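(* Let $\beta>0$ and let $(\gamma_n)$ be a sequence with $\gamma_n>0$ and $\gamma_n=\Theta(1)$. Consider a sequence of switch systems with Bernoulli arrivals indexed by $n$, where the $n$-th system is an $n\times n$ switch in which every $a^{(n)}_{ij}(t)$ is Bernoulli with mean $\lambda^{(n)}_{ij}=\frac{1-\gamma_n n^{-\beta}}{n}$, where $0<\gamma_n n^{-\beta}<1$ (so the load is $\rho^{(n)}=1-\gamma_n n^{-\beta}$). (i) Fix a scheduling policy under which the switch system is stable for any $n>0$, and suppose that the queue length process $\mathbf q^{(n)}(t)$ converges in distribution to a steady state random vector $\overline{\mathbf q}^{(n)}$. Then for each of these systems $$\mathbb E\Big[\sum_{ij}\overline q_{ij}^{(n)}\Big]\ge\frac{(1-\gamma_n n^{-\beta})^2}{2\gamma_n}\,n^\beta(n-1),$$ and so the expected sum queue length is $\Omega(n^{1+\beta})$. (ii) Under the MaxWeight scheduling policy, $\mathbf q^{(n)}(t)$ is positive recurrent and so converges in distribution to a steady state random vector $\overline{\mathbf q}^{(n)}$. If $\beta>4$, then there are functions $B_3(n)$ and $B_4(n)$, both $o(n^{1+\beta})$, such that whenever $2\gamma_n\le n^{\beta-1}$, $$\frac{n^{1+\beta}}{\gamma_n}-B_3(n)\le\mathbb E\Big[\sum_{ij}\overline q_{ij}^{(n)}\Big]\le\frac{n^{1+\beta}}{\gamma_n}+B_4(n).$$ Thus (for $\beta>4$), under MaxWeight the expected sum queue length is $\Theta(n^{1+\beta})$ and so has optimal scaling.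
   Context: Switch model (discrete time, $n\times n$). $q_{ij}(t)\in\mathbb Z_+$, $1\le i,j\le n$, is the queue length for the input-output pair $(i,j)$, $a_{ij}(t)$ is the number of arrivals to it in slot $t$. Arrivals are i.i.d. across $t$, independent across pairs $(i,j)$, and independent of the queue lengths and schedules. Feasible schedules: $\mathcal S=\{s\in\{0,1\}^{n^2}:\sum_i s_{ij}\le1\ \forall j,\ \sum_j s_{ij}\le1\ \forall i\}$; maximal schedules: $\mathcal S^*=\{s\in\{0,1\}^{n^2}:\sum_i s_{ij}=1\ \forall j,\ \sum_j s_{ij}=1\ \forall i\}$. A scheduling policy picks $\mathbf s(t)\in\mathcal S$ in every slot based on the current queue length vector $\mathbf q(t)$, before the arrivals $\mathbf a(t)$ occur. Queues evolve as $q_{ij}(t+1)=[q_{ij}(t)+a_{ij}(t)-s_{ij}(t)]^+$, and $\mathbf q(t)$ is a Markov chain. The switch is stable under a policy if $\limsup_{C\to\infty}\limsup_{t\to\infty}\mathbb P(\sum_{ij}q_{ij}(t)\ge C)=0$. MaxWeight algorithm: $\mathbf s(t)\in\arg\max_{s\in\mathcal S}\sum_{ij}q_{ij}(t)s_{ij}$, ties broken uniformly at random; the chosen schedule is always taken to be a maximal one, $\mathbf s(t)\in\mathcal S^*$ (the maximum over $\mathcal S$ is always attained in $\mathcal S^*$). Under it, $\mathbf q(t)$ is irreducible and aperiodic on the appropriate state space. Asymptotic notation $\Theta,\Omega,o$ is as $n\to\infty$. *)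

theory Defs
  imports "HOL-Probability.Probability" "HOL-Library.Landau_Symbols"
begin

primrec chain_law :: "('s \<Rightarrow> 's pmf) \<Rightarrow> 's pmf \<Rightarrow> nat \<Rightarrow> 's pmf" where
  "chain_law K \<mu> 0 = \<mu>"
| "chain_law K \<mu> (Suc t) = bind_pmf (chain_law K \<mu> t) K"

definition reachable :: "('s \<Rightarrow> 's pmf) \<Rightarrow> 's \<Rightarrow> 's set" where
  "reachable K x = {y. (\<lambda>u v. v \<in> set_pmf (K u))\<^sup>*\<^sup>* x y}"

text \<open>\<open>first_hit K x t y\<close> is the probability that the chain started in \<open>y\<close> visits \<open>x\<close> at time
  \<open>t + 1\<close> for the first time (the starting time 0 is not counted as a visit).\<close>

primrec first_hit :: "('s \<Rightarrow> 's pmf) \<Rightarrow> 's \<Rightarrow> nat \<Rightarrow> 's \<Rightarrow> real" where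
  "first_hit K x 0 y = pmf (K y) x"
| "first_hit K x (Suc t) y =
     measure_pmf.expectation (K y) (\<lambda>z. if z = x then 0 else first_hit K x t z)"

text \<open>The return time is almost surely finite and has finite mean.\<close>

definition positive_recurrent :: "('s \<Rightarrow> 's pmf) \<Rightarrow> 's \<Rightarrow> bool" where
  "positive_recurrent K x \<longleftrightarrow>
     (\<lambda>t. first_hit K x t x) sums 1 \<and> summable (\<lambda>t. real (t + 1) * first_hit K x t x)"

definition stationary :: "('s \<Rightarrow> 's pmf) \<Rightarrow> 's pmf \<Rightarrow> bool" where
  "stationary K \<pi> \<longleftrightarrow> bind_pmf \<pi> K = \<pi>"

text \<open>Weak convergence of laws on a discrete space, where every function is continuous.\<close>

definition converges_in_distribution :: "(nat \<Rightarrow> 's pmf) \<Rightarrow> 's pmf \<Rightarrow> bool" where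
  "converges_in_distribution X \<pi> \<longleftrightarrow>
     (\<forall>f :: 's \<Rightarrow> real. bounded (range f) \<longrightarrow>
        (\<lambda>t. measure_pmf.expectation (X t) f) \<longlonglongrightarrow> measure_pmf.expectation \<pi> f)"

text \<open>Since \<open>n\<close> varies, an \<open>n \<times> n\<close> array of naturals is a function on pairs of
  indices that vanishes outside \<open>pairs n\<close>.\<close>

type_synonym arr = "nat \<times> nat \<Rightarrow> nat"

definition pairs :: "nat \<Rightarrow> (nat \<times> nat) set" where
  "pairs n = {1..n} \<times> {1..n}"

definition queues :: "nat \<Rightarrow> arr set" where
  "queues n = {q. \<forall>ij. ij \<notin> pairs n \<longrightarrow> q ij = 0}"

definition feasible :: "nat \<Rightarrow> arr set" where
  "feasible n = {s \<in> queues n. (\<forall>ij. s ij \<in> {0, 1}) \<and>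
     (\<forall>j\<in>{1..n}. (\<Sum>i=1..n. s (i, j)) \<le> 1) \<and> (\<forall>i\<in>{1..n}. (\<Sum>j=1..n. s (i, j)) \<le> 1)}"

definition maximal :: "nat \<Rightarrow> arr set" where
  "maximal n = {s \<in> queues n. (\<forall>ij. s ij \<in> {0, 1}) \<and>
     (\<forall>j\<in>{1..n}. (\<Sum>i=1..n. s (i, j)) = 1) \<and> (\<forall>i\<in>{1..n}. (\<Sum>j=1..n. s (i, j)) = 1)}"

text \<open>A policy draws the schedule, possibly at random, given the current queue lengths.\<close>

type_synonym policy = "arr \<Rightarrow> arr pmf"

definition scheduling_policy :: "nat \<Rightarrow> policy \<Rightarrow> bool" where
  "scheduling_policy n pol \<longleftrightarrow> (\<forall>q\<in>queues n. set_pmf (pol q) \<subseteq> feasible n)"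

text \<open>The maximum over the feasible schedules is attained at a maximal one, so the finite set
  from which a uniform choice is made is not empty.\<close>

definition max_weight :: "nat \<Rightarrow> policy" where
  "max_weight n q = pmf_of_set {s \<in> maximal n.
     is_arg_max (\<lambda>s. \<Sum>ij\<in>pairs n. q ij * s ij) (\<lambda>s. s \<in> feasible n) s}"

text \<open>One time slot, for arrivals with distribution \<open>A ij\<close> at the pair \<open>ij\<close>. The arrivals are
  drawn afresh in every slot, independently across pairs and of the queues and the schedule.
  Subtraction on \<open>nat\<close> is truncated and so gives the positive part.\<close>

definition switch_kernel :: "nat \<Rightarrow> (nat \<times> nat \<Rightarrow> nat pmf) \<Rightarrow> policy \<Rightarrow> arr \<Rightarrow> arr pmf" where
  "switch_kernel n A pol q =
     bind_pmf (pol q) (\<lambda>s. bind_pmf (Pi_pmf (pairs n) 0 A) (\<lambda>a.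
       return_pmf (\<lambda>ij. q ij + a ij - s ij)))"

definition total :: "nat \<Rightarrow> arr \<Rightarrow> real" where
  "total n q = (\<Sum>ij\<in>pairs n. real (q ij))"

definition stable :: "nat \<Rightarrow> (nat \<Rightarrow> arr pmf) \<Rightarrow> bool" where
  "stable n X \<longleftrightarrow>
     Limsup at_top (\<lambda>C::real. limsup (\<lambda>t.
       ereal (measure_pmf.prob (X t) {q. total n q \<ge> C}))) = 0"

text \<open>The expectation may be infinite.\<close>

definition expected_total :: "nat \<Rightarrow> arr pmf \<Rightarrow> ereal" where
  "expected_total n \<pi> = enn2ereal (\<integral>\<^sup>+ q. ennreal (total n q) \<partial>measure_pmf \<pi>)"

definition load :: "real \<Rightarrow> (nat \<Rightarrow> real) \<Rightarrow> nat \<Rightarrow> real" where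
  "load \<beta> \<gamma> n = 1 - \<gamma> n * real n powr (- \<beta>)"

definition bernoulli_arrivals :: "real \<Rightarrow> (nat \<Rightarrow> real) \<Rightarrow> nat \<Rightarrow> nat \<times> nat \<Rightarrow> nat pmf" where
  "bernoulli_arrivals \<beta> \<gamma> n ij = map_pmf of_bool (bernoulli_pmf (load \<beta> \<gamma> n / real n))"

definition heavy_kernel :: "real \<Rightarrow> (nat \<Rightarrow> real) \<Rightarrow> (nat \<Rightarrow> policy) \<Rightarrow> nat \<Rightarrow> arr \<Rightarrow> arr pmf" where
  "heavy_kernel \<beta> \<gamma> pol n = switch_kernel n (bernoulli_arrivals \<beta> \<gamma> n) (pol n)"

text \<open>With the \<open>max_weight\<close> policy the empty state is accessible from every state, so the states
  reachable from it form the only closed communicating class, on which the chain is irreducible;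
  a state outside that class is transient and can only occur because of the initial law.\<close>

text \<open>Here \<open>\<mu> n\<close> is the law of the initial queue lengths of the \<open>n\<close>-th system and \<open>\<pi> n\<close> the law of
  its steady state vector.\<close>

definition stable_with_steady_state ::
  "real \<Rightarrow> (nat \<Rightarrow> real) \<Rightarrow> (nat \<Rightarrow> policy) \<Rightarrow> (nat \<Rightarrow> arr pmf) \<Rightarrow> (nat \<Rightarrow> arr pmf) \<Rightarrow> bool" where
  "stable_with_steady_state \<beta> \<gamma> pol \<mu> \<pi> \<longleftrightarrow>
     (\<forall>n>0. scheduling_policy n (pol n) \<and> set_pmf (\<mu> n) \<subseteq> queues n \<and>
        stable n (chain_law (heavy_kernel \<beta> \<gamma> pol n) (\<mu> n)) \<and>
        converges_in_distribution (chain_law (heavy_kernel \<beta> \<gamma> pol n) (\<mu> n)) (\<pi> n))"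

end

theory Submission
  imports Defs
begin

text \<open>Lower bound: in steady state a row sum \<open>W\<close> of the queue lengths satisfies
  \<open>W' \<ge> (W + A - 1)\<^sup>+\<close> with \<open>A\<close> binomial, and the drift of \<open>W\<^sup>2 + W\<close> bounds its mean from below as
  for a discrete-time single-server queue.

  MaxWeight: the squared norm is a Lyapunov function, since the average of the permutation schedules
  is the uniform one. Its drift gives tightness of the Cesaro averages, hence a stationary law; two
  copies of the chain couple because a harmonic function that vanishes on the diagonal attains its
  maximum and must vanish; Kac's identity gives positive recurrence.

  Heavy traffic: let \<open>K\<close> be the cone of arrays \<open>w i + z j\<close> with \<open>w, z \<ge> 0\<close>. By Birkhoff's theorem
  MaxWeight beats every doubly substochastic matrix, in particular the uniform one perturbed in the
  direction of \<open>q\<close> minus its projection onto \<open>K\<close>. So the distance \<open>Y\<close> to \<open>K\<close> has drift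
  \<open>- 1 / (2 n)\<close> uniformly in the load, and the drift of \<open>Y\<^sup>4\<close> shows that \<open>Y\<^sup>3\<close> has mean \<open>O(n\<^sup>6)\<close>.
  Setting the drift of the squared norm of the projection onto the span of \<open>K\<close> to zero determines
  the mean total queue length up to an error of the form \<open>n E[Y \<surd>U]\<close>, where the unused service \<open>U\<close>
  has mean \<open>n\<close> times the slack \<open>\<gamma> n powr - \<beta>\<close>; the third moment makes this negligible exactly when
  \<open>\<beta> > 4\<close>.\<close>

section \<open>Markov chains with finitely many successors\<close>

text \<open>The threshold for \<beta> is a balance of exponents. Since U is an integer, Y sqrt U <=
  Y^3 / S^2 + S U for every S > 0. With E[Y^3] = O(n^6), the error n E[Y sqrt U] is O(n^7 / S^2 +
  n^2 S slack). Divided by the slack, of order n^(-\<beta>), it must be o(n^(1 + \<beta>)), which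
  asks n^3 << S << n^(\<beta> - 1); such an S exists when \<beta> > 4. Second moments of Y and
  Cauchy-Schwarz would give \<beta> > 5 by the same count, hence the fourth power as Lyapunov
  function. The obstacle throughout is integrability: a stationary law comes without moments, so a
  drift inequality cannot simply be integrated. \<open>stationary_drift_bound\<close> therefore sums
  a truncated functional along the chain, and the fourth power of the norm is used to make the
  squared norm integrable; its constants may depend on the slack. The cone and its span play
  different roles. The cone gives the residual nonpositive line sums, which the comparison with
  MaxWeight needs; the projection onto the span is linear, so the mean drift of its squared norm can
  be computed exactly.\<close>

abbreviation mean :: "'s pmf \<Rightarrow> ('s \<Rightarrow> real) \<Rightarrow> real" where
  "mean p \<equiv> measure_pmf.expectation p"

lemma mean_mono_finite:
  fixes f g :: "'s \<Rightarrow> real"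
  assumes "finite (set_pmf p)" and "\<And>x. x \<in> set_pmf p \<Longrightarrow> f x \<le> g x"
  shows "mean p f \<le> mean p g"
  using assms by (intro integral_mono_AE integrable_measure_pmf_finite) (auto simp: AE_measure_pmf_iff)

lemma mean_le_bound_finite:
  fixes f :: "'s \<Rightarrow> real"
  assumes "finite (set_pmf p)" and "\<And>x. x \<in> set_pmf p \<Longrightarrow> f x \<le> c"
  shows "mean p f \<le> c"
  using mean_mono_finite[of p f "\<lambda>_. c", OF assms] by simp

lemma mean_bind_finite:
  fixes f :: "'s \<Rightarrow> real"
  assumes "finite (set_pmf p)" and "\<And>x. x \<in> set_pmf p \<Longrightarrow> finite (set_pmf (k x))"
  shows "mean (bind_pmf p k) f
    = mean p (\<lambda>x. mean (k x) f)"
  by (subst pmf_expectation_bind[of "set_pmf p"], use assms in simp_all)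
     (subst integral_measure_pmf[of "set_pmf p"], use assms in simp_all)

text \<open>Tonelli for the extended nonnegative integral needs no integrability in advance; finite
  supports turn the inner integrals into real means, and integrability of the outer function comes
  out as a conclusion.\<close>

lemma mean_bind_nonneg:
  fixes f :: "'s \<Rightarrow> real"
  assumes nn: "\<And>x. 0 \<le> f x" and int: "integrable (measure_pmf (bind_pmf p k)) f"
    and fin: "\<And>x. x \<in> set_pmf p \<Longrightarrow> finite (set_pmf (k x))"
  shows "integrable (measure_pmf p) (\<lambda>x. mean (k x) f)"
    and "mean p (\<lambda>x. mean (k x) f)
      = mean (bind_pmf p k) f"
proof -
  have nnE: "0 \<le> mean (k x) f" for x
    by (simp add: nn)
  have "(\<integral>\<^sup>+x. ennreal (f x) \<partial>bind_pmf p k)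
      = (\<integral>\<^sup>+x. ennreal (mean (k x) f) \<partial>p)"
    unfolding nn_integral_bind_pmf
    by (intro nn_integral_cong_AE)
       (auto simp: AE_measure_pmf_iff nn intro!: nn_integral_eq_integral integrable_measure_pmf_finite fin)
  moreover have "(\<integral>\<^sup>+x. ennreal (f x) \<partial>bind_pmf p k)
      = ennreal (mean (bind_pmf p k) f)"
    by (intro nn_integral_eq_integral int) (simp add: nn)
  ultimately have eq: "(\<integral>\<^sup>+x. ennreal (mean (k x) f) \<partial>p)
      = ennreal (mean (bind_pmf p k) f)"
    by simp
  then have h: "has_bochner_integral (measure_pmf p) (\<lambda>x. mean (k x) f)
      (mean (bind_pmf p k) f)"
    by (intro has_bochner_integral_nn_integral) (auto simp: nn nnE)
  then show "integrable (measure_pmf p) (\<lambda>x. mean (k x) f)"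
    by (simp add: has_bochner_integral_iff)
  show "mean p (\<lambda>x. mean (k x) f)
      = mean (bind_pmf p k) f"
    using h by (simp add: has_bochner_integral_iff)
qed

lemma integrable_bounded_pmf:
  fixes f :: "'s \<Rightarrow> real"
  assumes "\<And>x. \<bar>f x\<bar> \<le> c"
  shows "integrable (measure_pmf p) f"
  by (rule measure_pmf.integrable_const_bound[where B = c]) (simp_all add: assms)

lemma abs_mean_le:
  fixes f :: "'s \<Rightarrow> real"
  assumes "\<And>x. \<bar>f x\<bar> \<le> c"
  shows "\<bar>mean p f\<bar> \<le> c"
proof -
  have "\<bar>mean p f\<bar> \<le> mean p (\<lambda>x. \<bar>f x\<bar>)"
    by (rule integral_abs_bound)
  also have "\<dots> \<le> mean p (\<lambda>x. c)"
    by (intro integral_mono) (auto intro!: integrable_bounded_pmf[where c = c] simp: assms)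
  finally show ?thesis by simp
qed

text \<open>Adding \<open>c\<close> makes the integrand nonnegative, so Tonelli applies without
  finite supports.\<close>

lemma mean_bind_bounded:
  fixes f :: "'s \<Rightarrow> real"
  assumes b: "\<And>x. \<bar>f x\<bar> \<le> c"
  shows "mean (bind_pmf p k) f
    = mean p (\<lambda>x. mean (k x) f)"
proof -
  note ib = integrable_bounded_pmf[of f c, OF b]
  have nn: "0 \<le> f x + c" for x
    using b[of x] by linarith
  have c: "0 \<le> mean (k x) f + c" for x
    using abs_mean_le[of f c "k x", OF b] by linarith
  have "ennreal (mean (bind_pmf p k) (\<lambda>x. f x + c))
      = (\<integral>\<^sup>+x. ennreal (f x + c) \<partial>bind_pmf p k)"
    by (intro nn_integral_eq_integral[symmetric]) (auto simp: nn ib)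
  also have "\<dots> = (\<integral>\<^sup>+x. ennreal (mean (k x) (\<lambda>x. f x + c)) \<partial>p)"
    unfolding nn_integral_bind_pmf
    by (intro nn_integral_cong nn_integral_eq_integral) (auto simp: nn ib)
  also have "\<dots> = (\<integral>\<^sup>+x. ennreal (mean (k x) f + c) \<partial>p)"
    by (simp add: ib)
  also have "\<dots> = ennreal (mean p (\<lambda>x. mean (k x) f + c))"
    by (intro nn_integral_eq_integral Bochner_Integration.integrable_add
          integrable_bounded_pmf[where c = c] abs_mean_le b)
       (simp_all add: c order_trans[OF abs_ge_zero b])
  finally have "mean (bind_pmf p k) (\<lambda>x. f x + c)
      = mean p (\<lambda>x. mean (k x) f + c)"
    by (subst (asm) ennreal_inj) (auto intro!: Bochner_Integration.integral_nonneg nn c)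
  then show ?thesis
    by (simp add: ib integrable_bounded_pmf[where c = c] abs_mean_le b)
qed

text \<open>Finitely many successors make every real function integrable over one step from
  \<open>Q\<close>, so unbounded Lyapunov functions have a drift without any moment
  condition.\<close>

locale finite_step_chain =
  fixes K :: "'s \<Rightarrow> 's pmf" and Q :: "'s set"
  assumes closed: "x \<in> Q \<Longrightarrow> set_pmf (K x) \<subseteq> Q"
    and finite_step: "x \<in> Q \<Longrightarrow> finite (set_pmf (K x))"
begin

abbreviation step :: "('s \<Rightarrow> real) \<Rightarrow> 's \<Rightarrow> real" where
  "step f x \<equiv> mean (K x) f"

lemma integrable_step: "x \<in> Q \<Longrightarrow> integrable (measure_pmf (K x)) (f :: 's \<Rightarrow> real)"
  by (simp add: finite_step integrable_measure_pmf_finite)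

lemma step_mono:
  assumes "x \<in> Q" and "\<And>y. y \<in> Q \<Longrightarrow> f y \<le> g y"
  shows "step f x \<le> step g x"
  using assms closed by (intro mean_mono_finite finite_step) auto

lemma stationary_step_bounded:
  assumes "stationary K \<pi>" and "\<And>x. \<bar>f x\<bar> \<le> c"
  shows "mean \<pi> (step f) = mean \<pi> f"
  using mean_bind_bounded[of f c \<pi> K] assms by (simp add: stationary_def)

lemma stationary_step_nonneg:
  assumes "stationary K \<pi>" "set_pmf \<pi> \<subseteq> Q" "\<And>x. 0 \<le> f x" "integrable (measure_pmf \<pi>) f"
  shows "integrable (measure_pmf \<pi>) (step f)"
    and "mean \<pi> (step f) = mean \<pi> f"
  using mean_bind_nonneg[of f \<pi> K] assms finite_step
  by (auto simp: stationary_def subset_iff)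

text \<open>Whether \<open>f\<close> is integrable under \<open>\<pi>\<close> is unknown. The drift
  is therefore summed pointwise over \<open>N\<close> steps with \<open>g\<close> truncated at
  \<open>m\<close>; averaging over \<open>\<pi>\<close> and dividing by \<open>N\<close> removes the
  initial value \<open>f x\<close>, and monotone convergence in \<open>m\<close> removes the
  truncation.\<close>

lemma stationary_drift_bound:
  assumes st: "stationary K \<pi>" and sub: "set_pmf \<pi> \<subseteq> Q"
    and f: "\<And>x. x \<in> Q \<Longrightarrow> 0 \<le> f x" and g: "\<And>x. 0 \<le> g x" and b: "0 \<le> b"
    and drift: "\<And>x. x \<in> Q \<Longrightarrow> step f x \<le> f x - g x + b"
  shows "integrable (measure_pmf \<pi>) g" and "mean \<pi> g \<le> b"
proof -
  have trunc: "mean \<pi> (\<lambda>x. min (g x) (real m)) \<le> b" for m :: nat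
  proof -
    define h where "h = (\<lambda>x. min (g x) (real m))"
    have h: "0 \<le> h x" "h x \<le> real m" "h x \<le> g x" for x
      by (auto simp: h_def g)
    \<comment> \<open>\<open>S N x\<close> is the expected sum of \<open>h\<close> over the first
      \<open>N\<close> states of the chain started in \<open>x\<close>, time 0 included. It is
      bounded, so stationarity applies to it.\<close>
    define S where "S = rec_nat (\<lambda>_. 0) (\<lambda>_ s x. h x + step s x)"
    have S0: "S 0 = (\<lambda>_. 0)" and SS: "S (Suc N) = (\<lambda>x. h x + step (S N) x)" for N
      by (auto simp: S_def)
    have Snn: "0 \<le> S N x" for N x
      by (induction N arbitrary: x) (auto simp: S0 SS h intro!: add_nonneg_nonneg integral_nonneg_AE)
    have Sm: "S N x \<le> real N * real m" for N x
    proof (induction N arbitrary: x)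
      case (Suc N)
      have "\<bar>S N y\<bar> \<le> real N * real m" for y
        using Suc.IH[of y] Snn[of N y] by linarith
      then have "step (S N) x \<le> real N * real m"
        using abs_mean_le[of "S N" "real N * real m" "K x"] by fastforce
      then show ?case
        using h(2)[of x] by (simp add: SS algebra_simps)
    qed (simp add: S0)
    have Sabs: "\<bar>S N x\<bar> \<le> real N * real m" for N x
      using Snn[of N x] Sm[of N x] by linarith
    have Sf: "x \<in> Q \<Longrightarrow> S N x \<le> f x + real N * b" for N x
    proof (induction N arbitrary: x)
      case (Suc N)
      have "step (S N) x \<le> step (\<lambda>y. f y + real N * b) x"
        using Suc by (intro step_mono) auto
      also have "\<dots> = step f x + real N * b"
        by (simp add: integrable_step Suc.prems)
      finally show ?case
        using h(3)[of x] drift[OF Suc.prems] by (simp add: SS algebra_simps)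
    qed (simp add: S0 f)
    have ES: "mean \<pi> (S N) = real N * mean \<pi> h" for N
    proof (induction N)
      case (Suc N)
      have "mean \<pi> (S (Suc N))
          = mean \<pi> h + mean \<pi> (step (S N))"
        unfolding SS
        by (intro Bochner_Integration.integral_add integrable_bounded_pmf[where c = "real m"]
              integrable_bounded_pmf[where c = "real N * real m"] abs_mean_le Sabs)
           (use h in auto)
      then show ?case
        using Suc by (simp add: stationary_step_bounded[OF st Sabs] algebra_simps)
    qed (simp add: S0)
    \<comment> \<open>The cap at \<open>m\<close> keeps the majorant bounded, so dominated
      convergence can send \<open>N\<close> to infinity; the absolute value matters only outside
      \<open>Q\<close>, a null set.\<close>
    have le: "mean \<pi> h
        \<le> mean \<pi> (\<lambda>x. min (real m) (\<bar>f x\<bar> / real (Suc N) + b))" for N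
    proof -
      have "mean \<pi> h
          = mean \<pi> (\<lambda>x. S (Suc N) x / real (Suc N))"
        using ES[of "Suc N"] by simp
      also have "\<dots> \<le> mean \<pi> (\<lambda>x. min (real m) (\<bar>f x\<bar> / real (Suc N) + b))"
      proof (intro integral_mono_AE)
        show "integrable (measure_pmf \<pi>) (\<lambda>x. S (Suc N) x / real (Suc N))"
          by (intro Bochner_Integration.integrable_divide
                integrable_bounded_pmf[where c = "real (Suc N) * real m"] Sabs)
        show "integrable (measure_pmf \<pi>) (\<lambda>x. min (real m) (\<bar>f x\<bar> / real (Suc N) + b))"
          by (intro integrable_bounded_pmf[where c = "real m"]) (use b in \<open>auto simp: min_def\<close>)
        show "AE x in measure_pmf \<pi>. S (Suc N) x / real (Suc N) \<le> min (real m) (\<bar>f x\<bar> / real (Suc N) + b)"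
        proof (rule AE_pmfI)
          fix x assume "x \<in> set_pmf \<pi>"
          then have x: "x \<in> Q" using sub by auto
          have "S (Suc N) x / real (Suc N) \<le> real m"
            using Sm[of "Suc N" x] by (simp add: divide_simps mult.commute)
          moreover have "S (Suc N) x / real (Suc N) \<le> (\<bar>f x\<bar> + real (Suc N) * b) / real (Suc N)"
            using Sf[OF x, of "Suc N"] by (intro divide_right_mono) auto
          ultimately show "S (Suc N) x / real (Suc N) \<le> min (real m) (\<bar>f x\<bar> / real (Suc N) + b)"
            by (simp add: add_divide_distrib del: of_nat_Suc)
        qed
      qed
      finally show ?thesis .
    qed
    have "(\<lambda>N. mean \<pi> (\<lambda>x. min (real m) (\<bar>f x\<bar> / real (Suc N) + b)))
        \<longlonglongrightarrow> mean \<pi> (\<lambda>x. min (real m) b)"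
    proof (rule integral_dominated_convergence[where w = "\<lambda>_. real m"])
      show "AE x in measure_pmf \<pi>. (\<lambda>N. min (real m) (\<bar>f x\<bar> / real (Suc N) + b)) \<longlonglongrightarrow> min (real m) b"
      proof (rule AE_I2)
        fix x
        have "(\<lambda>N. \<bar>f x\<bar> / real (Suc N)) \<longlonglongrightarrow> 0"
          using LIMSEQ_Suc[OF lim_const_over_n[of "\<bar>f x\<bar>"]] by simp
        then have "(\<lambda>N. min (real m) (\<bar>f x\<bar> / real (Suc N) + b)) \<longlonglongrightarrow> min (real m) (0 + b)"
          by (intro tendsto_intros)
        then show "(\<lambda>N. min (real m) (\<bar>f x\<bar> / real (Suc N) + b)) \<longlonglongrightarrow> min (real m) b"
          by simp
      qed
    qed (use b in \<open>auto simp: min_def\<close>)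
    then have "mean \<pi> h \<le> mean \<pi> (\<lambda>x. min (real m) b)"
      by (rule LIMSEQ_le_const) (use le in auto)
    then show ?thesis
      by (simp add: h_def)
  qed
  have mono: "incseq (\<lambda>m x. ennreal (min (g x) (real m)))"
    by (intro incseq_SucI le_funI ennreal_leI) auto
  have sup: "(SUP m. ennreal (min (g x) (real m))) = ennreal (g x)" for x
  proof (rule antisym)
    show "(SUP m. ennreal (min (g x) (real m))) \<le> ennreal (g x)"
      by (intro SUP_least ennreal_leI) auto
    obtain m :: nat where "g x \<le> real m"
      using real_arch_simple by blast
    then have "ennreal (g x) = ennreal (min (g x) (real m))"
      by simp
    then show "ennreal (g x) \<le> (SUP m. ennreal (min (g x) (real m)))"
      using SUP_upper[of m UNIV "\<lambda>m. ennreal (min (g x) (real m))"] by simp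
  qed
  have "(\<integral>\<^sup>+x. ennreal (g x) \<partial>\<pi>) = (SUP m. \<integral>\<^sup>+x. ennreal (min (g x) (real m)) \<partial>\<pi>)"
    unfolding sup[symmetric] by (rule nn_integral_monotone_convergence_SUP[OF mono]) auto
  also have "\<dots> \<le> ennreal b"
  proof (rule SUP_least)
    fix m :: nat
    have "(\<integral>\<^sup>+x. ennreal (min (g x) (real m)) \<partial>\<pi>)
        = ennreal (mean \<pi> (\<lambda>x. min (g x) (real m)))"
      by (intro nn_integral_eq_integral integrable_bounded_pmf[where c = "real m"]) (auto simp: g)
    then show "(\<integral>\<^sup>+x. ennreal (min (g x) (real m)) \<partial>\<pi>) \<le> ennreal b"
      using trunc[of m] by (simp add: ennreal_leI)
  qed
  finally have bd: "(\<integral>\<^sup>+x. ennreal (g x) \<partial>\<pi>) \<le> ennreal b" .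
  then show int: "integrable (measure_pmf \<pi>) g"
    by (intro integrableI_nonneg) (auto simp: g order_le_less_trans[OF bd])
  show "mean \<pi> g \<le> b"
    using bd nn_integral_eq_integral[OF int] b by (simp add: g)
qed

end

text \<open>\<open>v t y\<close> is the probability that the chain started in \<open>y\<close>
  avoids \<open>x\<close> at the times 1 to \<open>t\<close>, so its decrease at the next step is
  the chance of a first visit at time \<open>t + 1\<close>.\<close>

lemma first_hit_eq_diff:
  fixes K :: "'s \<Rightarrow> 's pmf" and x :: 's and v
  assumes v0: "v 0 = (\<lambda>_. 1 :: real)"
    and vS: "\<And>t. v (Suc t) = (\<lambda>y. mean (K y) (\<lambda>z. if z = x then 0 else v t z))"
    and b: "\<And>t y. 0 \<le> v t y \<and> v t y \<le> 1"
  shows "first_hit K x t y = v t y - v (Suc t) y"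
proof (induction t arbitrary: y)
  case 0
  have "mean (K y) (\<lambda>z. 1 - indicator {x} z)
      = 1 - mean (K y) (indicator {x} :: 's \<Rightarrow> real)"
    by (subst Bochner_Integration.integral_diff) (auto intro!: integrable_bounded_pmf[where c = 1])
  moreover have "(\<lambda>z. if z = x then 0 else 1 :: real) = (\<lambda>z. 1 - indicator {x} z)"
    by (auto simp: fun_eq_iff indicator_def)
  ultimately show ?case
    unfolding first_hit.simps(1) vS v0 by (simp add: pmf.rep_eq)
next
  case (Suc t)
  have "first_hit K x (Suc t) y = mean (K y)
      (\<lambda>z. (if z = x then 0 else v t z) - (if z = x then 0 else v (Suc t) z))"
    unfolding first_hit.simps(2) Suc.IH by (rule arg_cong[where f = "integral\<^sup>L _"]) (rule ext, simp)
  also have "\<dots> = v (Suc t) y - v (Suc (Suc t)) y"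
    unfolding vS[of t] vS[of "Suc t"]
  proof (rule Bochner_Integration.integral_diff)
    have "\<bar>if z = x then 0 else v s z\<bar> \<le> 1" for s z
      using b[of s z] by auto
    then show "integrable (measure_pmf (K y)) (\<lambda>z. if z = x then 0 else v t z)"
      and "integrable (measure_pmf (K y)) (\<lambda>z. if z = x then 0
        else mean (K z) (\<lambda>z. if z = x then 0 else v t z))"
      unfolding vS[symmetric, THEN fun_cong] by (auto intro!: integrable_bounded_pmf[where c = 1])
  qed
  finally show ?case .
qed

text \<open>Kac's argument: under the stationary law, the probability of avoiding \<open>x\<close> for \<open>t\<close> steps
  decreases at step \<open>t\<close> by the probability of starting in \<open>x\<close> and not returning for \<open>t\<close> steps.\<close>

lemma stationary_imp_positive_recurrent:
  assumes st: "stationary K \<pi>" and pos: "x \<in> set_pmf \<pi>"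
  shows "positive_recurrent K x"
proof -
  define v where "v = rec_nat (\<lambda>_. 1 :: real)
    (\<lambda>_ w y. mean (K y) (\<lambda>z. if z = x then 0 else w z))"
  have v0: "v 0 = (\<lambda>_. 1)"
    and vS: "v (Suc t) = (\<lambda>y. mean (K y) (\<lambda>z. if z = x then 0 else v t z))" for t
    unfolding v_def by simp_all
  have b: "0 \<le> v t y \<and> v t y \<le> 1" for t y
  proof (induction t arbitrary: y)
    case (Suc t)
    have "\<bar>mean (K y) (\<lambda>z. if z = x then 0 else v t z)\<bar> \<le> 1"
      using Suc by (intro abs_mean_le) auto
    moreover have "0 \<le> mean (K y) (\<lambda>z. if z = x then 0 else v t z)"
      using Suc by (intro integral_nonneg_AE) auto
    ultimately show ?case by (simp add: vS)
  qed (simp add: v0)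
  have fh: "first_hit K x t y = v t y - v (Suc t) y" for t y
    by (rule first_hit_eq_diff[OF v0 vS b])
  have hb: "\<bar>if z = x then 0 else v t z\<bar> \<le> 1" for t z
    using b[of t z] by auto
  have kac: "mean \<pi> (v (Suc t)) = mean \<pi> (v t) - pmf \<pi> x * v t x" for t
  proof -
    have "mean \<pi> (v (Suc t)) = mean \<pi> (\<lambda>z. if z = x then 0 else v t z)"
      unfolding vS using mean_bind_bounded[OF hb, where p = \<pi> and k = K] st by (simp add: stationary_def)
    also have "\<dots> = mean \<pi> (\<lambda>z. v t z - indicator {x} z * v t x)"
      by (rule arg_cong[where f = "integral\<^sup>L _"]) (auto simp: fun_eq_iff)
    also have "\<dots> = mean \<pi> (v t) - mean \<pi> (\<lambda>z. indicator {x} z * v t x)"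
      by (rule Bochner_Integration.integral_diff)
         (use b in \<open>auto intro!: integrable_bounded_pmf[where c = 1] simp: indicator_def\<close>)
    also have "mean \<pi> (\<lambda>z. indicator {x} z * v t x) = pmf \<pi> x * v t x"
      by (simp add: pmf.rep_eq)
    finally show ?thesis .
  qed
  \<comment> \<open>\<open>v t x\<close> is the tail of the return time, so the sum of these terms
    is the mean return time; Kac's identity bounds it by \<open>1 / pmf \<pi> x\<close>.\<close>
  have sumv: "pmf \<pi> x * (\<Sum>t<N. v t x) = 1 - mean \<pi> (v N)" for N
    by (induction N) (auto simp: v0 kac algebra_simps)
  have px: "pmf \<pi> x > 0"
    using pos by (simp add: pmf_positive)
  have sumle: "(\<Sum>t<N. v t x) \<le> 1 / pmf \<pi> x" for N
  proof -
    have "0 \<le> mean \<pi> (v N)"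
      using b by (intro integral_nonneg_AE) auto
    then show ?thesis
      using sumv[of N] px by (simp add: field_simps)
  qed
  \<comment> \<open>One bound yields both claims: the tails tend to 0, so return is certain, and
    Abel summation (\<open>weighted\<close>) turns the same bound into a finite mean.\<close>
  have sv: "summable (\<lambda>t. v t x)"
    by (rule bounded_imp_summable[where B = "1 / pmf \<pi> x"])
       (use b sumle[of "Suc _"] in \<open>auto simp: lessThan_Suc_atMost\<close>)
  have partial: "(\<Sum>t<N. first_hit K x t x) = 1 - v N x" for N
    by (induction N) (auto simp: v0 fh)
  have nn: "0 \<le> first_hit K x t y" for t y
  proof (induction t arbitrary: y)
    case (Suc t) then show ?case by (auto intro!: integral_nonneg_AE)
  qed simp
  have "(\<lambda>N. 1 - v N x) \<longlonglongrightarrow> 1 - 0"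
    by (intro tendsto_intros summable_LIMSEQ_zero[OF sv])
  then have 1: "(\<lambda>t. first_hit K x t x) sums 1"
    by (simp add: sums_def partial)
  have weighted: "(\<Sum>t<N. real (t + 1) * first_hit K x t x) = (\<Sum>t<N. v t x) - real N * v N x" for N
    by (induction N) (auto simp: fh algebra_simps)
  have "summable (\<lambda>t. real (t + 1) * first_hit K x t x)"
  proof (rule bounded_imp_summable[where B = "1 / pmf \<pi> x"])
    show "(\<Sum>t\<le>N. real (t + 1) * first_hit K x t x) \<le> 1 / pmf \<pi> x" for N
      using weighted[of "Suc N"] sumle[of "Suc N"] b[of "Suc N" x]
        mult_nonneg_nonneg[of "real (Suc N)" "v (Suc N) x"]
      unfolding lessThan_Suc_atMost by linarith
  qed (use nn in simp)
  with 1 show ?thesis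
    by (simp add: positive_recurrent_def)
qed

section \<open>Stationary laws: existence, convergence and support\<close>

context finite_step_chain
begin

lemma finite_set_chain_law:
  assumes "finite (set_pmf \<mu>)" "set_pmf \<mu> \<subseteq> Q"
  shows "finite (set_pmf (chain_law K \<mu> t)) \<and> set_pmf (chain_law K \<mu> t) \<subseteq> Q"
proof (induction t)
  case (Suc t)
  then show ?case using closed finite_step by (auto simp: subset_iff)
qed (use assms in simp)

text \<open>Telescoping: each step trades the mean of \<open>g\<close> for a decrease of the mean of
  \<open>f\<close>, up to \<open>b\<close>. Started from a point, the chain has a finitely supported
  law at every time, so all means exist.\<close>

lemma cesaro_drift:
  assumes x0: "x0 \<in> Q" and f: "\<And>x. x \<in> Q \<Longrightarrow> 0 \<le> f x"
    and drift: "\<And>x. x \<in> Q \<Longrightarrow> step f x \<le> f x - g x + b"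
  shows "(\<Sum>t<N. mean (chain_law K (return_pmf x0) t) g) \<le> f x0 + real N * b"
proof -
  let ?L = "chain_law K (return_pmf x0)"
  have L: "finite (set_pmf (?L t))" "set_pmf (?L t) \<subseteq> Q" for t
    using finite_set_chain_law[of "return_pmf x0" t] x0 by auto
  have ib: "integrable (measure_pmf (?L t)) (h :: 's \<Rightarrow> real)" for h t
    by (rule integrable_measure_pmf_finite[OF L(1)])
  have "(\<Sum>t<N. mean (?L t) g)
      \<le> f x0 + real N * b - mean (?L N) f"
  proof (induction N)
    case (Suc N)
    have "mean (?L (Suc N)) f = mean (?L N) (step f)"
      using L[of N] finite_step by (simp, subst mean_bind_finite) auto
    also have "\<dots> \<le> mean (?L N) (\<lambda>x. f x - g x + b)"
      using L[of N] drift by (intro mean_mono_finite) auto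
    also have "\<dots> = mean (?L N) f - mean (?L N) g + b"
      by (simp add: ib)
    finally show ?case using Suc by (simp add: algebra_simps)
  qed simp
  moreover have "0 \<le> mean (?L N) f"
    using L(2) f by (intro integral_nonneg_AE AE_pmfI) auto
  ultimately show ?thesis by linarith
qed

end

text \<open>Tychonoff in place of a diagonal extraction: the countable power of the unit interval is
  compact and metrisable, hence sequentially compact.\<close>

lemma bounded_family_subsequence:
  fixes F :: "nat \<Rightarrow> nat \<Rightarrow> real"
  assumes "\<And>N i. F N i \<in> {0..1}"
  shows "\<exists>r l. strict_mono r \<and> (\<forall>i. (\<lambda>k. F (r k) i) \<longlonglongrightarrow> l i)"
proof -
  have "compactin (product_topology (\<lambda>_::nat. euclidean :: real topology) UNIV) (PiE UNIV (\<lambda>_. {0..1}))"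
    by (subst compactin_PiE) auto
  then have "compact (PiE UNIV (\<lambda>_::nat. {0..1::real}))"
    by (simp add: euclidean_product_topology)
  then have "seq_compact (PiE UNIV (\<lambda>_::nat. {0..1::real}))"
    by (simp add: compact_eq_seq_compact_metric)
  moreover have "\<forall>n. F n \<in> PiE UNIV (\<lambda>_. {0..1})"
    using assms by (simp add: PiE_UNIV_domain)
  ultimately obtain l r where r: "strict_mono r" "(F \<circ> r) \<longlonglongrightarrow> l"
    by (rule seq_compactE)
  have "(\<lambda>k. F (r k) i) \<longlonglongrightarrow> l i" for i
  proof -
    have "isCont (\<lambda>x :: nat \<Rightarrow> real. x i) l"
      using continuous_on_eq_continuous_at[THEN iffD1, OF open_UNIV continuous_on_product_coordinates]
      by blast
    from isCont_tendsto_compose[OF this r(2)] show ?thesis by simp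
  qed
  with r show ?thesis by blast
qed

text \<open>The harmonic function of two independent copies of the chain that measures the failure to
  couple. A drift condition confines its maximum to finitely many pairs, and a harmonic function
  is constant along the way down to the diagonal, where it vanishes.\<close>

lemma (in finite_step_chain) harmonic_off_diagonal_zero:
  fixes h :: "'s \<times> 's \<Rightarrow> real" and \<rho> :: "'s \<Rightarrow> nat"
  assumes h0: "\<And>z. 0 \<le> h z" and hc: "\<And>z. h z \<le> c"
    and diag: "\<And>x. h (x, x) = 0"
    and harm: "\<And>x y. x \<in> Q \<Longrightarrow> y \<in> Q \<Longrightarrow> x \<noteq> y \<Longrightarrow>
      h (x, y) = mean (pair_pmf (K x) (K y)) h"
    and f: "\<And>x. x \<in> Q \<Longrightarrow> 0 \<le> f x" and g: "\<And>x. x \<in> Q \<Longrightarrow> 0 \<le> g x"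
    and drift: "\<And>x. x \<in> Q \<Longrightarrow> step f x \<le> f x - g x + b"
    and finf: "\<And>m. finite {x \<in> Q. f x \<le> m}" and fing: "\<And>m. finite {x \<in> Q. g x \<le> m}"
    and o: "o' \<in> set_pmf (K o')"
    and down: "\<And>x. x \<in> Q \<Longrightarrow> x \<noteq> o' \<Longrightarrow> \<exists>x'\<in>set_pmf (K x). \<rho> x' < \<rho> x"
    and xy: "x \<in> Q" "y \<in> Q"
  shows "h (x, y) = 0"
proof -
  define F where "F = (\<lambda>(x, y). f x + f y)"
  \<comment> \<open>Outside \<open>C\<close> the drift of \<open>F\<close> is at most -1.
    \<open>C\<close> is finite because both summands are nonnegative on \<open>Q\<close>.\<close>
  define C where "C = {(x, y) \<in> Q \<times> Q. g x + g y \<le> 2 * b + 1}"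
  have "C \<subseteq> {x \<in> Q. g x \<le> 2 * b + 1} \<times> {x \<in> Q. g x \<le> 2 * b + 1}"
    unfolding C_def using g by (clarsimp, smt (verit))
  then have finC: "finite C"
    by (rule finite_subset) (intro finite_cartesian_product fing)
  \<comment> \<open>Inserting 0 covers an empty \<open>C\<close> and the value of \<open>h\<close>
    on the diagonal.\<close>
  define M where "M = Max (insert 0 (h ` C))"
  have M0: "0 \<le> M" and MC: "z \<in> C \<Longrightarrow> h z \<le> M" for z
    using finC by (auto simp: M_def)
  have finp: "finite (set_pmf (pair_pmf (K x) (K y)))" if "x \<in> Q" "y \<in> Q" for x y
    using that finite_step by simp
  have subp: "set_pmf (pair_pmf (K x) (K y)) \<subseteq> Q \<times> Q" if "x \<in> Q" "y \<in> Q" for x y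
    using that closed by auto
  have EF: "mean (pair_pmf (K x) (K y)) F \<le> F (x, y) - 1"
    if "x \<in> Q" "y \<in> Q" "(x, y) \<notin> C" for x y
  proof -
    have "mean (pair_pmf (K x) (K y)) F
        = mean (pair_pmf (K x) (K y)) (\<lambda>z. f (fst z))
          + mean (pair_pmf (K x) (K y)) (\<lambda>z. f (snd z))"
      unfolding F_def case_prod_beta
      by (intro Bochner_Integration.integral_add integrable_measure_pmf_finite finp that)
    also have "\<dots> = step f x + step f y"
      by (simp add: expectation_pair_pmf_fst expectation_pair_pmf_snd)
    also have "\<dots> \<le> f x + f y - (g x + g y) + 2 * b"
      using drift[OF that(1)] drift[OF that(2)] by linarith
    also have "\<dots> \<le> F (x, y) - 1"
      using that by (simp add: C_def F_def)
    finally show ?thesis .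
  qed
  \<comment> \<open>Maximum principle with a penalty: \<open>h - \<eta> * F\<close> attains a
    maximum. If that exceeded \<open>M\<close>, the maximiser would lie outside \<open>C\<close> and
    off the diagonal, where \<open>h\<close> is harmonic and \<open>F\<close> decreases on average,
    so the average over the successors would exceed the maximum.\<close>
  have upper: "h z \<le> M + \<eta> * F z" if z: "z \<in> Q \<times> Q" and \<eta>: "\<eta> > 0" for z \<eta>
  proof (rule ccontr)
    assume "\<not> ?thesis"
    then have big: "M < h z - \<eta> * F z" by simp
    \<comment> \<open>Outside \<open>A\<close> the penalty exceeds that at \<open>z\<close> by more
      than \<open>c\<close>, which is more than \<open>h\<close> can gain; so the maximum over the
      finite set \<open>A\<close> is global.\<close>
    define A where "A = {w \<in> Q \<times> Q. F w \<le> F z + c / \<eta>}"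
    have "A \<subseteq> {x \<in> Q. f x \<le> F z + c / \<eta>} \<times> {x \<in> Q. f x \<le> F z + c / \<eta>}"
      unfolding A_def F_def using f by (clarsimp, smt (verit))
    then have "finite A"
      by (rule finite_subset) (intro finite_cartesian_product finf)
    have "0 \<le> c" using h0[of z] hc[of z] by linarith
    then have zA: "z \<in> A" using z \<eta> by (simp add: A_def)
    have "A \<noteq> {}"
      using zA by blast
    obtain w where w0: "w \<in> A" "Max ((\<lambda>v. h v - \<eta> * F v) ` A) = h w - \<eta> * F w"
      by (rule obtains_MAX[OF \<open>finite A\<close> \<open>A \<noteq> {}\<close>])
    have w: "w \<in> A" "\<And>v. v \<in> A \<Longrightarrow> h v - \<eta> * F v \<le> h w - \<eta> * F w"
      using w0 \<open>finite A\<close> by (auto simp flip: w0(2))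
    have wQ: "w \<in> Q \<times> Q" using w by (simp add: A_def)
    have max: "h v - \<eta> * F v \<le> h w - \<eta> * F w" if v: "v \<in> Q \<times> Q" for v
    proof (cases "v \<in> A")
      case False
      then have "F v > F z + c / \<eta>" using v by (simp add: A_def)
      then have "\<eta> * F v > \<eta> * F z + c" using \<eta> by (simp add: field_simps)
      then show ?thesis using hc[of v] h0[of z] w(2)[OF zA] by linarith
    qed (rule w)
    obtain x y where xy: "w = (x, y)" by force
    have xyQ: "x \<in> Q" "y \<in> Q" using wQ xy by auto
    have gt: "M < h w - \<eta> * F w" using max[OF z] big by linarith
    have "0 \<le> \<eta> * F w" using \<eta> f xyQ xy by (simp add: F_def)
    then have hw: "M < h w" using gt by linarith
    then have nC: "w \<notin> C" using MC[of w] by auto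
    have "x \<noteq> y" using hw diag M0 xy by auto
    then have "h w - \<eta> * F w < mean (pair_pmf (K x) (K y)) h
        - \<eta> * mean (pair_pmf (K x) (K y)) F"
      using harm[OF xyQ] EF[OF xyQ] nC \<eta> xy
        mult_left_mono[of "mean (pair_pmf (K x) (K y)) F" "F (x, y) - 1" \<eta>]
      by (simp add: algebra_simps)
    also have "\<dots> = mean (pair_pmf (K x) (K y)) (\<lambda>v. h v - \<eta> * F v)"
      by (subst Bochner_Integration.integral_diff)
         (simp_all add: integrable_measure_pmf_finite finp xyQ del: set_pair_pmf)
    also have "\<dots> \<le> h w - \<eta> * F w"
      using max subp[OF xyQ] by (intro mean_le_bound_finite finp xyQ) blast
    finally show False by simp
  qed
  \<comment> \<open>The penalty tends to 0: \<open>e / (F z + 1)\<close> keeps it below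
    \<open>e\<close> at \<open>z\<close>.\<close>
  have hM: "h z \<le> M" if z: "z \<in> Q \<times> Q" for z
  proof (rule field_le_epsilon)
    fix e :: real assume e: "e > 0"
    have F0: "0 \<le> F z" using z f by (auto simp: F_def)
    have "e * F z / (F z + 1) \<le> e"
      using e F0 by (simp add: field_simps)
    then show "h z \<le> M + e"
      using upper[OF z, of "e / (F z + 1)"] e F0 by simp
  qed
  \<comment> \<open>If \<open>h\<close> attains its maximum \<open>M\<close> at a pair off the
    diagonal, it does so at all successor pairs. One of them has smaller total rank, and the descent
    can only end on the diagonal, where \<open>h\<close> is 0.\<close>
  have max_zero: "M = 0" if "z \<in> Q \<times> Q" "h z = M" for z
    using that
  proof (induction "\<rho> (fst z) + \<rho> (snd z)" arbitrary: z rule: less_induct)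
    case less
    obtain x y where z: "z = (x, y)" by force
    have Q: "x \<in> Q" "y \<in> Q" using less.prems z by auto
    show ?case
    proof (cases "x = y")
      case True then show ?thesis using less.prems diag z by simp
    next
      case False
      have "\<exists>z'\<in>set_pmf (pair_pmf (K x) (K y)). \<rho> (fst z') + \<rho> (snd z') < \<rho> x + \<rho> y"
      \<comment> \<open>A coordinate already at \<open>o'\<close> waits there through its loop while
        the other descends; otherwise both descend at once.\<close>
      proof (cases "x = o' \<or> y = o'")
        case True
        then show ?thesis
        proof
          assume x: "x = o'"
          then obtain y' where "y' \<in> set_pmf (K y)" "\<rho> y' < \<rho> y"
            using down[OF Q(2)] False by auto
          then show ?thesis
            using o x by (intro bexI[of _ "(o', y')"]) auto
        next
          assume y: "y = o'"
          then obtain x' where "x' \<in> set_pmf (K x)" "\<rho> x' < \<rho> x"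
            using down[OF Q(1)] False by auto
          then show ?thesis
            using o y by (intro bexI[of _ "(x', o')"]) auto
        qed
      next
        case False
        then obtain x' y' where "x' \<in> set_pmf (K x)" "\<rho> x' < \<rho> x" "y' \<in> set_pmf (K y)" "\<rho> y' < \<rho> y"
          using down[OF Q(1)] down[OF Q(2)] by blast
        then show ?thesis
          by (intro bexI[of _ "(x', y')"]) auto
      qed
      then obtain z' where z': "z' \<in> set_pmf (pair_pmf (K x) (K y))"
        "\<rho> (fst z') + \<rho> (snd z') < \<rho> (fst z) + \<rho> (snd z)" by (auto simp: z)
      have z'Q: "z' \<in> Q \<times> Q" using z' subp[OF Q] by blast
      have int0: "mean (pair_pmf (K x) (K y)) (\<lambda>v. M - h v) = 0"
        using harm[OF Q False] less.prems z
        by (simp add: integrable_measure_pmf_finite finp Q del: set_pair_pmf)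
      have "AE v in measure_pmf (pair_pmf (K x) (K y)). 0 \<le> M - h v"
        using hM subp[OF Q] by (intro AE_pmfI) (auto simp del: set_pair_pmf)
      then have "AE v in measure_pmf (pair_pmf (K x) (K y)). M - h v = 0"
        using integral_nonneg_eq_0_iff_AE[OF integrable_measure_pmf_finite[OF finp[OF Q]], of "\<lambda>v. M - h v"] int0
        by blast
      then have "h z' = M" using z'(1) by (auto simp: AE_measure_pmf_iff simp del: set_pair_pmf)
      then show ?thesis using less.hyps[OF z'(2) z'Q] by simp
    qed
  qed
  have "M = 0"
  proof -
    have "M \<in> insert 0 (h ` C)" unfolding M_def using finC by (intro Max_in) auto
    then show ?thesis using max_zero by (auto simp: C_def)
  qed
  then show ?thesis using hM[of "(x, y)"] h0[of "(x, y)"] xy by simp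
qed

text \<open>The independent pair is enough: the coupling is carried not by the joint law but by
  \<open>G\<close>, which in the application vanishes on pairs that have met.\<close>

lemma mean_diff_le_coupling:
  fixes f :: "'s \<Rightarrow> real"
  assumes f: "\<And>x. \<bar>f x\<bar> \<le> B" and G: "\<And>z. \<bar>G z\<bar> \<le> c"
    and le: "\<And>x y. \<bar>f x - f y\<bar> \<le> G (x, y)"
  shows "\<bar>mean p f - mean q f\<bar>
    \<le> mean (pair_pmf p q) G"
proof -
  have "mean p f - mean q f
      = mean (pair_pmf p q) (\<lambda>z. f (fst z) - f (snd z))"
    by (subst Bochner_Integration.integral_diff) (auto intro!: integrable_bounded_pmf[where c = B] f)
  also have "\<bar>\<dots>\<bar> \<le> mean (pair_pmf p q) (\<lambda>z. \<bar>f (fst z) - f (snd z)\<bar>)"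
    by (rule integral_abs_bound)
  also have "\<dots> \<le> mean (pair_pmf p q) G"
  proof (intro integral_mono)
    have abs: "\<bar>f (fst z) - f (snd z)\<bar> \<le> G z" for z
      using le[of "fst z" "snd z"] by simp
    then show "\<bar>f (fst z) - f (snd z)\<bar> \<le> G z" for z .
    show "integrable (measure_pmf (pair_pmf p q)) (\<lambda>z. \<bar>f (fst z) - f (snd z)\<bar>)"
    proof (rule integrable_bounded_pmf[where c = c])
      show "\<bar>\<bar>f (fst z) - f (snd z)\<bar>\<bar> \<le> c" for z
        using abs[of z] G[of z] by linarith
    qed
    show "integrable (measure_pmf (pair_pmf p q)) G"
      by (rule integrable_bounded_pmf[OF G])
  qed
  finally show ?thesis .
qed

context finite_step_chain
begin

text \<open>Krylov-Bogoliubov: a pointwise limit of the Cesaro averages keeps total mass 1 by the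
  tightness that the drift supplies, and shifting the average by one step changes it only by
  O(1/N).\<close>

lemma exists_stationary:
  assumes x0: "x0 \<in> Q" and f: "\<And>x. x \<in> Q \<Longrightarrow> 0 \<le> f x" and g: "\<And>x. x \<in> Q \<Longrightarrow> 0 \<le> g x"
    and drift: "\<And>x. x \<in> Q \<Longrightarrow> step f x \<le> f x - g x + b"
    and fing: "\<And>m. finite {x \<in> Q. g x \<le> m}"
  shows "\<exists>\<pi>. stationary K \<pi> \<and> set_pmf \<pi> \<subseteq> Q"
proof -
  define C where "C = (\<lambda>m :: nat. {x \<in> Q. g x \<le> real m})"
  have finC: "finite (C m)" and CQ: "C m \<subseteq> Q" for m
    using fing by (auto simp: C_def)
  have Cmono: "C m \<subseteq> C m'" if "m \<le> m'" for m m'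
    using that by (auto simp: C_def intro: order_trans)
  have "\<exists>m :: nat. g x \<le> real m" for x
    by (rule real_arch_simple)
  then have QC: "Q = (\<Union>m. C m)"
    unfolding C_def by blast
  have cQ: "countable Q"
    unfolding QC by (rule countable_UN) (simp_all add: countable_finite finC)
  let ?L = "chain_law K (return_pmf x0)"
  have L: "finite (set_pmf (?L t))" "set_pmf (?L t) \<subseteq> Q" for t
    using finite_set_chain_law[of "return_pmf x0" t] x0 by auto
  define \<mu> where "\<mu> = (\<lambda>N y. (\<Sum>t<Suc N. pmf (?L t) y) / real (Suc N))"
  have \<mu>nn: "0 \<le> \<mu> N y" for N y
    by (auto simp: \<mu>_def intro!: divide_nonneg_pos add_nonneg_nonneg sum_nonneg)
  have \<mu>sum: "sum (\<mu> N) A = (\<Sum>t<Suc N. measure_pmf.prob (?L t) A) / real (Suc N)"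
    if "finite A" for N A
    unfolding \<mu>_def using that
    by (subst measure_measure_pmf_finite[OF that], subst sum.swap) (simp add: sum_divide_distrib)
  have \<mu>le: "sum (\<mu> N) A \<le> 1" if "finite A" for N A
  proof -
    have "(\<Sum>t<Suc N. measure_pmf.prob (?L t) A) \<le> (\<Sum>t<Suc N. 1)"
      by (intro sum_mono) simp
    then show ?thesis by (subst \<mu>sum[OF that]) (simp add: divide_simps)
  qed
  have \<mu>le1: "\<mu> N y \<le> 1" for N y
    using \<mu>le[of "{y}" N] by simp
  obtain r l where r: "strict_mono r" and l: "\<And>i. (\<lambda>k. \<mu> (r k) (from_nat_into Q i)) \<longlonglongrightarrow> l i"
    using bounded_family_subsequence[of "\<lambda>N i. \<mu> N (from_nat_into Q i)"] \<mu>nn \<mu>le1 by auto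
  define p where "p = (\<lambda>y. if y \<in> Q then l (to_nat_on Q y) else 0)"
  have plim: "(\<lambda>k. \<mu> (r k) y) \<longlonglongrightarrow> p y" if "y \<in> Q" for y
    using l[of "to_nat_on Q y"] that cQ by (simp add: p_def)
  have pnn: "0 \<le> p y" for y
  proof (cases "y \<in> Q")
    case True
    then show ?thesis using \<mu>nn by (intro LIMSEQ_le_const[OF plim]) auto
  qed (simp add: p_def)
  have psum: "(\<lambda>k. sum (\<mu> (r k)) A) \<longlonglongrightarrow> sum p A" if "A \<subseteq> Q" for A
    using that by (intro tendsto_sum plim) auto
  define c where "c = f x0 + \<bar>b\<bar>"
  \<comment> \<open>Markov's inequality for \<open>g\<close> outside \<open>C m\<close>, averaged
    over time through \<open>cesaro_drift\<close>.\<close>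
  have tight: "1 - c / real m \<le> sum (\<mu> N) (C m)" if "m > 0" for m N
  proof -
    have Eg: "real m * (1 - measure_pmf.prob (?L t) (C m)) \<le> mean (?L t) g" for t
    proof -
      have "real m * (1 - measure_pmf.prob (?L t) (C m))
          = mean (?L t) (\<lambda>x. real m * (1 - indicator (C m) x))"
        by (subst integral_mult_right_zero, subst Bochner_Integration.integral_diff)
           (auto intro!: integrable_measure_pmf_finite L)
      also have "\<dots> \<le> mean (?L t) g"
        using L(2)[of t] g by (intro mean_mono_finite L) (auto simp: C_def indicator_def subset_iff)
      finally show ?thesis .
    qed
    have "(\<Sum>t<Suc N. real m * (1 - measure_pmf.prob (?L t) (C m)))
        \<le> (\<Sum>t<Suc N. mean (?L t) g)"
      by (intro sum_mono Eg)
    also have "\<dots> \<le> f x0 + real (Suc N) * b"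
      by (rule cesaro_drift[OF x0 f drift])
    also have "\<dots> \<le> real (Suc N) * f x0 + real (Suc N) * \<bar>b\<bar>"
      using f[OF x0] by (intro add_mono mult_left_mono) (auto simp: algebra_simps)
    finally have "real m * (real (Suc N) - (\<Sum>t<Suc N. measure_pmf.prob (?L t) (C m))) \<le> real (Suc N) * c"
      by (simp add: c_def sum_subtractf sum_distrib_left algebra_simps del: sum.lessThan_Suc)
    then show ?thesis
      using that unfolding \<mu>sum[OF finC] by (simp add: field_simps del: sum.lessThan_Suc of_nat_Suc)
  qed
  have ptight: "1 - c / real m \<le> sum p (C m)" if "m > 0" for m
    using tight[OF that] by (intro LIMSEQ_le_const[OF psum[OF CQ]]) auto
  have ple: "sum p (C m) \<le> 1" for m
    using \<mu>le[OF finC] by (intro LIMSEQ_le_const2[OF psum[OF CQ]]) auto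
  have pC: "(\<integral>\<^sup>+y. ennreal (p y) * indicator (C m) y \<partial>count_space UNIV) = ennreal (sum p (C m))" for m
    by (simp add: nn_integral_count_space_indicator[symmetric] nn_integral_count_space_finite finC
        sum_ennreal pnn)
  have pind: "ennreal (p y) = (SUP m. ennreal (p y) * indicator (C m) y)" for y
  proof (cases "y \<in> Q")
    case True
    then obtain m where "y \<in> C m" using QC by auto
    then have "ennreal (p y) * indicator (C m) y = ennreal (p y)" by simp
    then show ?thesis
      by (intro antisym SUP_least) (auto intro: SUP_upper2[of m] simp: indicator_def)
  qed (simp add: p_def)
  have "(\<integral>\<^sup>+y. ennreal (p y) \<partial>count_space UNIV) = (SUP m. \<integral>\<^sup>+y. ennreal (p y) * indicator (C m) y \<partial>count_space UNIV)"
    by (subst pind, rule nn_integral_monotone_convergence_SUP)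
       (auto simp: incseq_def le_fun_def indicator_def dest: Cmono)
  also have "\<dots> = (SUP m. ennreal (sum p (C m)))"
    by (simp add: pC)
  also have "\<dots> = 1"
  proof (rule antisym)
    show "(SUP m. ennreal (sum p (C m))) \<le> 1"
      using ple by (intro SUP_least) (simp add: ennreal_le_1)
    have "(\<lambda>m. ennreal (1 - c / real (Suc m))) \<longlonglongrightarrow> ennreal (1 - 0)"
      by (intro tendsto_ennrealI tendsto_diff tendsto_const LIMSEQ_Suc[OF lim_const_over_n])
    moreover have "ennreal (1 - c / real (Suc m)) \<le> (SUP m. ennreal (sum p (C m)))" for m
      using ptight[of "Suc m"] by (intro SUP_upper2[of "Suc m"] ennreal_leI) auto
    ultimately show "1 \<le> (SUP m. ennreal (sum p (C m)))"
      by (intro LIMSEQ_le_const2[of "\<lambda>m. ennreal (1 - c / real (Suc m))"]) auto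
  qed
  finally have one: "(\<integral>\<^sup>+y. ennreal (p y) \<partial>count_space UNIV) = 1" .
  define \<pi> where "\<pi> = embed_pmf p"
  have pmf\<pi>: "pmf \<pi> y = p y" for y
    unfolding \<pi>_def by (rule pmf_embed_pmf[OF pnn one])
  have sub: "set_pmf \<pi> \<subseteq> Q"
    by (auto simp: set_pmf_iff pmf\<pi> p_def split: if_splits)
  \<comment> \<open>Restricting to the finite set \<open>C m\<close> lets the limit pass through the
    sum, at the price of an inequality; \<open>1 / real (Suc N)\<close> is the boundary cost of
    shifting the time window.\<close>
  have flow: "(\<Sum>x\<in>C m. p x * pmf (K x) y) \<le> p y" if y: "y \<in> Q" for m y
  proof -
    have "(\<lambda>k. \<Sum>x\<in>C m. \<mu> (r k) x * pmf (K x) y) \<longlonglongrightarrow> (\<Sum>x\<in>C m. p x * pmf (K x) y)"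
      using CQ by (intro tendsto_sum tendsto_mult_right plim) auto
    moreover have "(\<lambda>k. \<mu> (r k) y + 1 / real (Suc (r k))) \<longlonglongrightarrow> p y + 0"
      by (intro tendsto_add plim y) (use LIMSEQ_subseq_LIMSEQ[OF LIMSEQ_Suc[OF lim_const_over_n[of 1]] r] in \<open>simp add: comp_def\<close>)
    moreover have "(\<Sum>x\<in>C m. \<mu> N x * pmf (K x) y) \<le> \<mu> N y + 1 / real (Suc N)" for N
    proof -
      have one_step: "(\<Sum>x\<in>C m. pmf (?L t) x * pmf (K x) y) \<le> pmf (?L (Suc t)) y" for t
      proof -
        have "(\<Sum>x\<in>C m. pmf (?L t) x * pmf (K x) y)
            = mean (?L t) (\<lambda>x. indicator (C m) x * pmf (K x) y)"
          by (subst integral_measure_pmf[OF finC[of m]]) (auto simp: indicator_def split: if_splits)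
        also have "\<dots> \<le> mean (?L t) (\<lambda>x. pmf (K x) y)"
          by (intro mean_mono_finite L) (auto simp: indicator_def)
        finally show ?thesis by (simp add: pmf_bind)
      qed
      have "(\<Sum>x\<in>C m. \<mu> N x * pmf (K x) y) * real (Suc N)
          = (\<Sum>t<Suc N. \<Sum>x\<in>C m. pmf (?L t) x * pmf (K x) y)"
        unfolding \<mu>_def by (subst sum.swap) (simp add: sum_distrib_right sum_divide_distrib del: sum.lessThan_Suc of_nat_Suc)
      also have "\<dots> \<le> (\<Sum>t<Suc N. pmf (?L (Suc t)) y)"
        by (intro sum_mono one_step)
      also have "\<dots> = (\<Sum>t<Suc N. pmf (?L t) y) + pmf (?L (Suc N)) y - pmf (?L 0) y"
        by (induction N) auto
      also have "\<dots> \<le> (\<Sum>t<Suc N. pmf (?L t) y) + 1"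
        using pmf_le_1[of "?L (Suc N)" y] pmf_nonneg[of "?L 0" y] by linarith
      finally show ?thesis
        by (simp add: \<mu>_def field_simps del: sum.lessThan_Suc of_nat_Suc chain_law.simps)
    qed
    ultimately show ?thesis
      by (intro LIMSEQ_le[where Y = "\<lambda>k. \<mu> (r k) y + 1 / real (Suc (r k))"]) auto
  qed
  have le: "pmf (bind_pmf \<pi> K) y \<le> pmf \<pi> y" for y
  proof (cases "y \<in> Q")
    case True
    have "(\<lambda>m. mean \<pi> (\<lambda>x. indicator (C m) x * pmf (K x) y))
        \<longlonglongrightarrow> mean \<pi> (\<lambda>x. pmf (K x) y)"
    proof (rule integral_dominated_convergence[where w = "\<lambda>_. 1"])
      show "AE x in measure_pmf \<pi>. (\<lambda>m. indicator (C m) x * pmf (K x) y) \<longlonglongrightarrow> pmf (K x) y"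
      proof (rule AE_pmfI)
        fix x assume "x \<in> set_pmf \<pi>"
        then obtain m0 where "x \<in> C m0" using sub QC by auto
        then have "\<forall>\<^sub>F m in sequentially. indicator (C m) x * pmf (K x) y = pmf (K x) y"
          using Cmono by (intro eventually_sequentiallyI[of m0]) (auto simp: indicator_def)
        then show "(\<lambda>m. indicator (C m) x * pmf (K x) y) \<longlonglongrightarrow> pmf (K x) y"
          by (rule tendsto_eventually)
      qed
    qed (auto simp: indicator_def pmf_le_1)
    moreover have "mean \<pi> (\<lambda>x. indicator (C m) x * pmf (K x) y) \<le> p y" for m
    proof -
      have "mean \<pi> (\<lambda>x. indicator (C m) x * pmf (K x) y) = (\<Sum>x\<in>C m. p x * pmf (K x) y)"
        by (subst integral_measure_pmf[OF finC[of m]]) (auto simp: indicator_def pmf\<pi> split: if_splits)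
      then show ?thesis using flow[OF True] by simp
    qed
    ultimately show ?thesis
      unfolding pmf_bind pmf\<pi> by (intro LIMSEQ_le_const2) auto
  next
    case False
    then have "y \<notin> set_pmf (bind_pmf \<pi> K)" using sub closed by auto
    then have "pmf (bind_pmf \<pi> K) y = 0" by (simp only: pmf_eq_0_set_pmf not_False_eq_True)
    then show ?thesis by simp
  qed
  \<comment> \<open>Two probability mass functions, one below the other everywhere, coincide; so
    subinvariance is invariance.\<close>
  have "bind_pmf \<pi> K = \<pi>"
  proof (rule ccontr)
    assume "bind_pmf \<pi> K \<noteq> \<pi>"
    then obtain y where "pmf \<pi> y < pmf (bind_pmf \<pi> K) y"
      using pmf_neq_exists_less[of \<pi> "bind_pmf \<pi> K"] by auto
    then show False using le[of y] by simp
  qed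
  then show ?thesis using sub by (auto simp: stationary_def)
qed

lemma mean_chain_law:
  assumes "\<And>x. \<bar>\<phi> x\<bar> \<le> c"
  shows "mean (chain_law K \<mu> t) \<phi> = mean \<mu> ((step ^^ t) \<phi>)"
  using assms
proof (induction t arbitrary: \<phi>)
  case (Suc t)
  have "mean (chain_law K \<mu> (Suc t)) \<phi>
      = mean (chain_law K \<mu> t) (step \<phi>)"
    using mean_bind_bounded[OF Suc.prems] by simp
  also have "\<dots> = mean \<mu> ((step ^^ t) (step \<phi>))"
    by (rule Suc.IH) (rule abs_mean_le[OF Suc.prems])
  also have "(step ^^ t) (step \<phi>) = (step ^^ Suc t) \<phi>"
    by (simp only: funpow_Suc_right comp_apply)
  finally show ?case .
qed simp

text \<open>Two independent copies run until they meet, one of them stationary. The loop at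
  \<open>o'\<close> stands for aperiodicity and the rank for accessibility of \<open>o'\<close>:
  from any two states of \<open>Q\<close> the copies can meet.\<close>

lemma converges_to_stationary:
  fixes \<rho> :: "'s \<Rightarrow> nat"
  assumes f: "\<And>x. x \<in> Q \<Longrightarrow> 0 \<le> f x" and g: "\<And>x. x \<in> Q \<Longrightarrow> 0 \<le> g x"
    and drift: "\<And>x. x \<in> Q \<Longrightarrow> step f x \<le> f x - g x + b"
    and finf: "\<And>m. finite {x \<in> Q. f x \<le> m}" and fing: "\<And>m. finite {x \<in> Q. g x \<le> m}"
    and o: "o' \<in> set_pmf (K o')"
    and down: "\<And>x. x \<in> Q \<Longrightarrow> x \<noteq> o' \<Longrightarrow> \<exists>x'\<in>set_pmf (K x). \<rho> x' < \<rho> x"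
    and st: "stationary K \<pi>" and sub: "set_pmf \<pi> \<subseteq> Q" and \<mu>: "set_pmf \<mu> \<subseteq> Q"
  shows "converges_in_distribution (chain_law K \<mu>) \<pi>"
  unfolding converges_in_distribution_def
proof (intro allI impI)
  fix \<phi> :: "'s \<Rightarrow> real" assume "bounded (range \<phi>)"
  then obtain B where B: "\<And>x. \<bar>\<phi> x\<bar> \<le> B"
    by (auto simp: bounded_iff)
  have Ub: "\<bar>(step ^^ t) \<phi> x\<bar> \<le> B" for t x
    by (induction t arbitrary: x) (auto intro: B abs_mean_le)
  have B0: "0 \<le> B" using order_trans[OF abs_ge_zero B] .
  \<comment> \<open>\<open>G t z\<close> is \<open>2 * B\<close> times the probability that
    independent copies started from the pair \<open>z\<close> have not met by time \<open>t\<close>.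
    Its limit is harmonic off the diagonal.\<close>
  define G where "G = rec_nat (\<lambda>z. if fst z = snd z then 0 else 2 * B)
    (\<lambda>_ G z. if fst z = snd z then 0 else mean (pair_pmf (K (fst z)) (K (snd z))) G)"
  have G0: "G 0 = (\<lambda>z. if fst z = snd z then 0 else 2 * B)"
    and GS: "G (Suc t) = (\<lambda>z. if fst z = snd z then 0
      else mean (pair_pmf (K (fst z)) (K (snd z))) (G t))" for t
    unfolding G_def by simp_all
  have Gnn: "0 \<le> G t z" for t z
    by (induction t arbitrary: z) (auto simp: G0 GS B0)
  have Gle: "\<bar>G t z\<bar> \<le> 2 * B" for t z
    by (induction t arbitrary: z) (auto simp: G0 GS B0 intro: abs_mean_le)
  have Gint: "integrable (measure_pmf q) (G t)" for q t
    by (rule integrable_bounded_pmf[OF Gle])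
  have Gdec: "G (Suc t) z \<le> G t z" for t z
  proof (induction t arbitrary: z)
    case 0
    have "G (Suc 0) z \<le> 2 * B" using Gle[of "Suc 0" z] by linarith
    then show ?case by (cases "fst z = snd z") (simp_all add: G0 GS)
  next
    case (Suc t)
    have "mean q (G (Suc t)) \<le> mean q (G t)" for q
      by (intro integral_mono Gint Suc)
    then show ?case unfolding GS[of "Suc t"] GS[of t] by (simp add: GS[of t, symmetric])
  qed
  have coupling: "\<bar>(step ^^ t) \<phi> x - (step ^^ t) \<phi> y\<bar> \<le> G t (x, y)" for t x y
  proof (induction t arbitrary: x y)
    case 0
    then show ?case using B[of x] B[of y] by (auto simp: G0)
  next
    case (Suc t)
    have "\<bar>(step ^^ Suc t) \<phi> x - (step ^^ Suc t) \<phi> y\<bar>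
        \<le> mean (pair_pmf (K x) (K y)) (G t)"
      unfolding funpow.simps comp_apply by (rule mean_diff_le_coupling[where f = "(step ^^ t) \<phi>" and G = "G t", OF Ub Gle Suc.IH])
    then show ?case by (cases "x = y") (simp_all add: GS)
  qed
  define h where "h = (\<lambda>z. lim (\<lambda>t. G t z))"
  have hlim: "(\<lambda>t. G t z) \<longlonglongrightarrow> h z" for z
  proof -
    have "decseq (\<lambda>t. G t z)" by (intro decseq_SucI Gdec)
    then have "convergent (\<lambda>t. G t z)"
      using Gnn by (metis decseq_convergent convergentI)
    then show ?thesis by (simp add: h_def convergent_LIMSEQ_iff)
  qed
  have h0: "0 \<le> h z" and hle: "h z \<le> 2 * B" for z
    by (rule LIMSEQ_le_const[OF hlim], use Gnn in blast)
       (rule LIMSEQ_le_const2[OF hlim], use Gle abs_le_D1 in blast)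
  have hdiag: "h (x, x) = 0" for x
  proof -
    have "G t (x, x) = 0" for t by (cases t) (simp_all add: G0 GS)
    then show ?thesis using LIMSEQ_unique[OF hlim[of "(x, x)"]] by simp
  qed
  have harm: "h (x, y) = mean (pair_pmf (K x) (K y)) h" if "x \<noteq> y" for x y
  proof (rule LIMSEQ_unique)
    show "(\<lambda>t. G (Suc t) (x, y)) \<longlonglongrightarrow> h (x, y)" by (rule LIMSEQ_Suc[OF hlim])
    have "(\<lambda>t. mean (pair_pmf (K x) (K y)) (G t))
        \<longlonglongrightarrow> mean (pair_pmf (K x) (K y)) h"
      by (rule integral_dominated_convergence[where w = "\<lambda>_. 2 * B"]) (use hlim Gle in auto)
    then show "(\<lambda>t. G (Suc t) (x, y)) \<longlonglongrightarrow> mean (pair_pmf (K x) (K y)) h"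
      using that by (simp add: GS)
  qed
  have hzero: "h (x, y) = 0" if "x \<in> Q" "y \<in> Q" for x y
    by (rule harmonic_off_diagonal_zero[where \<rho> = \<rho> and o' = o', OF h0 hle hdiag harm f g drift finf fing o down that])
  let ?p = "pair_pmf \<mu> \<pi>"
  have zero: "(\<lambda>t. mean ?p (G t)) \<longlonglongrightarrow> mean ?p (\<lambda>_. 0)"
  proof (rule integral_dominated_convergence[where w = "\<lambda>_. 2 * B"])
    show "AE z in measure_pmf ?p. (\<lambda>t. G t z) \<longlonglongrightarrow> 0"
    proof (rule AE_pmfI)
      fix z assume "z \<in> set_pmf ?p"
      then have "fst z \<in> Q" "snd z \<in> Q" using \<mu> sub by auto
      then have "h z = 0" using hzero[of "fst z" "snd z"] by simp
      then show "(\<lambda>t. G t z) \<longlonglongrightarrow> 0" using hlim[of z] by simp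
    qed
  qed (use Gle in auto)
  have inv: "mean \<pi> ((step ^^ t) \<phi>) = mean \<pi> \<phi>" for t
    by (induction t) (simp_all add: stationary_step_bounded[OF st Ub])
  have diff: "\<bar>mean (chain_law K \<mu> t) \<phi> - mean \<pi> \<phi>\<bar>
      \<le> mean ?p (G t)" for t
    using mean_diff_le_coupling[where f = "(step ^^ t) \<phi>" and G = "G t" and p = \<mu> and q = \<pi>, OF Ub Gle coupling]
    by (simp add: inv mean_chain_law[OF B])
  show "(\<lambda>t. mean (chain_law K \<mu> t) \<phi>) \<longlonglongrightarrow> mean \<pi> \<phi>"
    by (rule LIM_zero_cancel, rule tendsto_0_le[where K = 1 and f = "\<lambda>t. mean ?p (G t)"])
       (use zero diff Gnn in auto)
qed

text \<open>A state of least rank in the support of a stationary law must be \<open>o'\<close>.\<close>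

lemma stationary_support:
  fixes \<rho> :: "'s \<Rightarrow> nat"
  assumes down: "\<And>x. x \<in> Q \<Longrightarrow> x \<noteq> o' \<Longrightarrow> \<exists>x'\<in>set_pmf (K x). \<rho> x' < \<rho> x"
    and st: "stationary K \<pi>" and sub: "set_pmf \<pi> \<subseteq> Q"
  shows "reachable K o' \<subseteq> set_pmf \<pi>"
proof -
  have inv: "set_pmf (K x) \<subseteq> set_pmf \<pi>" if "x \<in> set_pmf \<pi>" for x
    using that st set_bind_pmf[of \<pi> K] unfolding stationary_def by auto
  define m where "m = arg_min \<rho> (\<lambda>x. x \<in> set_pmf \<pi>)"
  obtain x1 where "x1 \<in> set_pmf \<pi>" using set_pmf_not_empty by fast
  then have m: "m \<in> set_pmf \<pi>"
    unfolding m_def by (rule arg_min_natI)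
  have min: "\<rho> m \<le> \<rho> y" if "y \<in> set_pmf \<pi>" for y
    unfolding m_def using that by (rule arg_min_nat_le)
  have "m = o'"
    using down[of m] m min inv[OF m] sub by (meson leD subset_iff)
  then have o: "o' \<in> set_pmf \<pi>" using m by simp
  have "y \<in> set_pmf \<pi>" if "(\<lambda>u v. v \<in> set_pmf (K u))\<^sup>*\<^sup>* o' y" for y
    using that by induction (use o inv in auto)
  then show ?thesis by (auto simp: reachable_def)
qed

end

section \<open>Matchings and doubly substochastic matrices\<close>

text \<open>Induction on the size of \<open>I\<close>. If some proper nonempty \<open>J\<close> has
  exactly \<open>card J\<close> neighbours, \<open>J\<close> and its complement are matched
  separately; otherwise Hall's condition has a spare unit and any single edge can be fixed.\<close>

lemma hall_matching:
  fixes N :: "'a \<Rightarrow> 'b set"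
  assumes "finite I" and "\<And>i. i \<in> I \<Longrightarrow> finite (N i)"
    and "\<And>J. J \<subseteq> I \<Longrightarrow> card J \<le> card (\<Union>i\<in>J. N i)"
  shows "\<exists>\<sigma>. inj_on \<sigma> I \<and> (\<forall>i\<in>I. \<sigma> i \<in> N i)"
  using assms
proof (induction "card I" arbitrary: I N rule: less_induct)
  case less
  note fin = less.prems(1) and finN = less.prems(2) and hall = less.prems(3)
  show ?case
  proof (cases "I = {}")
    case False
    then obtain i0 where i0: "i0 \<in> I" by blast
    show ?thesis
    proof (cases "\<exists>J. J \<subset> I \<and> J \<noteq> {} \<and> card (\<Union>i\<in>J. N i) = card J")
      case True
      then obtain J where J: "J \<subset> I" "J \<noteq> {}" "card (\<Union>i\<in>J. N i) = card J" by blast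
      define U where "U = (\<Union>i\<in>J. N i)"
      have finJ: "finite J" using J fin finite_subset by blast
      have finU: "finite U" unfolding U_def using finJ J finN by auto
      have "card J < card I" using J fin by (simp add: psubset_card_mono)
      then have "\<exists>\<sigma>. inj_on \<sigma> J \<and> (\<forall>i\<in>J. \<sigma> i \<in> N i)"
        using finJ J finN by (intro less.hyps hall) auto
      then obtain \<sigma>1 where \<sigma>1: "inj_on \<sigma>1 J" "\<And>i. i \<in> J \<Longrightarrow> \<sigma>1 i \<in> N i"
        by blast
      have "card (I - J) < card I"
        using J fin by (intro psubset_card_mono) auto
      \<comment> \<open>Hall's condition for \<open>L \<union> J\<close>, less the
        \<open>card J\<close> elements of \<open>U\<close>, is Hall's condition for \<open>L\<close>
        once \<open>U\<close> is removed.\<close>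
      moreover have "card L \<le> card (\<Union>i\<in>L. N i - U)" if L: "L \<subseteq> I - J" for L
      proof -
        have finL: "finite L" using L fin by (meson finite_Diff finite_subset)
        have "card L + card J = card (L \<union> J)"
          using L finJ finL by (subst card_Un_disjoint) auto
        also have "\<dots> \<le> card (\<Union>i\<in>L \<union> J. N i)"
          using L J by (intro hall) auto
        also have "(\<Union>i\<in>L \<union> J. N i) = (\<Union>i\<in>L. N i - U) \<union> U" by (auto simp: U_def)
        also have "card \<dots> \<le> card (\<Union>i\<in>L. N i - U) + card U" by (rule card_Un_le)
        finally show ?thesis using J(3) by (simp add: U_def)
      qed
      ultimately have "\<exists>\<sigma>. inj_on \<sigma> (I - J) \<and> (\<forall>i\<in>I - J. \<sigma> i \<in> N i - U)"
        using fin finN by (intro less.hyps) auto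
      then obtain \<sigma>2 where \<sigma>2: "inj_on \<sigma>2 (I - J)" "\<And>i. i \<in> I - J \<Longrightarrow> \<sigma>2 i \<in> N i - U"
        by blast
      define \<sigma> where "\<sigma> = (\<lambda>i. if i \<in> J then \<sigma>1 i else \<sigma>2 i)"
      have "\<sigma>1 i \<in> U" if "i \<in> J" for i using \<sigma>1 that by (auto simp: U_def)
      then have "inj_on \<sigma> I"
        using \<sigma>1(1) \<sigma>2 unfolding inj_on_def \<sigma>_def by (smt (verit) Diff_iff)
      moreover have "\<forall>i\<in>I. \<sigma> i \<in> N i" using \<sigma>1 \<sigma>2 by (auto simp: \<sigma>_def)
      ultimately show ?thesis by blast
    next
      case nt: False
      have "card {i0} \<le> card (N i0)" using hall[of "{i0}"] i0 by simp
      then have "N i0 \<noteq> {}" by auto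
      then obtain y where y: "y \<in> N i0" by blast
      have "card (I - {i0}) < card I" using i0 fin by (meson card_Diff1_less)
      moreover have "card L \<le> card (\<Union>i\<in>L. N i - {y})" if L: "L \<subseteq> I - {i0}" for L
      proof (cases "L = {}")
        case False
        have "L \<subset> I" using L i0 by blast
        then have "card (\<Union>i\<in>L. N i) \<noteq> card L" using nt False by blast
        moreover have "card L \<le> card (\<Union>i\<in>L. N i)" using L by (intro hall) auto
        ultimately have "card L < card (\<Union>i\<in>L. N i)" by linarith
        moreover have "(\<Union>i\<in>L. N i) - {y} = (\<Union>i\<in>L. N i - {y})" by auto
        then have "card (\<Union>i\<in>L. N i) - 1 \<le> card (\<Union>i\<in>L. N i - {y})"
          by (metis card_Diff_singleton_if diff_le_self order_refl)
        ultimately show ?thesis by linarith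
      qed simp
      ultimately have "\<exists>\<sigma>. inj_on \<sigma> (I - {i0}) \<and> (\<forall>i\<in>I - {i0}. \<sigma> i \<in> N i - {y})"
        using fin finN by (intro less.hyps) auto
      then obtain \<sigma>2 where \<sigma>2: "inj_on \<sigma>2 (I - {i0})" "\<And>i. i \<in> I - {i0} \<Longrightarrow> \<sigma>2 i \<in> N i - {y}"
        by blast
      define \<sigma> where "\<sigma> = (\<lambda>i. if i = i0 then y else \<sigma>2 i)"
      have "inj_on \<sigma> I"
        using \<sigma>2 unfolding inj_on_def \<sigma>_def by (smt (verit) Diff_iff singletonD singletonI)
      moreover have "\<forall>i\<in>I. \<sigma> i \<in> N i" using \<sigma>2 y by (auto simp: \<sigma>_def)
      ultimately show ?thesis by blast
    qed
  qed simp
qed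

text \<open>A Birkhoff decomposition peels off a permutation supported on the positive entries
  (which exists by Hall's theorem) until nothing is left.\<close>

lemma birkhoff_weight_bound:
  fixes D q :: "nat \<Rightarrow> nat \<Rightarrow> real"
  assumes "\<And>i j. i \<in> {1..n} \<Longrightarrow> j \<in> {1..n} \<Longrightarrow> 0 \<le> D i j"
    and "\<And>i. i \<in> {1..n} \<Longrightarrow> (\<Sum>j=1..n. D i j) = c"
    and "\<And>j. j \<in> {1..n} \<Longrightarrow> (\<Sum>i=1..n. D i j) = c"
    and bound: "\<And>\<sigma>. bij_betw \<sigma> {1..n} {1..n} \<Longrightarrow> (\<Sum>i=1..n. q i (\<sigma> i)) \<le> m"
    and n: "n > 0"
  shows "(\<Sum>i=1..n. \<Sum>j=1..n. D i j * q i j) \<le> c * m"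
  using assms(1-3)
proof (induction "card {ij \<in> {1..n} \<times> {1..n}. D (fst ij) (snd ij) \<noteq> 0}" arbitrary: D c rule: less_induct)
  case less
  note nn = less.prems(1) and row = less.prems(2) and col = less.prems(3)
  have c0: "0 \<le> c" using row[of 1] nn[of 1] n by (auto intro!: sum_nonneg simp: Suc_le_eq)
  show ?case
  proof (cases "c = 0")
    case True
    have "D i j = 0" if "i \<in> {1..n}" "j \<in> {1..n}" for i j
      using row[OF that(1)] nn that True sum_nonneg_eq_0_iff[of "{1..n}" "D i"] by auto
    then show ?thesis using True by simp
  next
    case False
    then have cpos: "c > 0" using c0 by simp
    define N where "N = (\<lambda>i. {j \<in> {1..n}. D i j \<noteq> 0})"
    \<comment> \<open>Double counting: the rows in \<open>J\<close> carry mass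
      \<open>c * card J\<close>, all of it in the columns of their neighbours, each of which holds
      only \<open>c\<close>.\<close>
    have "card J \<le> card (\<Union>i\<in>J. N i)" if J: "J \<subseteq> {1..n}" for J
    proof -
      let ?U = "\<Union>i\<in>J. N i"
      have U: "?U \<subseteq> {1..n}" by (auto simp: N_def)
      have finJ: "finite J" using J finite_subset by blast
      have finU: "finite ?U" using U finite_subset by blast
      have "c * card J = (\<Sum>i\<in>J. \<Sum>j=1..n. D i j)" using row J by (subst sum.cong[OF refl, of J _ "\<lambda>_. c"]) auto
      also have "\<dots> = (\<Sum>i\<in>J. \<Sum>j\<in>?U. D i j)"
        using U by (intro sum.cong refl sum.mono_neutral_right) (auto simp: N_def)
      also have "\<dots> = (\<Sum>j\<in>?U. \<Sum>i\<in>J. D i j)" by (rule sum.swap)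
      also have "\<dots> \<le> (\<Sum>j\<in>?U. \<Sum>i=1..n. D i j)"
        using U J nn by (intro sum_mono sum_mono2) auto
      also have "\<dots> = c * card ?U" using col U by (subst sum.cong[OF refl, of ?U _ "\<lambda>_. c"]) auto
      finally show ?thesis using cpos by simp
    qed
    then have "\<exists>\<sigma>. inj_on \<sigma> {1..n} \<and> (\<forall>i\<in>{1..n}. \<sigma> i \<in> N i)"
      by (intro hall_matching) (simp_all add: N_def)
    then obtain \<sigma> where \<sigma>: "inj_on \<sigma> {1..n}" "\<And>i. i \<in> {1..n} \<Longrightarrow> \<sigma> i \<in> N i"
      by blast
    have sub: "\<sigma> ` {1..n} \<subseteq> {1..n}" using \<sigma>(2) by (auto simp: N_def)
    then have bij: "bij_betw \<sigma> {1..n} {1..n}"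
      using \<sigma>(1) endo_inj_surj[OF _ sub] by (simp add: bij_betw_def)
    have ne: "{1..n} \<noteq> {}" using n by simp
    obtain k where k: "k \<in> {1..n}" "Min ((\<lambda>i. D i (\<sigma> i)) ` {1..n}) = D k (\<sigma> k)"
      by (rule obtains_MIN[OF finite_atLeastAtMost ne])
    \<comment> \<open>The least entry on the permutation: subtracting it keeps the matrix
      nonnegative, empties one position and lowers every line sum to \<open>c - \<theta>\<close>.
      This is why the claim is made for a general line sum \<open>c\<close>.\<close>
    define \<theta> where "\<theta> = D k (\<sigma> k)"
    have \<theta>le: "\<theta> \<le> D i (\<sigma> i)" if "i \<in> {1..n}" for i
      using k(2)[symmetric] that by (simp add: \<theta>_def)
    have \<sigma>in: "\<sigma> i \<in> {1..n}" if "i \<in> {1..n}" for i using that sub by blast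
    have \<theta>0: "\<theta> \<noteq> 0" using \<sigma>(2)[OF k(1)] by (simp add: \<theta>_def N_def)
    have \<theta>nn: "0 \<le> \<theta>" using nn[OF k(1) \<sigma>in[OF k(1)]] by (simp add: \<theta>_def)
    define D' where "D' = (\<lambda>i j. D i j - (if j = \<sigma> i then \<theta> else 0))"
    define Z where "Z = (\<lambda>D :: nat \<Rightarrow> nat \<Rightarrow> real. {ij \<in> {1..n} \<times> {1..n}. D (fst ij) (snd ij) \<noteq> 0})"
    have "Z D' \<subseteq> Z D"
      using \<sigma>(2) by (auto simp: Z_def D'_def N_def split: if_splits)
    moreover have "(k, \<sigma> k) \<in> Z D" "(k, \<sigma> k) \<notin> Z D'"
      using k(1) \<sigma>in[OF k(1)] \<theta>0 by (auto simp: Z_def D'_def \<theta>_def)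
    ultimately have "Z D' \<subset> Z D" by blast
    then have less: "card (Z D') < card (Z D)"
      by (intro psubset_card_mono) (auto simp: Z_def)
    have row': "(\<Sum>j=1..n. D' i j) = c - \<theta>" if "i \<in> {1..n}" for i
      using row[OF that] \<sigma>in[OF that] by (simp add: D'_def sum_subtractf)
    have col': "(\<Sum>i=1..n. D' i j) = c - \<theta>" if j: "j \<in> {1..n}" for j
    proof -
      obtain i where i: "i \<in> {1..n}" "\<sigma> i = j" using j bij_betw_imp_surj_on[OF bij] by (metis imageE)
      have eq: "j = \<sigma> l \<longleftrightarrow> l = i" if "l \<in> {1..n}" for l
        using i that \<sigma>(1) by (auto dest: inj_onD)
      have "(\<Sum>l=1..n. if j = \<sigma> l then \<theta> else 0) = (\<Sum>l=1..n. if l = i then \<theta> else 0)"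
        by (intro sum.cong refl) (simp only: eq)
      also have "\<dots> = \<theta>" using i by simp
      finally show ?thesis using col[OF j] by (simp add: D'_def sum_subtractf)
    qed
    have IH: "(\<Sum>i=1..n. \<Sum>j=1..n. D' i j * q i j) \<le> (c - \<theta>) * m"
      using less nn \<theta>le row' col' unfolding Z_def by (intro less.hyps) (auto simp: D'_def)
    have inner: "(\<Sum>j=1..n. D i j * q i j) = (\<Sum>j=1..n. D' i j * q i j) + \<theta> * q i (\<sigma> i)" if "i \<in> {1..n}" for i
    proof -
      have "D i j * q i j = D' i j * q i j + (if j = \<sigma> i then \<theta> * q i (\<sigma> i) else 0)" for j
        by (simp add: D'_def algebra_simps)
      then show ?thesis using \<sigma>in[OF that] by (simp add: sum.distrib)
    qed
    have "(\<Sum>i=1..n. \<Sum>j=1..n. D i j * q i j)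
        = (\<Sum>i=1..n. (\<Sum>j=1..n. D' i j * q i j) + \<theta> * q i (\<sigma> i))"
      by (intro sum.cong refl inner)
    also have "\<dots> = (\<Sum>i=1..n. \<Sum>j=1..n. D' i j * q i j) + \<theta> * (\<Sum>i=1..n. q i (\<sigma> i))"
      by (simp add: sum.distrib sum_distrib_left)
    also have "\<dots> \<le> (c - \<theta>) * m + \<theta> * m"
      using IH bound[OF bij] \<theta>nn by (intro add_mono mult_left_mono) auto
    finally show ?thesis by (simp add: algebra_simps)
  qed
qed

section \<open>Permutation schedules and the maximum weight\<close>

definition perm_schedule :: "nat \<Rightarrow> (nat \<Rightarrow> nat) \<Rightarrow> arr" where
  "perm_schedule n \<sigma> = (\<lambda>(i, j). if i \<in> {1..n} \<and> j = \<sigma> i then 1 else 0)"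

lemma perm_schedule_maximal:
  assumes "bij_betw \<sigma> {1..n} {1..n}"
  shows "perm_schedule n \<sigma> \<in> maximal n"
proof -
  have s_in: "\<sigma> i \<in> {1..n}" if "i \<in> {1..n}" for i using assms that by (auto simp: bij_betw_def)
  have "(\<Sum>i=1..n. perm_schedule n \<sigma> (i, j)) = 1" if j: "j \<in> {1..n}" for j
  proof -
    obtain k where k: "k \<in> {1..n}" "\<sigma> k = j" using j bij_betw_imp_surj_on[OF assms] by (metis imageE)
    have eq: "j = \<sigma> l \<longleftrightarrow> l = k" if "l \<in> {1..n}" for l
      using k that assms by (auto simp: bij_betw_def dest: inj_onD)
    have "(\<Sum>i=1..n. perm_schedule n \<sigma> (i, j)) = (\<Sum>i=1..n. if i = k then 1 else 0)"
      by (intro sum.cong refl) (simp add: perm_schedule_def eq)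
    then show ?thesis using k by simp
  qed
  moreover have "(\<Sum>j=1..n. perm_schedule n \<sigma> (i, j)) = 1" if i: "i \<in> {1..n}" for i
    using i s_in[OF i] by (simp add: perm_schedule_def)
  moreover have "perm_schedule n \<sigma> \<in> queues n"
    using s_in by (auto simp: queues_def pairs_def perm_schedule_def)
  ultimately show ?thesis
    by (auto simp: maximal_def perm_schedule_def)
qed

lemma sum_pairs: "(\<Sum>ij\<in>pairs n. f ij) = (\<Sum>i=1..n. \<Sum>j=1..n. f (i, j))"
  by (simp add: pairs_def sum.cartesian_product)

lemma finite_pairs [simp]: "finite (pairs n)"
  by (simp add: pairs_def)

text \<open>A doubly substochastic matrix is dominated by the doubly stochastic one that adds the
  product of the row and column deficits divided by the total deficit.\<close>

lemma substochastic_weight_bound: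
  fixes D q :: "nat \<times> nat \<Rightarrow> real"
  assumes nn: "\<And>ij. ij \<in> pairs n \<Longrightarrow> 0 \<le> D ij"
    and row: "\<And>i. i \<in> {1..n} \<Longrightarrow> (\<Sum>j=1..n. D (i, j)) \<le> 1"
    and col: "\<And>j. j \<in> {1..n} \<Longrightarrow> (\<Sum>i=1..n. D (i, j)) \<le> 1"
    and q: "\<And>ij. ij \<in> pairs n \<Longrightarrow> 0 \<le> q ij"
    and bound: "\<And>s. s \<in> maximal n \<Longrightarrow> (\<Sum>ij\<in>pairs n. q ij * real (s ij)) \<le> m"
    and n: "n > 0"
  shows "(\<Sum>ij\<in>pairs n. q ij * D ij) \<le> m"
proof -
  define r where "r = (\<lambda>i. 1 - (\<Sum>j=1..n. D (i, j)))"
  define c where "c = (\<lambda>j. 1 - (\<Sum>i=1..n. D (i, j)))"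
  define S where "S = (\<Sum>i=1..n. r i)"
  have rn: "0 \<le> r i" if "i \<in> {1..n}" for i using row[OF that] by (simp add: r_def)
  have cn: "0 \<le> c j" if "j \<in> {1..n}" for j using col[OF that] by (simp add: c_def)
  have Sc: "S = (\<Sum>j=1..n. c j)"
    unfolding S_def r_def c_def by (simp add: sum_subtractf) (rule sum.swap)
  have S0: "0 \<le> S" unfolding S_def using rn by (intro sum_nonneg) auto
  \<comment> \<open>If the total deficit \<open>S\<close> is 0, the quotient is 0 by convention and
    all deficits vanish too, so the line sums are still 1.\<close>
  define D' where "D' = (\<lambda>i j. D (i, j) + r i * c j / S)"
  have z: "r i = 0" if "S = 0" "i \<in> {1..n}" for i
    using that rn sum_nonneg_eq_0_iff[of "{1..n}" r] by (auto simp: S_def)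
  have z': "c j = 0" if "S = 0" "j \<in> {1..n}" for j
    using that cn sum_nonneg_eq_0_iff[of "{1..n}" c] by (auto simp: Sc)
  have row1: "(\<Sum>j=1..n. D' i j) = 1" if i: "i \<in> {1..n}" for i
  proof -
    have "(\<Sum>j=1..n. D' i j) = (1 - r i) + r i * S / S"
      unfolding D'_def sum.distrib Sc by (simp add: r_def sum_distrib_left sum_divide_distrib)
    then show ?thesis using z[OF _ i] by (cases "S = 0") auto
  qed
  have col1: "(\<Sum>i=1..n. D' i j) = 1" if j: "j \<in> {1..n}" for j
  proof -
    have "(\<Sum>i=1..n. D' i j) = (1 - c j) + S * c j / S"
      unfolding D'_def sum.distrib S_def by (simp add: c_def sum_distrib_right sum_divide_distrib)
    then show ?thesis using z'[OF _ j] by (cases "S = 0") auto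
  qed
  have D'0: "D (i, j) \<le> D' i j" if "i \<in> {1..n}" "j \<in> {1..n}" for i j
    using rn[OF that(1)] cn[OF that(2)] S0 by (simp add: D'_def)
  have "(\<Sum>ij\<in>pairs n. q ij * D ij) = (\<Sum>i=1..n. \<Sum>j=1..n. D (i, j) * q (i, j))"
    by (simp add: sum_pairs mult.commute)
  also have "\<dots> \<le> (\<Sum>i=1..n. \<Sum>j=1..n. D' i j * q (i, j))"
    using D'0 q by (intro sum_mono mult_right_mono) (auto simp: pairs_def)
  also have "\<dots> \<le> 1 * m"
  proof (rule birkhoff_weight_bound[OF _ row1 col1 _ n])
    fix i j assume "i \<in> {1..n}" "j \<in> {1..n}"
    then show "0 \<le> D' i j" using D'0[of i j] nn[of "(i, j)"] by (simp add: pairs_def)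
  next
    fix \<sigma> assume \<sigma>: "bij_betw \<sigma> {1..n} {1..n}"
    then have s_in: "\<sigma> i \<in> {1..n}" if "i \<in> {1..n}" for i using that by (auto simp: bij_betw_def)
    have "(\<Sum>ij\<in>pairs n. q ij * real (perm_schedule n \<sigma> ij))
        = (\<Sum>i=1..n. \<Sum>j=1..n. if j = \<sigma> i then q (i, \<sigma> i) else 0)"
      unfolding sum_pairs by (intro sum.cong refl) (auto simp: perm_schedule_def)
    also have "\<dots> = (\<Sum>i=1..n. q (i, \<sigma> i))"
      using s_in by (intro sum.cong refl) simp
    finally show "(\<Sum>i=1..n. q (i, \<sigma> i)) \<le> m"
      using bound[OF perm_schedule_maximal[OF \<sigma>]] by simp
  qed
  finally show ?thesis by simp
qed

lemma maximal_subset_feasible: "maximal n \<subseteq> feasible n"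
  by (auto simp: maximal_def feasible_def)

lemma finite_feasible: "finite (feasible n)"
proof -
  have "feasible n \<subseteq> (\<lambda>S ij. if ij \<in> S then 1 else 0) ` Pow (pairs n)"
  proof
    fix s assume s: "s \<in> feasible n"
    have "s ij = (if ij \<in> {ij. s ij = 1} then 1 else 0)" for ij
      using s by (cases ij) (auto simp: feasible_def)
    moreover have "{ij. s ij = 1} \<subseteq> pairs n"
      using s by (auto simp: feasible_def queues_def) (metis One_nat_def n_not_Suc_n old.prod.exhaust)
    ultimately show "s \<in> (\<lambda>S ij. if ij \<in> S then 1 else 0) ` Pow (pairs n)"
      by (intro image_eqI[of _ _ "{ij. s ij = 1}"]) auto
  qed
  then show ?thesis by (rule finite_subset) simp
qed

text \<open>\<open>pmf_of_set\<close> is meaningful only on a finite nonempty set. Nonempty because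
  a feasible schedule is a doubly substochastic matrix, so its weight cannot exceed that of the best
  maximal schedule.\<close>

lemma max_weight_schedules:
  assumes n: "n > 0"
  defines "A \<equiv> \<lambda>q. {s \<in> maximal n.
     is_arg_max (\<lambda>s. \<Sum>ij\<in>pairs n. q ij * s ij) (\<lambda>s. s \<in> feasible n) s}"
  shows "finite (A q)" "A q \<noteq> {}"
    and "set_pmf (max_weight n q) = A q"
proof -
  show fin: "finite (A q)"
    using finite_subset[OF maximal_subset_feasible finite_feasible] by (simp add: A_def)
  have finm: "finite (maximal n)"
    using finite_subset[OF maximal_subset_feasible finite_feasible] .
  let ?w = "\<lambda>s :: arr. \<Sum>ij\<in>pairs n. q ij * s ij"
  have "bij_betw id {1..n} {1..n}" by simp
  then have "maximal n \<noteq> {}" using perm_schedule_maximal by blast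
  then obtain s where s: "s \<in> maximal n" "Max (?w ` maximal n) = ?w s"
    by (rule obtains_MAX[OF finm])
  have le: "?w t \<le> ?w s" if "t \<in> maximal n" for t
    using s(2)[symmetric] that finm by simp
  have "?w t \<le> ?w s" if t: "t \<in> feasible n" for t
  proof -
    have "(\<Sum>ij\<in>pairs n. real (q ij) * real (t ij)) \<le> real (?w s)"
    proof (rule substochastic_weight_bound[OF _ _ _ _ _ n])
      show "(\<Sum>j=1..n. real (t (i, j))) \<le> 1" if "i \<in> {1..n}" for i
        using t that unfolding feasible_def by (simp flip: of_nat_sum)
      show "(\<Sum>i=1..n. real (t (i, j))) \<le> 1" if "j \<in> {1..n}" for j
        using t that unfolding feasible_def by (simp flip: of_nat_sum)
      show "(\<Sum>ij\<in>pairs n. real (q ij) * real (u ij)) \<le> real (?w s)" if "u \<in> maximal n" for u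
        using le[OF that] by (simp flip: of_nat_mult of_nat_sum)
    qed auto
    then show ?thesis by (simp flip: of_nat_mult of_nat_sum)
  qed
  then have "s \<in> A q"
    using s(1) maximal_subset_feasible by (auto simp: A_def is_arg_max_def not_less)
  then show ne: "A q \<noteq> {}" by blast
  show "set_pmf (max_weight n q) = A q"
    unfolding max_weight_def A_def by (rule set_pmf_of_set) (use ne fin in \<open>simp_all add: A_def\<close>)
qed

section \<open>Distance to the cone of arrays of the form \<open>w i + z j\<close>\<close>

definition row_sum :: "nat \<Rightarrow> (nat \<times> nat \<Rightarrow> real) \<Rightarrow> nat \<Rightarrow> real" where
  "row_sum n x i = (\<Sum>j=1..n. x (i, j))"

definition col_sum :: "nat \<Rightarrow> (nat \<times> nat \<Rightarrow> real) \<Rightarrow> nat \<Rightarrow> real" where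
  "col_sum n x j = (\<Sum>i=1..n. x (i, j))"

definition norm_sq :: "nat \<Rightarrow> (nat \<times> nat \<Rightarrow> real) \<Rightarrow> real" where
  "norm_sq n x = (\<Sum>ij\<in>pairs n. (x ij)\<^sup>2)"

lemma norm_sq_nonneg: "0 \<le> norm_sq n x"
  by (simp add: norm_sq_def sum_nonneg)

lemma sum_row_sum: "(\<Sum>i=1..n. row_sum n x i) = (\<Sum>ij\<in>pairs n. x ij)"
  by (simp add: row_sum_def sum_pairs)

lemma sum_col_sum: "(\<Sum>j=1..n. col_sum n x j) = (\<Sum>ij\<in>pairs n. x ij)"
  unfolding col_sum_def sum_pairs by (rule sum.swap)

lemma sum_pairs_row: "(\<Sum>ij\<in>pairs n. f (fst ij) * x ij) = (\<Sum>i=1..n. f i * row_sum n x i)"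
  by (simp add: sum_pairs row_sum_def sum_distrib_left)

lemma sum_pairs_col: "(\<Sum>ij\<in>pairs n. f (snd ij) * x ij) = (\<Sum>j=1..n. f j * col_sum n x j)"
  unfolding sum_pairs col_sum_def sum_distrib_left by (subst sum.swap) simp

lemma cauchy_schwarz_pairs:
  "(\<Sum>ij\<in>pairs n. x ij * y ij)\<^sup>2 \<le> norm_sq n x * norm_sq n y"
  unfolding norm_sq_def by (rule Cauchy_Schwarz_ineq_sum)

lemma card_pairs [simp]: "card (pairs n) = n * n"
  by (simp add: pairs_def)

lemma sum_squared_le: "(\<Sum>ij\<in>pairs n. x ij)\<^sup>2 \<le> real n ^ 2 * norm_sq n x"
  using cauchy_schwarz_pairs[where n = n and x = "\<lambda>_. 1" and y = x] by (simp add: norm_sq_def power2_eq_square)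

lemma sum_row_squares_le: "(\<Sum>i=1..n. (row_sum n x i)\<^sup>2) \<le> real n * norm_sq n x"
proof -
  have "(row_sum n x i)\<^sup>2 \<le> real n * (\<Sum>j=1..n. (x (i, j))\<^sup>2)" for i
    using Cauchy_Schwarz_ineq_sum[of "\<lambda>_. 1" "\<lambda>j. x (i, j)" "{1..n}"] by (simp add: row_sum_def)
  then have "(\<Sum>i=1..n. (row_sum n x i)\<^sup>2) \<le> (\<Sum>i=1..n. real n * (\<Sum>j=1..n. (x (i, j))\<^sup>2))"
    by (intro sum_mono)
  then show ?thesis by (simp add: norm_sq_def sum_pairs sum_distrib_left)
qed

lemma norm_sq_swap: "norm_sq n (\<lambda>(i, j). x (j, i)) = norm_sq n x"
  unfolding norm_sq_def sum_pairs by (subst sum.swap) simp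

lemma sum_col_squares_le: "(\<Sum>j=1..n. (col_sum n x j)\<^sup>2) \<le> real n * norm_sq n x"
  using sum_row_squares_le[of n "\<lambda>(i, j). x (j, i)"]
  by (simp add: norm_sq_swap row_sum_def col_sum_def)

text \<open>Up to the factor \<open>n\<close>, the inner product of the orthogonal projections onto the arrays of
  the form \<open>w i + z j\<close>.\<close>

definition proj_form :: "nat \<Rightarrow> (nat \<times> nat \<Rightarrow> real) \<Rightarrow> (nat \<times> nat \<Rightarrow> real) \<Rightarrow> real" where
  "proj_form n x y = (\<Sum>i=1..n. row_sum n x i * row_sum n y i) + (\<Sum>j=1..n. col_sum n x j * col_sum n y j)
     - (\<Sum>ij\<in>pairs n. x ij) * (\<Sum>ij\<in>pairs n. y ij) / n"

lemma proj_form_sym: "proj_form n x y = proj_form n y x"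
  by (simp add: proj_form_def mult.commute)

lemma row_sum_add: "row_sum n (\<lambda>ij. x ij + y ij) i = row_sum n x i + row_sum n y i"
  by (simp add: row_sum_def sum.distrib)

lemma col_sum_add: "col_sum n (\<lambda>ij. x ij + y ij) i = col_sum n x i + col_sum n y i"
  by (simp add: col_sum_def sum.distrib)

lemma row_sum_diff: "row_sum n (\<lambda>ij. x ij - y ij) i = row_sum n x i - row_sum n y i"
  by (simp add: row_sum_def sum_subtractf)

lemma col_sum_diff: "col_sum n (\<lambda>ij. x ij - y ij) i = col_sum n x i - col_sum n y i"
  by (simp add: col_sum_def sum_subtractf)

lemma proj_form_add: "proj_form n x (\<lambda>ij. y ij + z ij) = proj_form n x y + proj_form n x z"
  by (simp add: proj_form_def row_sum_add col_sum_add sum.distrib algebra_simps add_divide_distrib)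

lemma proj_form_diff: "proj_form n x (\<lambda>ij. y ij - z ij) = proj_form n x y - proj_form n x z"
  by (simp add: proj_form_def row_sum_diff col_sum_diff sum_subtractf sum.distrib algebra_simps diff_divide_distrib)

text \<open>The bracket is \<open>n\<close> times the orthogonal projection of \<open>x\<close> onto
  the span: row mean plus column mean minus overall mean. In this shape the form is linear in
  \<open>y\<close> with explicit weights, ready for \<open>E_weighted\<close> and
  Cauchy-Schwarz.\<close>

lemma proj_form_eq_sum:
  "proj_form n x y = (\<Sum>ij\<in>pairs n. (row_sum n x (fst ij) + col_sum n x (snd ij)
     - (\<Sum>ij\<in>pairs n. x ij) / n) * y ij)"
proof -
  have "(\<Sum>ij\<in>pairs n. (row_sum n x (fst ij) + col_sum n x (snd ij) - (\<Sum>ij\<in>pairs n. x ij) / n) * y ij)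
      = (\<Sum>ij\<in>pairs n. row_sum n x (fst ij) * y ij) + (\<Sum>ij\<in>pairs n. col_sum n x (snd ij) * y ij)
        - (\<Sum>ij\<in>pairs n. (\<Sum>ij\<in>pairs n. x ij) / n * y ij)"
    by (simp add: algebra_simps sum.distrib sum_subtractf)
  then show ?thesis
    unfolding sum_pairs_row sum_pairs_col by (simp add: proj_form_def sum_distrib_left[symmetric] sum_divide_distrib[symmetric])
qed

lemma proj_form_square_update:
  "proj_form n (\<lambda>ij. x ij + y ij) (\<lambda>ij. x ij + y ij)
    = proj_form n x x + 2 * proj_form n x y + proj_form n y y"
  by (simp add: proj_form_add proj_form_sym[of n "\<lambda>ij. x ij + y ij"] proj_form_sym[of n y x])

lemma proj_form_nonneg:
  assumes "n > 0"
  shows "0 \<le> proj_form n x x"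
proof -
  have "(\<Sum>i=1..n. row_sum n x i)\<^sup>2 \<le> real n * (\<Sum>i=1..n. (row_sum n x i)\<^sup>2)"
    using Cauchy_Schwarz_ineq_sum[of "\<lambda>_. 1" "row_sum n x" "{1..n}"] by simp
  then have "(\<Sum>ij\<in>pairs n. x ij)\<^sup>2 / n \<le> (\<Sum>i=1..n. (row_sum n x i)\<^sup>2)"
    using assms unfolding sum_row_sum by (simp add: divide_simps mult.commute)
  moreover have "0 \<le> (\<Sum>j=1..n. (col_sum n x j)\<^sup>2)"
    by (simp add: sum_nonneg)
  ultimately show ?thesis by (simp add: proj_form_def power2_eq_square)
qed

lemma proj_form_le: "proj_form n x x \<le> 2 * real n * norm_sq n x"
proof -
  have "0 \<le> (\<Sum>ij\<in>pairs n. x ij) * (\<Sum>ij\<in>pairs n. x ij) / real n"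
    by simp
  then show ?thesis
    using sum_row_squares_le[of n x] sum_col_squares_le[of n x]
    unfolding proj_form_def power2_eq_square by linarith
qed

section \<open>The nearest point of the cone\<close>

definition cone_minimiser :: "nat \<Rightarrow> (nat \<times> nat \<Rightarrow> real) \<Rightarrow> (nat \<Rightarrow> real) \<Rightarrow> (nat \<Rightarrow> real) \<Rightarrow> bool" where
  "cone_minimiser n q w z \<longleftrightarrow> (\<forall>i. 0 \<le> w i) \<and> (\<forall>j. 0 \<le> z j) \<and>
     (\<forall>w' z'. (\<forall>i. 0 \<le> w' i) \<longrightarrow> (\<forall>j. 0 \<le> z' j) \<longrightarrow>
        norm_sq n (\<lambda>(i, j). q (i, j) - w i - z j) \<le> norm_sq n (\<lambda>(i, j). q (i, j) - w' i - z' j))"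

text \<open>The squared distance. As an infimum it is bounded above by any candidate pair, so after
  a slot the minimiser from before the slot can be reused.\<close>

definition cone_gap :: "nat \<Rightarrow> (nat \<times> nat \<Rightarrow> real) \<Rightarrow> real" where
  "cone_gap n q = Inf {norm_sq n (\<lambda>(i, j). q (i, j) - w i - z j) | w z. (\<forall>i. 0 \<le> w i) \<and> (\<forall>j. 0 \<le> z j)}"

lemma cone_gap_eq:
  assumes "cone_minimiser n q w z"
  shows "cone_gap n q = norm_sq n (\<lambda>(i, j). q (i, j) - w i - z j)"
  unfolding cone_gap_def using assms
  by (intro cInf_eq_minimum) (auto simp: cone_minimiser_def)

lemma cone_gap_nonneg: "0 \<le> cone_gap n q"
  unfolding cone_gap_def
  by (intro cInf_greatest) (auto intro: norm_sq_nonneg exI[of _ "\<lambda>_. 0 :: real"])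

lemma cone_gap_le:
  assumes "\<And>i. 0 \<le> w i" "\<And>j. 0 \<le> z j"
  shows "cone_gap n q \<le> norm_sq n (\<lambda>(i, j). q (i, j) - w i - z j)"
  unfolding cone_gap_def
  by (intro cInf_lower bdd_belowI[of _ 0]) (use assms norm_sq_nonneg in auto)

text \<open>If a coefficient exceeds the bound \<open>M\<close> on the entries, the difference is
  already negative, and cutting the coefficient off at \<open>M\<close> only brings it closer to 0.
  This confines the minimisation to a compact set.\<close>

lemma truncated_cone_diff:
  fixes x a b M :: real
  assumes "x \<le> M" "0 \<le> M" "0 \<le> a" "0 \<le> b"
  shows "(x - min a M - min b M)\<^sup>2 \<le> (x - a - b)\<^sup>2"
proof (cases "a \<le> M \<and> b \<le> M")
  case False
  then have "0 \<le> min a M + min b M - x" "min a M + min b M - x \<le> a + b - x"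
    using assms by (auto simp: min_def)
  then have "(min a M + min b M - x)\<^sup>2 \<le> (a + b - x)\<^sup>2"
    by (simp add: power_mono)
  then show ?thesis by (simp add: power2_eq_square algebra_simps)
qed simp

lemma cone_minimiser_exists:
  assumes q: "\<And>ij. ij \<in> pairs n \<Longrightarrow> 0 \<le> q ij"
  shows "\<exists>w z. cone_minimiser n q w z"
proof -
  define M where "M = (\<Sum>ij\<in>pairs n. q ij)"
  have qM: "q ij \<le> M" if "ij \<in> pairs n" for ij
    unfolding M_def using q that by (intro member_le_sum) auto
  have M0: "0 \<le> M" unfolding M_def using q by (rule sum_nonneg)
  \<comment> \<open>Coefficients in \<open>{0..M}\<close> suffice by
    \<open>truncated_cone_diff\<close>, and the product of these intervals over all of
    \<open>nat\<close> is compact by Tychonoff.\<close>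
  define B where "B = (PiE UNIV (\<lambda>_::nat. {0..M}))"
  have "compactin (product_topology (\<lambda>_::nat. euclidean :: real topology) UNIV) B"
    unfolding B_def by (subst compactin_PiE) auto
  then have "compact B"
    by (simp add: euclidean_product_topology)
  then have cB: "compact (B \<times> B)" by (intro compact_Times)
  have "(\<lambda>_. 0) \<in> B" using M0 by (auto simp: B_def)
  then have ne: "B \<times> B \<noteq> {}" by auto
  define F where "F = (\<lambda>p :: (nat \<Rightarrow> real) \<times> (nat \<Rightarrow> real). norm_sq n (\<lambda>(i, j). q (i, j) - fst p i - snd p j))"
  have c1: "continuous_on (B \<times> B) (\<lambda>p. fst p i)" for i :: nat
    by (rule continuous_on_compose2[OF continuous_on_product_coordinates continuous_on_fst[OF continuous_on_id]]) simp
  have c2: "continuous_on (B \<times> B) (\<lambda>p. snd p i)" for i :: nat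
    by (rule continuous_on_compose2[OF continuous_on_product_coordinates continuous_on_snd[OF continuous_on_id]]) simp
  have "continuous_on (B \<times> B) F"
    unfolding F_def norm_sq_def case_prod_beta by (intro continuous_intros c1 c2)
  from continuous_attains_inf[OF cB ne this]
  obtain p where p: "p \<in> B \<times> B" "\<And>p'. p' \<in> B \<times> B \<Longrightarrow> F p \<le> F p'" by blast
  have "cone_minimiser n q (fst p) (snd p)"
    unfolding cone_minimiser_def
  proof (intro conjI allI impI)
    show "0 \<le> fst p i" "0 \<le> snd p i" for i
      using p(1) by (auto simp: B_def mem_Times_iff PiE_iff)
    fix w' z' :: "nat \<Rightarrow> real"
    assume w': "\<forall>i. 0 \<le> w' i" and z': "\<forall>j. 0 \<le> z' j"
    let ?p = "(\<lambda>i. min (w' i) M, \<lambda>j. min (z' j) M)"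
    have "?p \<in> B \<times> B" using w' z' M0 by (auto simp: B_def)
    then have "F p \<le> F ?p" by (rule p(2))
    also have "\<dots> \<le> norm_sq n (\<lambda>(i, j). q (i, j) - w' i - z' j)"
      unfolding F_def norm_sq_def using w' z' qM M0
      by (intro sum_mono) (auto intro: truncated_cone_diff)
    finally show "norm_sq n (\<lambda>(i, j). q (i, j) - fst p i - snd p j)
        \<le> norm_sq n (\<lambda>(i, j). q (i, j) - w' i - z' j)"
      by (simp add: F_def)
  qed
  then show ?thesis by blast
qed

text \<open>First-order conditions in the single variable \<open>w i\<close>: moving it by
  \<open>t \<ge> - w i\<close> changes the squared distance by
  \<open>real n * t\<^sup>2 - 2 * t * R\<close>. With \<open>R > 0\<close> an increase would pay
  off, with \<open>R < 0\<close> and \<open>w i > 0\<close> a decrease.\<close>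

lemma cone_minimiser_row:
  assumes min: "cone_minimiser n q w z" and i: "i \<in> {1..n}"
  defines "R \<equiv> row_sum n (\<lambda>(i, j). q (i, j) - w i - z j) i"
  shows "R \<le> 0" and "w i * R = 0"
proof -
  have n: "real n > 0" using i by auto
  have w0: "0 \<le> w i" and z0: "\<forall>j. 0 \<le> z j" using min by (auto simp: cone_minimiser_def)
  have key: "0 \<le> t * (real n * t - 2 * R)" if t: "- w i \<le> t" for t
  proof -
    define x where "x = (\<lambda>ij. q ij - w (fst ij) - z (snd ij))"
    have "norm_sq n (\<lambda>(k, j). q (k, j) - w k - z j)
        \<le> norm_sq n (\<lambda>(k, j). q (k, j) - (w(i := w i + t)) k - z j)"
      using min t z0 unfolding cone_minimiser_def by auto
    also have "\<dots> = (\<Sum>k=1..n. \<Sum>j=1..n. (x (k, j))\<^sup>2 + (if k = i then t\<^sup>2 - 2 * t * x (i, j) else 0))"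
      unfolding norm_sq_def sum_pairs x_def
      by (intro sum.cong refl) (auto simp: power2_eq_square algebra_simps)
    also have "\<dots> = norm_sq n (\<lambda>(k, j). q (k, j) - w k - z j)
        + (\<Sum>k=1..n. \<Sum>j=1..n. (if k = i then t\<^sup>2 - 2 * t * x (i, j) else 0))"
      by (simp add: sum.distrib norm_sq_def sum_pairs x_def)
    also have "(\<Sum>k=1..n. \<Sum>j=1..n. (if k = i then t\<^sup>2 - 2 * t * x (i, j) else 0))
        = (\<Sum>k=1..n. if k = i then (\<Sum>j=1..n. t\<^sup>2 - 2 * t * x (i, j)) else 0)"
      by (intro sum.cong refl) simp
    also have "\<dots> = real n * t\<^sup>2 - 2 * t * R"
    proof -
      have "R = (\<Sum>j=1..n. x (i, j))" by (simp add: R_def row_sum_def x_def)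
      then show ?thesis using i by (simp add: sum_subtractf sum_distrib_left)
    qed
    finally show ?thesis by (simp add: power2_eq_square algebra_simps)
  qed
  show R: "R \<le> 0"
  proof (rule ccontr)
    assume "\<not> ?thesis"
    then have R0: "R > 0" by simp
    then have "R / n * (real n * (R / n) - 2 * R) < 0"
      using n by (intro mult_pos_neg) auto
    moreover have "- w i \<le> R / n" using w0 divide_pos_pos[OF R0 n] by linarith
    ultimately show False using key[of "R / n"] by linarith
  qed
  show "w i * R = 0"
  proof (rule ccontr)
    assume "w i * R \<noteq> 0"
    then have w: "w i > 0" and R': "R < 0" using w0 R by auto
    \<comment> \<open>The unconstrained optimum \<open>R / n\<close>, cut off so that
      \<open>w i + t\<close> stays nonnegative.\<close>
    define t where "t = max (- w i) (R / n)"
    have t: "t < 0" "- w i \<le> t" "R / n \<le> t"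
      using w R' n by (auto simp: t_def divide_neg_pos)
    have "R \<le> real n * t" using t(3) n by (simp add: field_simps)
    then have "t * (real n * t - 2 * R) < 0"
      using t(1) R' by (intro mult_neg_pos) auto
    then show False using key[OF t(2)] by linarith
  qed
qed

lemma cone_minimiser_swap:
  assumes "cone_minimiser n q w z"
  shows "cone_minimiser n (\<lambda>(i, j). q (j, i)) z w"
proof -
  have sw: "norm_sq n (\<lambda>(i, j). (case (i, j) of (i, j) \<Rightarrow> q (j, i)) - a i - b j)
      = norm_sq n (\<lambda>(i, j). q (i, j) - b i - a j)" for a b
    using norm_sq_swap[of n "\<lambda>(i, j). q (i, j) - b i - a j"] by (simp add: algebra_simps)
  show ?thesis
    using assms unfolding cone_minimiser_def sw by blast
qed

lemma cone_minimiser_col: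
  assumes min: "cone_minimiser n q w z" and j: "j \<in> {1..n}"
  defines "R \<equiv> col_sum n (\<lambda>(i, j). q (i, j) - w i - z j) j"
  shows "R \<le> 0" and "z j * R = 0"
proof -
  have "row_sum n (\<lambda>(i, j). (case (i, j) of (i, j) \<Rightarrow> q (j, i)) - z i - w j) j = R"
    by (simp add: R_def row_sum_def col_sum_def algebra_simps)
  then show "R \<le> 0" "z j * R = 0"
    using cone_minimiser_row[OF cone_minimiser_swap[OF min] j] by simp_all
qed

text \<open>Complementary slackness: a coefficient is positive only on lines where the residual sums
  to 0, so the residual is orthogonal to the nearest point and only its own square remains.\<close>

lemma cone_minimiser_orthogonal:
  assumes min: "cone_minimiser n q w z"
  defines "x \<equiv> \<lambda>(i, j). q (i, j) - w i - z j"
  shows "(\<Sum>ij\<in>pairs n. q ij * x ij) = norm_sq n x"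
proof -
  have q: "q ij = x ij + w (fst ij) + z (snd ij)" for ij
    by (cases ij) (simp add: x_def)
  have "(\<Sum>ij\<in>pairs n. q ij * x ij)
      = norm_sq n x + (\<Sum>ij\<in>pairs n. w (fst ij) * x ij) + (\<Sum>ij\<in>pairs n. z (snd ij) * x ij)"
    unfolding q by (simp add: norm_sq_def power2_eq_square algebra_simps sum.distrib)
  moreover have "(\<Sum>i=1..n. w i * row_sum n x i) = 0"
    using cone_minimiser_row(2)[OF min] by (intro sum.neutral) (auto simp: x_def)
  moreover have "(\<Sum>j=1..n. z j * col_sum n x j) = 0"
    using cone_minimiser_col(2)[OF min] by (intro sum.neutral) (auto simp: x_def)
  ultimately show ?thesis by (simp add: sum_pairs_row sum_pairs_col)
qed

text \<open>The residual has nonpositive row and column sums and entries at most its norm, so adding its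
  normalised form, divided by \<open>n\<close>, to the uniform matrix leaves it doubly substochastic.\<close>

lemma max_weight_gap_bound:
  assumes n: "n > 0" and q: "\<And>ij. ij \<in> pairs n \<Longrightarrow> 0 \<le> q ij"
    and bound: "\<And>s. s \<in> maximal n \<Longrightarrow> (\<Sum>ij\<in>pairs n. q ij * real (s ij)) \<le> m"
  shows "((\<Sum>ij\<in>pairs n. q ij) + sqrt (cone_gap n q)) / n \<le> m"
proof -
  obtain w z where min: "cone_minimiser n q w z" using cone_minimiser_exists[of n q] q by blast
  define x where "x = (\<lambda>(i, j). q (i, j) - w i - z j)"
  define Y where "Y = sqrt (cone_gap n q)"
  have Y2: "Y\<^sup>2 = norm_sq n x"
    unfolding Y_def x_def cone_gap_eq[OF min, symmetric] by (rule real_sqrt_pow2[OF cone_gap_nonneg])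
  have Y0: "0 \<le> Y" by (simp add: Y_def cone_gap_nonneg)
  have absx: "\<bar>x ij\<bar> \<le> Y" if "ij \<in> pairs n" for ij
  proof -
    have "(x ij)\<^sup>2 \<le> Y\<^sup>2"
      unfolding Y2 norm_sq_def using that by (intro member_le_sum) auto
    then show ?thesis using Y0 by (simp add: abs_le_square_iff[symmetric])
  qed
  \<comment> \<open>For \<open>Y = 0\<close> the quotient is 0 by convention and \<open>D\<close> is
    the uniform matrix.\<close>
  define D where "D = (\<lambda>ij. (1 + x ij / Y) / n)"
  have "(\<Sum>ij\<in>pairs n. q ij * D ij) \<le> m"
  proof (rule substochastic_weight_bound[OF _ _ _ q bound n])
    fix ij assume "ij \<in> pairs n"
    then have "- Y \<le> x ij" using absx[of ij] by linarith
    then show "0 \<le> D ij"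
      using Y0 n by (cases "Y = 0") (auto simp: D_def field_simps)
  next
    fix i assume i: "i \<in> {1..n}"
    have "(\<Sum>j=1..n. D (i, j)) = (real n + row_sum n x i / Y) / n"
      by (simp add: D_def row_sum_def sum.distrib sum_divide_distrib[symmetric])
    also have "row_sum n x i / Y \<le> 0"
      using cone_minimiser_row(1)[OF min i] Y0 by (simp add: x_def divide_nonpos_nonneg)
    then have "(real n + row_sum n x i / Y) / n \<le> 1"
      using n by simp
    finally show "(\<Sum>j=1..n. D (i, j)) \<le> 1" .
  next
    fix j assume j: "j \<in> {1..n}"
    have "(\<Sum>i=1..n. D (i, j)) = (real n + col_sum n x j / Y) / n"
      by (simp add: D_def col_sum_def sum.distrib sum_divide_distrib[symmetric])
    also have "col_sum n x j / Y \<le> 0"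
      using cone_minimiser_col(1)[OF min j] Y0 by (simp add: x_def divide_nonpos_nonneg)
    then have "(real n + col_sum n x j / Y) / n \<le> 1"
      using n by simp
    finally show "(\<Sum>i=1..n. D (i, j)) \<le> 1" .
  qed
  also have "(\<Sum>ij\<in>pairs n. q ij * D ij) = ((\<Sum>ij\<in>pairs n. q ij) + (\<Sum>ij\<in>pairs n. q ij * x ij) / Y) / n"
    by (simp add: D_def algebra_simps sum.distrib sum_divide_distrib add_divide_distrib)
  \<comment> \<open>Orthogonality makes the gain over the uniform matrix exactly
    \<open>Y / n\<close>.\<close>
  also have "(\<Sum>ij\<in>pairs n. q ij * x ij) = Y\<^sup>2"
    using cone_minimiser_orthogonal[OF min] Y2 by (simp add: x_def)
  also have "Y\<^sup>2 / Y = Y" by (simp add: power2_eq_square)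
  finally show ?thesis by (simp add: Y_def)
qed

text \<open>Where \<open>u\<close> is positive \<open>q\<close> vanishes, so only the residual of \<open>q\<close> contributes to the
  projected inner product.\<close>

lemma proj_form_unused_bound:
  assumes n: "n > 0" and q: "\<And>ij. ij \<in> pairs n \<Longrightarrow> 0 \<le> q ij"
    and u: "\<And>ij. ij \<in> pairs n \<Longrightarrow> u ij = 0 \<or> u ij = 1"
    and qu: "\<And>ij. ij \<in> pairs n \<Longrightarrow> q ij * u ij = 0"
  shows "\<bar>proj_form n q u\<bar> \<le> 4 * real n * (sqrt (cone_gap n q) * sqrt (\<Sum>ij\<in>pairs n. u ij))"
proof -
  obtain w z where min: "cone_minimiser n q w z" using cone_minimiser_exists[of n q] q by blast
  define x where "x = (\<lambda>(i, j). q (i, j) - w i - z j)"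
  define W where "W = (\<Sum>i=1..n. w i)"
  define Z where "Z = (\<Sum>j=1..n. z j)"
  define X where "X = (\<Sum>ij\<in>pairs n. x ij)"
  have gap: "cone_gap n q = norm_sq n x" using cone_gap_eq[OF min] by (simp add: x_def)
  have qx: "q (i, j) = x (i, j) + (w i + z j)" for i j by (simp add: x_def)
  have rq: "row_sum n q i = row_sum n x i + (real n * w i + Z)" for i
    unfolding row_sum_def qx by (simp add: sum.distrib Z_def)
  have cq: "col_sum n q j = col_sum n x j + (W + real n * z j)" for j
    unfolding col_sum_def qx by (simp add: sum.distrib W_def)
  have tq: "(\<Sum>ij\<in>pairs n. q ij) = X + real n * (W + Z)"
    unfolding X_def sum_pairs qx
    by (simp add: sum.distrib W_def Z_def sum_distrib_left algebra_simps)
  \<comment> \<open>This is \<open>n\<close> times the projection of \<open>x\<close> onto the span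
    minus \<open>n * x\<close>. The cone part of \<open>q\<close> is fixed by the projection, and
    what is left over, \<open>n * q\<close>, vanishes where \<open>u\<close> is positive.\<close>
  define y where "y = (\<lambda>ij. row_sum n x (fst ij) + col_sum n x (snd ij) - X / n - n * x ij)"
  have form: "proj_form n q u = (\<Sum>ij\<in>pairs n. y ij * u ij)"
    unfolding proj_form_eq_sum
  proof (intro sum.cong refl)
    fix ij assume ij: "ij \<in> pairs n"
    have "(row_sum n q (fst ij) + col_sum n q (snd ij) - (\<Sum>ij\<in>pairs n. q ij) / n) * u ij
        = (y ij + n * q ij) * u ij"
      using n by (cases ij) (simp add: rq cq tq y_def qx field_simps)
    also have "\<dots> = y ij * u ij" using qu[OF ij] by (simp add: algebra_simps)
    finally show "(row_sum n q (fst ij) + col_sum n q (snd ij) - (\<Sum>ij\<in>pairs n. q ij) / n) * u ij = y ij * u ij" .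
  qed
  have "norm_sq n y \<le> (\<Sum>ij\<in>pairs n. 4 * ((row_sum n x (fst ij))\<^sup>2 + (col_sum n x (snd ij))\<^sup>2
      + (X / n)\<^sup>2 + (n * x ij)\<^sup>2))"
    unfolding norm_sq_def
  proof (intro sum_mono)
    fix ij
    have "(a + b - c - d)\<^sup>2 \<le> 4 * (a\<^sup>2 + b\<^sup>2 + c\<^sup>2 + d\<^sup>2)" for a b c d :: real
      using zero_le_power2[of "a - b"] zero_le_power2[of "a + c"] zero_le_power2[of "a + d"]
        zero_le_power2[of "b + c"] zero_le_power2[of "b + d"] zero_le_power2[of "c - d"]
      by (simp add: power2_eq_square algebra_simps)
    then show "(y ij)\<^sup>2 \<le> 4 * ((row_sum n x (fst ij))\<^sup>2 + (col_sum n x (snd ij))\<^sup>2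
        + (X / n)\<^sup>2 + (n * x ij)\<^sup>2)"
      unfolding y_def .
  qed
  also have "\<dots> = 4 * (real n * (\<Sum>i=1..n. (row_sum n x i)\<^sup>2) + real n * (\<Sum>j=1..n. (col_sum n x j)\<^sup>2)
      + X\<^sup>2 + real n ^ 2 * norm_sq n x)"
    using n by (simp add: sum_distrib_left[symmetric] sum.distrib norm_sq_def sum_pairs power_mult_distrib
        power_divide power2_eq_square) (simp add: sum_distrib_left mult_ac)
  also have "\<dots> \<le> 4 * (real n * (real n * norm_sq n x) + real n * (real n * norm_sq n x)
      + real n ^ 2 * norm_sq n x + real n ^ 2 * norm_sq n x)"
    unfolding X_def
    by (intro mult_left_mono add_mono sum_row_squares_le sum_col_squares_le sum_squared_le) auto
  also have "\<dots> = (4 * real n)\<^sup>2 * norm_sq n x" by (simp add: power2_eq_square)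
  finally have ny: "norm_sq n y \<le> (4 * real n)\<^sup>2 * norm_sq n x" .
  have nu: "norm_sq n u = (\<Sum>ij\<in>pairs n. u ij)"
    unfolding norm_sq_def by (intro sum.cong refl) (use u in force)
  have U0: "0 \<le> (\<Sum>ij\<in>pairs n. u ij)" using norm_sq_nonneg[of n u] nu by simp
  have "(proj_form n q u)\<^sup>2 \<le> norm_sq n y * norm_sq n u"
    unfolding form by (rule cauchy_schwarz_pairs)
  also have "\<dots> \<le> ((4 * real n)\<^sup>2 * norm_sq n x) * (\<Sum>ij\<in>pairs n. u ij)"
    unfolding nu by (intro mult_right_mono ny U0)
  also have "\<dots> = (4 * real n * (sqrt (cone_gap n q) * sqrt (\<Sum>ij\<in>pairs n. u ij)))\<^sup>2"
    using U0 norm_sq_nonneg[of n x] by (simp add: gap power_mult_distrib)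
  finally show ?thesis
    using U0 norm_sq_nonneg[of n x]
    by (simp only: abs_le_square_iff[symmetric]) (simp add: gap)
qed

section \<open>One slot of the switch\<close>

text \<open>\<open>Y\<^sup>2\<close> is a squared distance before the slot, \<open>F'\<close> bounds
  or equals it afterwards, \<open>\<xi>\<close> is the inner product with the increment and
  \<open>G\<close> bounds the squared length of the increment. Squaring once more turns the linear
  drift of \<open>\<xi>\<close> into a cubic one.\<close>

lemma square_drift:
  fixes F' \<xi> G :: "'a \<Rightarrow> real"
  assumes fin: "finite (set_pmf p)" and Y: "0 \<le> Y"
    and F': "\<And>a. a \<in> set_pmf p \<Longrightarrow> 0 \<le> F' a \<and> F' a \<le> Y\<^sup>2 + 2 * \<xi> a + G a"
    and \<xi>: "\<And>a. a \<in> set_pmf p \<Longrightarrow> (\<xi> a)\<^sup>2 \<le> Y\<^sup>2 * G a"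
    and E\<xi>: "mean p \<xi> \<le> - \<kappa> * Y"
    and EG: "mean p G \<le> g1"
    and EG2: "mean p (\<lambda>a. (G a)\<^sup>2) \<le> g2"
    and \<kappa>: "\<kappa> > 0" and g1: "0 \<le> g1"
  shows "mean p (\<lambda>a. (F' a)\<^sup>2)
    \<le> (Y\<^sup>2)\<^sup>2 - 2 * \<kappa> * Y ^ 3 + (250 * g1 ^ 3 / \<kappa>\<^sup>2 + 2 * g2)"
proof -
  note int = integrable_measure_pmf_finite[OF fin]
  have pw: "(F' a)\<^sup>2 \<le> (Y\<^sup>2)\<^sup>2 + 4 * Y\<^sup>2 * \<xi> a + 10 * Y\<^sup>2 * G a + 2 * (G a)\<^sup>2" if a: "a \<in> set_pmf p" for a
  proof -
    have "(F' a)\<^sup>2 \<le> (Y\<^sup>2 + 2 * \<xi> a + G a)\<^sup>2"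
      using F'[OF a] by (intro power_mono) auto
    also have "\<dots> \<le> (Y\<^sup>2)\<^sup>2 + 2 * Y\<^sup>2 * (2 * \<xi> a + G a) + (8 * (\<xi> a)\<^sup>2 + 2 * (G a)\<^sup>2)"
      using zero_le_power2[of "2 * \<xi> a - G a"] by (simp add: power2_eq_square algebra_simps)
    also have "\<dots> \<le> (Y\<^sup>2)\<^sup>2 + 2 * Y\<^sup>2 * (2 * \<xi> a + G a) + (8 * (Y\<^sup>2 * G a) + 2 * (G a)\<^sup>2)"
      using \<xi>[OF a] by simp
    finally show ?thesis by (simp add: algebra_simps)
  qed
  have "mean p (\<lambda>a. (F' a)\<^sup>2)
      \<le> mean p (\<lambda>a. (Y\<^sup>2)\<^sup>2 + 4 * Y\<^sup>2 * \<xi> a + 10 * Y\<^sup>2 * G a + 2 * (G a)\<^sup>2)"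
    by (intro mean_mono_finite fin pw)
  also have "\<dots> = (Y\<^sup>2)\<^sup>2 + 4 * Y\<^sup>2 * mean p \<xi> + 10 * Y\<^sup>2 * mean p G
      + 2 * mean p (\<lambda>a. (G a)\<^sup>2)"
    by (simp add: int)
  also have "\<dots> \<le> (Y\<^sup>2)\<^sup>2 + (4 * Y\<^sup>2 * (- \<kappa> * Y) + 10 * Y\<^sup>2 * g1) + 2 * g2"
    unfolding add.assoc by (intro add_mono mult_left_mono E\<xi> EG EG2) auto
  \<comment> \<open>Half of the cubic term absorbs \<open>10 * Y\<^sup>2 * g1\<close> once
    \<open>Y\<close> is at least \<open>5 * g1 / \<kappa>\<close>; below that threshold the
    quadratic term is at most the constant.\<close>
  also have "4 * Y\<^sup>2 * (- \<kappa> * Y) + 10 * Y\<^sup>2 * g1 \<le> - 2 * \<kappa> * Y ^ 3 + 250 * g1 ^ 3 / \<kappa>\<^sup>2"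
  proof (cases "5 * g1 \<le> \<kappa> * Y")
    case True
    have "Y\<^sup>2 * (10 * g1 - 2 * \<kappa> * Y) \<le> 0"
      using True by (intro mult_nonneg_nonpos) (auto simp: mult.commute)
    then have "10 * Y\<^sup>2 * g1 \<le> 2 * \<kappa> * Y ^ 3"
      by (simp add: power2_eq_square power3_eq_cube algebra_simps)
    moreover have "0 \<le> 250 * g1 ^ 3 / \<kappa>\<^sup>2" using g1 by simp
    ultimately show ?thesis by (simp add: power2_eq_square power3_eq_cube algebra_simps)
  next
    case False
    then have "Y \<le> 5 * g1 / \<kappa>" using \<kappa> by (simp add: field_simps)
    then have "Y\<^sup>2 \<le> (5 * g1 / \<kappa>)\<^sup>2" using Y by (intro power_mono) auto
    then have "10 * Y\<^sup>2 * g1 \<le> 10 * (5 * g1 / \<kappa>)\<^sup>2 * g1"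
      using g1 by (intro mult_right_mono) auto
    also have "\<dots> = 250 * g1 ^ 3 / \<kappa>\<^sup>2"
      by (simp add: power_divide power_mult_distrib power2_eq_square power3_eq_cube)
    finally have "10 * Y\<^sup>2 * g1 \<le> 250 * g1 ^ 3 / \<kappa>\<^sup>2" .
    moreover have "0 \<le> \<kappa> * Y ^ 3" using \<kappa> Y by simp
    ultimately show ?thesis by (simp add: power2_eq_square power3_eq_cube algebra_simps)
  qed
  finally show ?thesis by simp
qed

definition served :: "arr \<Rightarrow> arr \<Rightarrow> arr \<Rightarrow> arr" where
  "served q s a = (\<lambda>ij. q ij + a ij - s ij)"

definition unused :: "arr \<Rightarrow> arr \<Rightarrow> arr \<Rightarrow> arr" where
  "unused q s a = (\<lambda>ij. s ij - (q ij + a ij))"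

abbreviation real_arr :: "arr \<Rightarrow> nat \<times> nat \<Rightarrow> real" where
  "real_arr q \<equiv> \<lambda>ij. real (q ij)"

lemma real_served: "real (served q s a ij) = real (q ij) + (real (a ij) - real (s ij)) + real (unused q s a ij)"
  by (simp add: served_def unused_def of_nat_diff)

abbreviation queue_norm :: "nat \<Rightarrow> arr \<Rightarrow> real" where
  "queue_norm n q \<equiv> norm_sq n (real_arr q)"

abbreviation queue_gap :: "nat \<Rightarrow> arr \<Rightarrow> real" where
  "queue_gap n q \<equiv> cone_gap n (real_arr q)"

abbreviation change :: "arr \<Rightarrow> arr \<Rightarrow> arr \<Rightarrow> nat \<times> nat \<Rightarrow> real" where
  "change q s a \<equiv> \<lambda>ij. (real (a ij) - real (s ij)) + real (unused q s a ij)"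

lemma served_unused: "served q s a ij * unused q s a ij = 0"
  by (simp add: served_def unused_def) linarith

lemma total_served:
  "total n (served q s a) = total n q + total n a - total n s + total n (unused q s a)"
  by (simp add: total_def real_served sum.distrib sum_subtractf)

lemma maximalD:
  assumes "s \<in> maximal n"
  shows "s ij = 0 \<or> s ij = 1" "ij \<notin> pairs n \<Longrightarrow> s ij = 0"
    and "i \<in> {1..n} \<Longrightarrow> row_sum n (real_arr s) i = 1"
    and "j \<in> {1..n} \<Longrightarrow> col_sum n (real_arr s) j = 1"
    and "total n s = n"
proof -
  show "s ij = 0 \<or> s ij = 1" "ij \<notin> pairs n \<Longrightarrow> s ij = 0"
    using assms by (cases ij; auto simp: maximal_def queues_def)+
  show row: "row_sum n (real_arr s) i = 1" if "i \<in> {1..n}" for i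
    using assms that unfolding maximal_def row_sum_def by (simp flip: of_nat_sum)
  show "col_sum n (real_arr s) j = 1" if "j \<in> {1..n}"
    using assms that unfolding maximal_def col_sum_def by (simp flip: of_nat_sum)
  show "total n s = n"
    unfolding total_def sum_row_sum[symmetric] using row by simp
qed

lemma max_weight_maximal:
  assumes "n > 0" and s: "s \<in> set_pmf (max_weight n q)"
  shows "s \<in> maximal n"
    and "t \<in> maximal n \<Longrightarrow> (\<Sum>ij\<in>pairs n. real (q ij) * real (t ij)) \<le> (\<Sum>ij\<in>pairs n. real (q ij) * real (s ij))"
proof -
  show "s \<in> maximal n" using s max_weight_schedules(3)[OF assms(1)] by auto
  assume "t \<in> maximal n"
  then have "\<not> (\<Sum>ij\<in>pairs n. q ij * s ij) < (\<Sum>ij\<in>pairs n. q ij * t ij)"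
    using s max_weight_schedules(3)[OF assms(1), of q] maximal_subset_feasible
    by (auto simp: is_arg_max_def)
  then show "(\<Sum>ij\<in>pairs n. real (q ij) * real (t ij)) \<le> (\<Sum>ij\<in>pairs n. real (q ij) * real (s ij))"
    by (simp flip: of_nat_mult of_nat_sum)
qed

section \<open>Moments of the arrivals\<close>

locale bernoulli_switch =
  fixes n :: nat and lam :: real
  assumes n_pos: "n > 0" and lam_pos: "0 < lam" and load_lt_1: "real n * lam < 1"
begin

definition arrivals :: "arr pmf" where
  "arrivals = Pi_pmf (pairs n) 0 (\<lambda>_. map_pmf of_bool (bernoulli_pmf lam))"

definition kernel :: "policy \<Rightarrow> arr \<Rightarrow> arr pmf" where
  "kernel = switch_kernel n (\<lambda>_. map_pmf of_bool (bernoulli_pmf lam))"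

definition slack :: real where
  "slack = 1 - real n * lam"

abbreviation E :: "(arr \<Rightarrow> real) \<Rightarrow> real" where
  "E \<equiv> mean arrivals"

lemma lam_lt_1: "lam < 1"
proof -
  have "1 * lam \<le> real n * lam" using n_pos lam_pos by (intro mult_right_mono) auto
  then show ?thesis using load_lt_1 by linarith
qed

lemma slack_pos: "0 < slack" and slack_lt_1: "slack < 1"
  using load_lt_1 lam_pos n_pos by (auto simp: slack_def)

lemma set_arrivals: "set_pmf arrivals = {a \<in> queues n. \<forall>ij. a ij = 0 \<or> a ij = 1}"
proof -
  have "set_pmf (bernoulli_pmf lam) = UNIV"
    using lam_pos lam_lt_1 by (intro set_pmf_bernoulli) auto
  then show ?thesis
    by (auto simp: arrivals_def set_Pi_pmf PiE_dflt_def queues_def UNIV_bool)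
qed

lemma finite_arrivals: "finite (set_pmf arrivals)"
  unfolding arrivals_def by (subst set_Pi_pmf) (auto intro!: finite_PiE_dflt)

lemma int_arrivals [simp]: "integrable (measure_pmf arrivals) (f :: arr \<Rightarrow> real)"
  by (intro integrable_measure_pmf_finite finite_arrivals)

lemma E_component:
  assumes "ij \<in> pairs n"
  shows "E (\<lambda>a. real (a ij)) = lam"
proof -
  have "E (\<lambda>a. real (a ij)) = mean (map_pmf (\<lambda>a. a ij) arrivals) real"
    by simp
  also have "map_pmf (\<lambda>a. a ij) arrivals = map_pmf of_bool (bernoulli_pmf lam)"
    unfolding arrivals_def using assms by (subst Pi_pmf_component) auto
  finally show ?thesis using lam_pos lam_lt_1 by simp
qed

lemma E_component2:
  assumes x: "x \<in> pairs n" and y: "y \<in> pairs n"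
  shows "E (\<lambda>a. real (a x) * real (a y)) = (if x = y then lam else lam\<^sup>2)"
proof (cases "x = y")
  case True
  have "E (\<lambda>a. real (a x) * real (a y)) = E (\<lambda>a. real (a x))"
  proof (intro integral_cong_AE AE_pmfI)
    fix a assume "a \<in> set_pmf arrivals"
    then have "a y = 0 \<or> a y = 1" by (cases y) (simp add: set_arrivals)
    then show "real (a x) * real (a y) = real (a x)" using True by auto
  qed auto
  then show ?thesis using True E_component[OF x] by simp
next
  case False
  define f where "f = (\<lambda>z v. if z \<in> {x, y} then real v else 1)"
  have f: "(\<Prod>z\<in>pairs n. f z (a z)) = real (a x) * real (a y)" for a :: arr
  proof -
    have "(\<Prod>z\<in>pairs n. f z (a z)) = (\<Prod>z\<in>{x, y}. f z (a z))"
      using x y by (intro prod.mono_neutral_right) (auto simp: f_def)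
    then show ?thesis using False by (simp add: f_def)
  qed
  let ?p = "map_pmf of_bool (bernoulli_pmf lam) :: nat pmf"
  have "E (\<lambda>a. \<Prod>z\<in>pairs n. f z (a z)) = (\<Prod>z\<in>pairs n. mean ?p (f z))"
    unfolding arrivals_def
    by (rule expectation_prod_Pi_pmf) (auto intro!: integrable_measure_pmf_finite simp: f_def)
  also have "\<dots> = (\<Prod>z\<in>{x, y}. mean ?p (f z))"
    using x y by (intro prod.mono_neutral_right) (auto simp: f_def)
  also have "\<dots> = lam\<^sup>2"
    using False lam_pos lam_lt_1 by (simp add: f_def power2_eq_square)
  finally show ?thesis using False by (simp add: f)
qed

lemma E_weighted: "E (\<lambda>a. \<Sum>ij\<in>pairs n. f ij * real (a ij)) = lam * (\<Sum>ij\<in>pairs n. f ij)"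
  by (simp add: E_component sum_distrib_left mult.commute)

lemma E_sum_square:
  assumes S: "S \<subseteq> pairs n"
  shows "E (\<lambda>a. (\<Sum>ij\<in>S. real (a ij))\<^sup>2) = real (card S) * lam + real (card S) * (real (card S) - 1) * lam\<^sup>2"
proof -
  have fin: "finite S" using finite_subset[OF S] by simp
  have "E (\<lambda>a. (\<Sum>ij\<in>S. real (a ij))\<^sup>2) = E (\<lambda>a. \<Sum>x\<in>S. \<Sum>y\<in>S. real (a x) * real (a y))"
    by (simp add: power2_eq_square sum_product)
  also have "\<dots> = (\<Sum>x\<in>S. \<Sum>y\<in>S. if x = y then lam else lam\<^sup>2)"
    by (simp, intro sum.cong refl E_component2) (use S in auto)
  also have "\<dots> = (\<Sum>x\<in>S. \<Sum>y\<in>S. lam\<^sup>2 + (if x = y then lam - lam\<^sup>2 else 0))"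
    by (intro sum.cong refl) auto
  also have "\<dots> = (\<Sum>x\<in>S. real (card S) * lam\<^sup>2 + (lam - lam\<^sup>2))"
    using fin by (intro sum.cong refl) (simp add: sum.distrib)
  finally show ?thesis by (simp add: algebra_simps)
qed

lemma E_total: "E (total n) = real n ^ 2 * lam"
  unfolding total_def using E_weighted[of "\<lambda>_. 1"] by (simp add: power2_eq_square)

lemma E_total_sq: "E (\<lambda>a. (total n a)\<^sup>2) = real n ^ 2 * lam + real n ^ 2 * (real n ^ 2 - 1) * lam\<^sup>2"
  unfolding total_def by (subst E_sum_square) (auto simp: power2_eq_square)

lemma E_line_sq:
  assumes "inj f" and "\<And>k. k \<in> {1..n} \<Longrightarrow> f k \<in> pairs n"
  shows "E (\<lambda>a. (\<Sum>k=1..n. real (a (f k)))\<^sup>2) = real n * lam + real n * (real n - 1) * lam\<^sup>2"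
proof -
  have inj: "inj_on f {1..n}" using assms(1) by (rule inj_on_subset) simp
  have "(\<Sum>k=1..n. real (a (f k))) = (\<Sum>ij\<in>f ` {1..n}. real (a ij))" for a :: arr
    by (simp only: sum.reindex[OF inj] comp_def)
  moreover have "f ` {1..n} \<subseteq> pairs n" using assms(2) by blast
  ultimately show ?thesis using E_sum_square[of "f ` {1..n}"] card_image[OF inj] by simp
qed

lemma E_row_sq:
  assumes "i \<in> {1..n}"
  shows "E (\<lambda>a. (row_sum n (real_arr a) i)\<^sup>2) = real n * lam + real n * (real n - 1) * lam\<^sup>2"
  unfolding row_sum_def using assms by (intro E_line_sq) (auto simp: inj_def pairs_def)

lemma E_col_sq:
  assumes "j \<in> {1..n}"
  shows "E (\<lambda>a. (col_sum n (real_arr a) j)\<^sup>2) = real n * lam + real n * (real n - 1) * lam\<^sup>2"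
  unfolding col_sum_def using assms by (intro E_line_sq) (auto simp: inj_def pairs_def)

lemma E_row:
  assumes "i \<in> {1..n}"
  shows "E (\<lambda>a. row_sum n (real_arr a) i) = real n * lam"
  using assms unfolding row_sum_def by (simp add: E_component pairs_def)

text \<open>\<open>total n a + n\<close> dominates the squared length of the change in one slot
  (\<open>shifted_norm_sq\<close>). Its moments are bounded independently of the load and enter the
  drift estimates below.\<close>

lemma E_total_plus: "E (\<lambda>a. total n a + n) \<le> 2 * real n"
  and E_total_plus_sq: "E (\<lambda>a. (total n a + n)\<^sup>2) \<le> 5 * real n ^ 2"
proof -
  have n1: "1 \<le> real n" using n_pos by simp
  have nl: "real n * lam \<le> 1" "0 \<le> real n * lam" using load_lt_1 lam_pos by auto
  have a: "real n ^ 2 * lam \<le> real n"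
    using mult_left_mono[OF nl(1), of "real n"] by (simp add: power2_eq_square mult.assoc)
  then show "E (\<lambda>a. total n a + n) \<le> 2 * real n" by (simp add: E_total)
  have "(real n * lam)\<^sup>2 \<le> 1" using nl by (intro power_le_one) auto
  then have b: "real n ^ 2 * (real n * lam)\<^sup>2 \<le> real n ^ 2 * 1" by (intro mult_left_mono) auto
  have c: "real n \<le> real n ^ 2" using n1 by (simp add: power2_eq_square)
  have "E (\<lambda>a. (total n a + n)\<^sup>2) = E (\<lambda>a. (total n a)\<^sup>2) + 2 * real n * E (total n) + real n ^ 2"
    by (simp add: power2_sum mult.commute mult.left_commute)
  also have "\<dots> = real n ^ 2 * lam + real n ^ 2 * (real n * lam)\<^sup>2 - real n ^ 2 * lam\<^sup>2
      + 2 * real n * (real n ^ 2 * lam) + real n ^ 2"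
    by (simp add: E_total E_total_sq power_mult_distrib algebra_simps)
  also have "\<dots> \<le> real n ^ 2 + real n ^ 2 * 1 - 0 + 2 * real n * real n + real n ^ 2"
  proof -
    have "0 \<le> real n ^ 2 * lam\<^sup>2" by simp
    moreover have "2 * real n * (real n ^ 2 * lam) \<le> 2 * real n * real n"
      using a by (intro mult_left_mono) auto
    ultimately show ?thesis using a b c by linarith
  qed
  finally show "E (\<lambda>a. (total n a + n)\<^sup>2) \<le> 5 * real n ^ 2"
    by (simp add: power2_eq_square)
qed

lemma kernel_eq: "kernel pol q = bind_pmf (pol q) (\<lambda>s. map_pmf (served q s) arrivals)"
  unfolding kernel_def switch_kernel_def arrivals_def map_pmf_def served_def ..

lemma E_kernel:
  assumes "finite (set_pmf (pol q))"
  shows "mean (kernel pol q) f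
    = mean (pol q) (\<lambda>s. E (\<lambda>a. f (served q s a)))"
  unfolding kernel_eq using assms finite_arrivals by (subst mean_bind_finite) auto

lemma kernel_le:
  assumes "finite (set_pmf (pol q))" "\<And>s. s \<in> set_pmf (pol q) \<Longrightarrow> E (\<lambda>a. f (served q s a)) \<le> c"
  shows "mean (kernel pol q) f \<le> c"
  unfolding E_kernel[of pol q, OF assms(1)] by (rule mean_le_bound_finite[OF assms])

lemma policy_chain:
  assumes "scheduling_policy n pol"
  shows "finite_step_chain (kernel pol) (queues n)"
proof
  fix q assume q: "q \<in> queues n"
  then have pol: "set_pmf (pol q) \<subseteq> feasible n"
    using assms by (simp add: scheduling_policy_def)
  then show "finite (set_pmf (kernel pol q))"
    using finite_subset[OF pol finite_feasible] finite_arrivals by (simp add: kernel_eq)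
  show "set_pmf (kernel pol q) \<subseteq> queues n"
    using q pol by (auto simp: kernel_eq set_arrivals queues_def served_def feasible_def)
qed

lemma max_weight_policy: "scheduling_policy n (max_weight n)"
  using max_weight_schedules(3)[OF n_pos] maximal_subset_feasible
  by (auto simp: scheduling_policy_def)

lemma finite_max_weight: "finite (set_pmf (max_weight n q))"
  using max_weight_schedules[OF n_pos, of q] by simp

section \<open>Drift of quadratic functionals under MaxWeight\<close>

lemma unused_01:
  assumes "s \<in> maximal n"
  shows "unused q s a ij = 0 \<or> unused q s a ij = 1" "unused q s a ij \<le> s ij" "q ij * unused q s a ij = 0"
proof -
  have "s ij = 0 \<or> s ij = 1" by (rule maximalD[OF assms])
  then show "unused q s a ij = 0 \<or> unused q s a ij = 1" "unused q s a ij \<le> s ij" "q ij * unused q s a ij = 0"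
    by (auto simp: unused_def)
qed

text \<open>Every entry of the change is -1, 0 or 1 and its square is at most
  \<open>a ij + s ij\<close>. \<open>x\<close> is arbitrary so that the estimate serves both the
  queue lengths and their residual from the cone.\<close>

lemma shifted_norm_sq:
  fixes q :: arr
  assumes s: "s \<in> maximal n" and a: "a \<in> set_pmf arrivals"
  defines "d \<equiv> change q s a"
  shows "norm_sq n (\<lambda>ij. x ij + d ij) \<le> norm_sq n x + 2 * (\<Sum>ij\<in>pairs n. x ij * d ij) + (total n a + n)"
    and "(\<Sum>ij\<in>pairs n. x ij * d ij)\<^sup>2 \<le> norm_sq n x * (total n a + n)"
proof -
  have "(d ij)\<^sup>2 \<le> real (a ij) + real (s ij)" for ij
  proof -
    have "a ij = 0 \<or> a ij = 1" "s ij = 0 \<or> s ij = 1"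
      using a maximalD(1)[OF s] by (cases ij; simp add: set_arrivals)+
    then show ?thesis by (cases "q ij") (auto simp: d_def unused_def)
  qed
  then have "norm_sq n d \<le> (\<Sum>ij\<in>pairs n. real (a ij) + real (s ij))"
    unfolding norm_sq_def by (intro sum_mono)
  then have d: "norm_sq n d \<le> total n a + n"
    using maximalD(5)[OF s] by (simp add: total_def sum.distrib)
  have "norm_sq n (\<lambda>ij. x ij + d ij) = norm_sq n x + 2 * (\<Sum>ij\<in>pairs n. x ij * d ij) + norm_sq n d"
    by (simp add: norm_sq_def power2_sum sum.distrib sum_distrib_left algebra_simps)
  then show "norm_sq n (\<lambda>ij. x ij + d ij) \<le> norm_sq n x + 2 * (\<Sum>ij\<in>pairs n. x ij * d ij) + (total n a + n)"
    using d by simp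
  have "(\<Sum>ij\<in>pairs n. x ij * d ij)\<^sup>2 \<le> norm_sq n x * norm_sq n d"
    by (rule cauchy_schwarz_pairs)
  also have "\<dots> \<le> norm_sq n x * (total n a + n)"
    by (intro mult_left_mono d norm_sq_nonneg)
  finally show "(\<Sum>ij\<in>pairs n. x ij * d ij)\<^sup>2 \<le> norm_sq n x * (total n a + n)" .
qed

lemma queue_inner_drift:
  assumes s: "s \<in> set_pmf (max_weight n q)"
  shows "E (\<lambda>a. \<Sum>ij\<in>pairs n. real (q ij) * change q s a ij)
    \<le> - slack * total n q / n"
proof -
  have smax: "s \<in> maximal n" using max_weight_maximal(1)[OF n_pos s] .
  define m where "m = (\<Sum>ij\<in>pairs n. real (q ij) * real (s ij))"
  have "(\<Sum>ij\<in>pairs n. real (q ij) * change q s a ij)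
      = (\<Sum>ij\<in>pairs n. real (q ij) * real (a ij)) - m" for a
    unfolding m_def sum_subtractf[symmetric]
  proof (intro sum.cong refl)
    fix ij
    have "real (q ij) * real (unused q s a ij) = 0"
      unfolding of_nat_mult[symmetric] unused_01(3)[OF smax] by simp
    then show "real (q ij) * change q s a ij
        = real (q ij) * real (a ij) - real (q ij) * real (s ij)"
      by (simp only: distrib_left right_diff_distrib)
  qed
  then have "E (\<lambda>a. \<Sum>ij\<in>pairs n. real (q ij) * change q s a ij)
      = lam * total n q - m"
    by (simp add: E_weighted total_def)
  moreover have "((\<Sum>ij\<in>pairs n. real (q ij)) + sqrt (queue_gap n q)) / n \<le> m"
    unfolding m_def by (rule max_weight_gap_bound[OF n_pos _ max_weight_maximal(2)[OF n_pos s]]) auto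
  moreover have "total n q / n \<le> (total n q + sqrt (queue_gap n q)) / n"
    by (intro divide_right_mono) (auto simp: cone_gap_nonneg)
  ultimately have "E (\<lambda>a. \<Sum>ij\<in>pairs n. real (q ij) * change q s a ij)
      \<le> lam * total n q - total n q / n"
    by (simp add: total_def)
  also have "\<dots> = - slack * total n q / n"
    using n_pos by (simp add: slack_def field_simps)
  finally show ?thesis .
qed

lemma real_served_fun: "real_arr (served q s a)
    = (\<lambda>ij. real (q ij) + change q s a ij)"
  by (rule ext) (simp add: real_served)

lemma norm_drift:
  "mean (kernel (max_weight n) q) (\<lambda>q. queue_norm n q)
    \<le> queue_norm n q - 2 * slack / n * total n q + 2 * real n" (is "_ \<le> ?b")
proof (rule kernel_le[where pol = "max_weight n", OF finite_max_weight])
  fix s assume s: "s \<in> set_pmf (max_weight n q)"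
  note smax = max_weight_maximal(1)[OF n_pos s]
  let ?\<xi> = "\<lambda>a. \<Sum>ij\<in>pairs n. real (q ij) * change q s a ij"
  have "E (\<lambda>a. queue_norm n (served q s a)) \<le> E (\<lambda>a. queue_norm n q + 2 * ?\<xi> a + (total n a + n))"
    unfolding real_served_fun
    by (intro mean_mono_finite finite_arrivals shifted_norm_sq(1)[OF smax])
  also have "\<dots> = queue_norm n q + 2 * E ?\<xi> + E (\<lambda>a. total n a + n)"
    by (simp del: integral_sum Bochner_Integration.integral_sum)
  also have "\<dots> \<le> queue_norm n q + 2 * (- slack * total n q / n) + 2 * real n"
    by (intro add_mono mult_left_mono queue_inner_drift[OF s] E_total_plus) auto
  finally show "E (\<lambda>a. queue_norm n (served q s a)) \<le> ?b"
    by (simp add: algebra_simps)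
qed

lemma norm_le_total: "sqrt (queue_norm n q) \<le> total n q"
  using L2_set_le_sum[of "pairs n" "real_arr q"] by (simp add: L2_set_def norm_sq_def total_def)

text \<open>The constant blows up as the slack vanishes, but the bound is used only to show that the
  steady state has a finite second moment.\<close>

lemma norm_square_drift:
  "mean (kernel (max_weight n) q) (\<lambda>q. (queue_norm n q)\<^sup>2)
    \<le> (queue_norm n q)\<^sup>2 - 2 * (slack / n) * sqrt (queue_norm n q) ^ 3
      + (250 * (2 * real n) ^ 3 / (slack / n)\<^sup>2 + 2 * (5 * real n ^ 2))" (is "_ \<le> ?b")
proof (rule kernel_le[where pol = "max_weight n", OF finite_max_weight])
  fix s assume s: "s \<in> set_pmf (max_weight n q)"
  note smax = max_weight_maximal(1)[OF n_pos s]
  define Y where "Y = sqrt (queue_norm n q)"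
  have Y2: "Y\<^sup>2 = queue_norm n q" by (simp add: Y_def norm_sq_nonneg)
  let ?\<xi> = "\<lambda>a. \<Sum>ij\<in>pairs n. real (q ij) * change q s a ij"
  have "E (\<lambda>a. (queue_norm n (served q s a))\<^sup>2)
      \<le> (Y\<^sup>2)\<^sup>2 - 2 * (slack / n) * Y ^ 3 + (250 * (2 * real n) ^ 3 / (slack / n)\<^sup>2 + 2 * (5 * real n ^ 2))"
  proof (rule square_drift[where \<xi> = ?\<xi> and G = "\<lambda>a. total n a + n"])
    have "Y * (slack / n) \<le> total n q * (slack / n)"
      unfolding Y_def using slack_pos by (intro mult_right_mono norm_le_total) auto
    then show "E ?\<xi> \<le> - (slack / n) * Y"
      using queue_inner_drift[OF s] by (simp add: algebra_simps)
  next
    fix a assume a: "a \<in> set_pmf arrivals"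
    show "0 \<le> queue_norm n (served q s a) \<and>
        queue_norm n (served q s a) \<le> Y\<^sup>2 + 2 * ?\<xi> a + (total n a + n)"
      using shifted_norm_sq(1)[OF smax a, where x = "real_arr q" and q = q]
      by (simp add: Y2 norm_sq_nonneg real_served_fun del: real_served)
    show "(?\<xi> a)\<^sup>2 \<le> Y\<^sup>2 * (total n a + n)"
      unfolding Y2 by (rule shifted_norm_sq(2)[OF smax a])
  qed (use slack_pos n_pos E_total_plus E_total_plus_sq finite_arrivals in \<open>auto simp: Y_def norm_sq_nonneg\<close>)
  then show "E (\<lambda>a. (queue_norm n (served q s a))\<^sup>2) \<le> ?b"
    unfolding Y2 unfolding Y_def .
qed

text \<open>State space collapse: unlike in \<open>norm_square_drift\<close>, the drift does not degrade with the slack.\<close>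

lemma cone_gap_drift:
  assumes small: "slack \<le> 1 / (2 * n)"
  shows "mean (kernel (max_weight n) q) (\<lambda>q. (queue_gap n q)\<^sup>2)
    \<le> (queue_gap n q)\<^sup>2 - 2 * (1 / (2 * n)) * sqrt (queue_gap n q) ^ 3
      + (250 * (2 * real n) ^ 3 / (1 / (2 * n))\<^sup>2 + 2 * (5 * real n ^ 2))" (is "_ \<le> ?b")
proof (rule kernel_le[where pol = "max_weight n", OF finite_max_weight])
  fix s assume s: "s \<in> set_pmf (max_weight n q)"
  note smax = max_weight_maximal(1)[OF n_pos s]
  obtain w z where min: "cone_minimiser n (real_arr q) w z"
    using cone_minimiser_exists[of n "real_arr q"] by auto
  have w0: "0 \<le> w i" and z0: "0 \<le> z j" for i j using min by (auto simp: cone_minimiser_def)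
  define x where "x = (\<lambda>(i, j). real (q (i, j)) - w i - z j)"
  define W where "W = (\<Sum>i=1..n. w i) + (\<Sum>j=1..n. z j)"
  define X where "X = (\<Sum>ij\<in>pairs n. x ij)"
  define Y where "Y = sqrt (queue_gap n q)"
  define m where "m = (\<Sum>ij\<in>pairs n. real (q ij) * real (s ij))"
  have Y2: "Y\<^sup>2 = queue_gap n q" and Y0: "0 \<le> Y"
    by (simp_all add: Y_def cone_gap_nonneg)
  have gap: "queue_gap n q = norm_sq n x"
    using cone_gap_eq[OF min] by (simp add: x_def)
  have q: "real (q ij) = x ij + (w (fst ij) + z (snd ij))" for ij
    by (cases ij) (simp add: x_def)
  let ?\<xi> = "\<lambda>a. \<Sum>ij\<in>pairs n. x ij * change q s a ij"
  have T: "total n q = X + real n * W"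
    unfolding total_def q X_def sum.distrib
    by (simp add: sum_pairs W_def sum_distrib_left algebra_simps)
  have ws: "(\<Sum>ij\<in>pairs n. (w (fst ij) + z (snd ij)) * real (s ij)) = W"
    using maximalD(3,4)[OF smax]
    by (simp add: distrib_right sum.distrib W_def sum_pairs_row[where f = w and x = "real_arr s"]
        sum_pairs_col[where f = z and x = "real_arr s"])
  have pw: "?\<xi> a \<le> (\<Sum>ij\<in>pairs n. x ij * real (a ij)) - m + W" for a
  proof -
    have "x ij * change q s a ij \<le> x ij * real (a ij) - real (q ij) * real (s ij) + (w (fst ij) + z (snd ij)) * real (s ij)" for ij
    proof -
      have "real (q ij) * real (unused q s a ij) = 0"
        unfolding of_nat_mult[symmetric] unused_01(3)[OF smax] by simp
      then have "x ij * real (unused q s a ij) = - (w (fst ij) + z (snd ij)) * real (unused q s a ij)"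
        unfolding q by (simp add: algebra_simps)
      also have "\<dots> \<le> 0"
        using w0[of "fst ij"] z0[of "snd ij"] by (intro mult_nonpos_nonneg) auto
      finally show ?thesis unfolding q by (simp add: algebra_simps)
    qed
    then have "?\<xi> a \<le> (\<Sum>ij\<in>pairs n. x ij * real (a ij) - real (q ij) * real (s ij) + (w (fst ij) + z (snd ij)) * real (s ij))"
      by (intro sum_mono)
    then show ?thesis by (simp add: sum.distrib sum_subtractf ws m_def)
  qed
  have m: "(total n q + Y) / n \<le> m"
    unfolding m_def Y_def total_def
    by (rule max_weight_gap_bound[OF n_pos _ max_weight_maximal(2)[OF n_pos s]]) auto
  have "X\<^sup>2 \<le> (real n * Y)\<^sup>2"
    unfolding X_def power_mult_distrib Y2 gap by (rule sum_squared_le)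
  then have X: "\<bar>X\<bar> \<le> real n * Y" using Y0 by (simp add: abs_le_square_iff[symmetric])
  have "E ?\<xi> \<le> E (\<lambda>a. (\<Sum>ij\<in>pairs n. x ij * real (a ij)) - m + W)"
    by (intro mean_mono_finite finite_arrivals pw)
  also have "\<dots> = lam * X - m + W"
    by (simp add: E_weighted X_def del: Bochner_Integration.integral_sum)
  also have "\<dots> \<le> lam * X - (total n q + Y) / n + W" using m by simp
  also have "\<dots> = - slack / n * X - Y / n"
    unfolding T slack_def using n_pos by (simp add: field_simps)
  also have "\<dots> \<le> slack / n * (real n * Y) - Y / n"
  proof -
    have "slack / n * (- X) \<le> slack / n * (real n * Y)"
      using X slack_pos by (intro mult_left_mono) auto
    then show ?thesis by simp
  qed
  \<comment> \<open>The MaxWeight gain \<open>Y / n\<close> is at least twice the term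
    \<open>slack * Y\<close>; this is what the assumption \<open>small\<close> is for.\<close>
  also have "\<dots> = slack * Y - Y / n" using n_pos by simp
  also have "\<dots> \<le> 1 / (2 * n) * Y - Y / n"
    using mult_right_mono[OF small Y0] by simp
  also have "\<dots> = - (1 / (2 * n)) * Y" using n_pos by (simp add: field_simps)
  finally have E\<xi>: "E ?\<xi> \<le> - (1 / (2 * n)) * Y" .
  have "E (\<lambda>a. (queue_gap n (served q s a))\<^sup>2)
      \<le> (Y\<^sup>2)\<^sup>2 - 2 * (1 / (2 * n)) * Y ^ 3 + (250 * (2 * real n) ^ 3 / (1 / (2 * n))\<^sup>2 + 2 * (5 * real n ^ 2))"
  proof (rule square_drift[where \<xi> = ?\<xi> and G = "\<lambda>a. total n a + n", OF finite_arrivals Y0 _ _ E\<xi> E_total_plus E_total_plus_sq])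
    fix a assume a: "a \<in> set_pmf arrivals"
    \<comment> \<open>The nearest cone point from before the slot is an admissible candidate after
      it.\<close>
    have "queue_gap n (served q s a) \<le> norm_sq n (\<lambda>(i, j). real (served q s a (i, j)) - w i - z j)"
      using w0 z0 by (rule cone_gap_le)
    also have "(\<lambda>(i, j). real (served q s a (i, j)) - w i - z j) = (\<lambda>ij. x ij + change q s a ij)"
      by (auto simp: fun_eq_iff x_def real_served)
    also have "norm_sq n \<dots> \<le> Y\<^sup>2 + 2 * ?\<xi> a + (total n a + n)"
      unfolding Y2 gap by (rule shifted_norm_sq(1)[OF smax a])
    finally show "0 \<le> queue_gap n (served q s a) \<and>
        queue_gap n (served q s a) \<le> Y\<^sup>2 + 2 * ?\<xi> a + (total n a + n)"
      by (simp add: cone_gap_nonneg)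
    show "(?\<xi> a)\<^sup>2 \<le> Y\<^sup>2 * (total n a + n)"
      unfolding Y2 gap by (rule shifted_norm_sq(2)[OF smax a])
  qed (use n_pos in auto)
  then show "E (\<lambda>a. (queue_gap n (served q s a))\<^sup>2) \<le> ?b"
    unfolding Y2 unfolding Y_def .
qed

end

section \<open>MaxWeight in steady state\<close>

text \<open>A pointwise substitute for Hoelder that is linear in \<open>U\<close>, whose mean is
  known from flow balance. If \<open>Y\<close> exceeds \<open>S * sqrt U\<close>, then
  \<open>Y \<ge> S\<close> as well, because a nonzero integer has \<open>sqrt U \<ge> 1\<close>;
  that gives the cubic term.\<close>

lemma cubic_trade_off:
  fixes Y S :: real and U :: nat
  assumes Y: "0 \<le> Y" and S: "0 < S"
  shows "Y * sqrt U \<le> Y ^ 3 / S\<^sup>2 + S * U"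
proof (cases "U = 0")
  case False
  define t where "t = sqrt U"
  have t2: "t\<^sup>2 = U" and t1: "1 \<le> t" using False by (auto simp: t_def)
  have nn: "0 \<le> Y ^ 3 / S\<^sup>2" "0 \<le> S * t\<^sup>2" using Y S by auto
  have "Y * t \<le> Y ^ 3 / S\<^sup>2 + S * t\<^sup>2"
  proof (cases "Y \<le> S * t")
    case True
    then have "Y * t \<le> S * t * t" using t1 by (intro mult_right_mono) auto
    then show ?thesis using nn(1) by (simp add: power2_eq_square mult.assoc)
  next
    case False
    then have Yt: "S * t \<le> Y" by simp
    have "S * 1 \<le> S * t" using t1 S by (intro mult_left_mono) auto
    then have "S \<le> Y" using Yt by simp
    then have "t * S * S \<le> Y * Y" using Yt Y S by (intro mult_mono) (auto simp: mult.commute)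
    then have "Y * (t * S * S) \<le> Y * (Y * Y)" using Y by (rule mult_left_mono)
    then have "Y * t \<le> Y ^ 3 / S\<^sup>2"
      using S by (simp add: field_simps power2_eq_square power3_eq_cube)
    then show ?thesis using nn(2) by simp
  qed
  then show ?thesis by (simp add: t2 flip: t_def)
qed (use Y S in simp)

lemma finite_total_le: "finite {q \<in> queues n. total n q \<le> m}"
proof (rule finite_subset)
  show "{q \<in> queues n. total n q \<le> m} \<subseteq> PiE_dflt (pairs n) 0 (\<lambda>_. {..nat \<lfloor>m\<rfloor>})"
  proof
    fix q assume q: "q \<in> {q \<in> queues n. total n q \<le> m}"
    have "real (q ij) \<le> m" if "ij \<in> pairs n" for ij
    proof -
      have "real (q ij) \<le> total n q"
        unfolding total_def using that by (intro member_le_sum) auto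
      then show ?thesis using q by simp
    qed
    then have "q ij \<le> nat \<lfloor>m\<rfloor>" if "ij \<in> pairs n" for ij
      using that by (simp add: le_nat_floor)
    then show "q \<in> PiE_dflt (pairs n) 0 (\<lambda>_. {..nat \<lfloor>m\<rfloor>})"
      using q by (auto simp: PiE_dflt_def queues_def)
  qed
  show "finite (PiE_dflt (pairs n) (0 :: nat) (\<lambda>_. {..nat \<lfloor>m\<rfloor>}))"
    by (rule finite_PiE_dflt) auto
qed

lemma total_le_norm_sq: "total n q \<le> queue_norm n q"
proof -
  have "real k \<le> (real k)\<^sup>2" for k :: nat
    by (cases k) (auto simp: power2_eq_square)
  then show ?thesis unfolding total_def norm_sq_def by (intro sum_mono)
qed

lemma total_nonneg: "0 \<le> total n q"
  by (simp add: total_def sum_nonneg)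

context bernoulli_switch
begin

abbreviation mw :: "arr \<Rightarrow> arr pmf" where
  "mw \<equiv> kernel (max_weight n)"

lemma mw_chain: "finite_step_chain mw (queues n)"
  by (rule policy_chain[OF max_weight_policy])

lemma mw_no_arrivals:
  obtains s where "s \<in> set_pmf (max_weight n q)" "(\<lambda>ij. q ij - s ij) \<in> set_pmf (mw q)"
proof -
  obtain s where s: "s \<in> set_pmf (max_weight n q)" using set_pmf_not_empty by fast
  have "(\<lambda>_. 0) \<in> set_pmf arrivals" by (simp add: set_arrivals queues_def)
  then have "served q s (\<lambda>_. 0) \<in> set_pmf (mw q)" using s by (auto simp: kernel_eq)
  then show ?thesis using that s by (simp add: served_def)
qed

lemma mw_zero_loop: "(\<lambda>_. 0) \<in> set_pmf (mw (\<lambda>_. 0))"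
  by (rule mw_no_arrivals[of "\<lambda>_. 0"]) simp

text \<open>With positive probability nothing arrives, and MaxWeight then serves some nonempty
  queue: its weight is at least the average \<open>1 / n\<close> of the positive total.\<close>

lemma mw_down:
  assumes q: "q \<in> queues n" and ne: "q \<noteq> (\<lambda>_. 0)"
  shows "\<exists>q'\<in>set_pmf (mw q). (\<Sum>ij\<in>pairs n. q' ij) < (\<Sum>ij\<in>pairs n. q ij)"
proof -
  obtain s where s: "s \<in> set_pmf (max_weight n q)" "(\<lambda>ij. q ij - s ij) \<in> set_pmf (mw q)"
    by (rule mw_no_arrivals)
  obtain kl where "q kl \<noteq> 0" using ne by blast
  moreover have "q kl = 0" if "kl \<notin> pairs n"
    using q that unfolding queues_def mem_Collect_eq by (elim allE[of _ kl] mp)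
  ultimately have kl: "kl \<in> pairs n" "0 < q kl" by (cases "kl \<in> pairs n"; simp)+
  then have pos: "0 < (\<Sum>ij\<in>pairs n. real (q ij))"
    by (intro sum_pos2[of _ kl]) auto
  have "((\<Sum>ij\<in>pairs n. real (q ij)) + sqrt (queue_gap n q)) / n
      \<le> (\<Sum>ij\<in>pairs n. real (q ij) * real (s ij))"
    by (rule max_weight_gap_bound[OF n_pos _ max_weight_maximal(2)[OF n_pos s(1)]]) auto
  moreover have "0 < ((\<Sum>ij\<in>pairs n. real (q ij)) + sqrt (queue_gap n q)) / n"
    using pos n_pos by (intro divide_pos_pos add_pos_nonneg) (auto simp: cone_gap_nonneg)
  ultimately have "(\<Sum>ij\<in>pairs n. real (q ij) * real (s ij)) \<noteq> 0" by linarith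
  then obtain ij where "ij \<in> pairs n" "real (q ij) * real (s ij) \<noteq> 0" by (rule sum.not_neutral_contains_not_neutral)
  then have "(\<Sum>ij\<in>pairs n. q ij - s ij) < (\<Sum>ij\<in>pairs n. q ij)"
    by (intro sum_strict_mono_ex1) (auto intro!: bexI[of _ ij])
  then show ?thesis using s(2) by auto
qed

lemma max_weight_recurrent:
  "\<exists>\<pi>. stationary mw \<pi> \<and> set_pmf \<pi> \<subseteq> queues n \<and>
     (\<forall>x\<in>reachable mw (\<lambda>_. 0). positive_recurrent mw x) \<and>
     (\<forall>\<mu>. set_pmf \<mu> \<subseteq> queues n \<longrightarrow> converges_in_distribution (chain_law mw \<mu>) \<pi>)"
proof -
  interpret finite_step_chain mw "queues n" by (rule mw_chain)
  define f where "f = (\<lambda>q. queue_norm n q)"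
  define g where "g = (\<lambda>q. 2 * slack / n * total n q)"
  have f: "0 \<le> f q" and g: "0 \<le> g q" for q
    using slack_pos by (auto simp: f_def g_def norm_sq_nonneg total_nonneg)
  have drift: "step f q \<le> f q - g q + 2 * real n" for q
    using norm_drift[of q] by (simp add: f_def g_def)
  have finf: "finite {q \<in> queues n. f q \<le> m}" for m
    by (rule finite_subset[OF _ finite_total_le[of n m]])
       (auto simp: f_def intro: order_trans[OF total_le_norm_sq])
  have fing: "finite {q \<in> queues n. g q \<le> m}" for m
    by (rule finite_subset[OF _ finite_total_le[of n "m * n / (2 * slack)"]])
       (use slack_pos n_pos in \<open>auto simp: g_def field_simps\<close>)
  have zero: "(\<lambda>_. 0) \<in> queues n" by (simp add: queues_def)
  obtain \<pi> where \<pi>: "stationary mw \<pi>" "set_pmf \<pi> \<subseteq> queues n"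
    using exists_stationary[OF zero f g drift fing] by blast
  have "reachable mw (\<lambda>_. 0) \<subseteq> set_pmf \<pi>"
    by (rule stationary_support[where \<rho> = "\<lambda>q. \<Sum>ij\<in>pairs n. q ij", OF mw_down \<pi>])
  then have "positive_recurrent mw x" if "x \<in> reachable mw (\<lambda>_. 0)" for x
    using that stationary_imp_positive_recurrent[OF \<pi>(1)] by blast
  moreover have "converges_in_distribution (chain_law mw \<mu>) \<pi>" if "set_pmf \<mu> \<subseteq> queues n" for \<mu>
    by (rule converges_to_stationary[where \<rho> = "\<lambda>q. \<Sum>ij\<in>pairs n. q ij",
          OF f g drift finf fing mw_zero_loop mw_down \<pi> that])
  ultimately show ?thesis using \<pi> by blast
qed

text \<open>The fourth-power drift gives a third moment of the norm, hence the second moment, which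
  dominates both the total and the projected form. Only then may the drift of the form be set to
  zero in steady state.\<close>

lemma stationary_integrable:
  assumes st: "stationary mw \<pi>" and sub: "set_pmf \<pi> \<subseteq> queues n"
  shows "integrable (measure_pmf \<pi>) (\<lambda>q. queue_norm n q)"
    and "integrable (measure_pmf \<pi>) (total n)"
    and "integrable (measure_pmf \<pi>) (\<lambda>q. proj_form n (real_arr q) (real_arr q))"
proof -
  interpret finite_step_chain mw "queues n" by (rule mw_chain)
  define b where "b = 250 * (2 * real n) ^ 3 / (slack / n)\<^sup>2 + 2 * (5 * real n ^ 2)"
  have b: "0 \<le> b" by (simp add: b_def)
  have *: "integrable (measure_pmf \<pi>) (\<lambda>q. 2 * (slack / n) * sqrt (queue_norm n q) ^ 3)"
    by (rule stationary_drift_bound(1)[OF st sub _ _ b norm_square_drift[folded b_def]])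
       (use slack_pos in \<open>auto simp: norm_sq_nonneg\<close>)
  have i3: "integrable (measure_pmf \<pi>) (\<lambda>q. 1 + sqrt (queue_norm n q) ^ 3)"
  proof -
    have "integrable (measure_pmf \<pi>)
        (\<lambda>q. n / (2 * slack) * (2 * (slack / n) * sqrt (queue_norm n q) ^ 3))"
      using * by (rule integrable_mult_right)
    then show ?thesis using slack_pos n_pos by simp
  qed
  have le: "queue_norm n q \<le> 1 + sqrt (queue_norm n q) ^ 3" for q
  proof -
    define y where "y = sqrt (queue_norm n q)"
    have y: "0 \<le> y" "queue_norm n q = y\<^sup>2" by (simp_all add: y_def norm_sq_nonneg)
    have "y\<^sup>2 \<le> 1 + y ^ 3"
    proof (cases "y \<le> 1")
      case True
      then have "y\<^sup>2 \<le> 1" using y by (intro power_le_one) auto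
      then show ?thesis using zero_le_power[OF y(1), of 3] by linarith
    next
      case False
      then have "y\<^sup>2 \<le> y ^ 3" by (intro power_increasing) auto
      then show ?thesis by simp
    qed
    then show ?thesis unfolding y(2) using y(1) by simp
  qed
  show i2: "integrable (measure_pmf \<pi>) (\<lambda>q. queue_norm n q)"
    by (rule Bochner_Integration.integrable_bound[OF i3])
       (use le norm_sq_nonneg in \<open>auto intro!: AE_I2 simp: abs_of_nonneg add_nonneg_nonneg\<close>)
  show "integrable (measure_pmf \<pi>) (total n)"
    by (rule Bochner_Integration.integrable_bound[OF i2])
       (auto intro!: AE_I2 simp: total_nonneg norm_sq_nonneg total_le_norm_sq)
  have "integrable (measure_pmf \<pi>) (\<lambda>q. 2 * real n * queue_norm n q)"
    using i2 by simp
  then show "integrable (measure_pmf \<pi>) (\<lambda>q. proj_form n (real_arr q) (real_arr q))"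
    by (rule Bochner_Integration.integrable_bound)
       (auto intro!: AE_I2 simp: abs_of_nonneg proj_form_nonneg[OF n_pos] norm_sq_nonneg proj_form_le)
qed

lemma stationary_cone_gap:
  assumes st: "stationary mw \<pi>" and sub: "set_pmf \<pi> \<subseteq> queues n" and small: "slack \<le> 1 / (2 * n)"
  shows "integrable (measure_pmf \<pi>) (\<lambda>q. sqrt (queue_gap n q) ^ 3)"
    and "mean \<pi> (\<lambda>q. sqrt (queue_gap n q) ^ 3) \<le> 8010 * real n ^ 6"
proof -
  interpret finite_step_chain mw "queues n" by (rule mw_chain)
  define b where "b = 250 * (2 * real n) ^ 3 / (1 / (2 * n))\<^sup>2 + 2 * (5 * real n ^ 2)"
  have b: "0 \<le> b" by (simp add: b_def)
  have i: "integrable (measure_pmf \<pi>) (\<lambda>q. 2 * (1 / (2 * n)) * sqrt (queue_gap n q) ^ 3)"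
    by (rule stationary_drift_bound(1)[OF st sub _ _ b cone_gap_drift[OF small, folded b_def]])
       (simp_all add: cone_gap_nonneg)
  have e: "mean \<pi> (\<lambda>q. 2 * (1 / (2 * n)) * sqrt (queue_gap n q) ^ 3) \<le> b"
    by (rule stationary_drift_bound(2)[OF st sub _ _ b cone_gap_drift[OF small, folded b_def]])
       (simp_all add: cone_gap_nonneg)
  show "integrable (measure_pmf \<pi>) (\<lambda>q. sqrt (queue_gap n q) ^ 3)"
    using integrable_mult_right[OF i, of "real n"] n_pos by simp
  have "mean \<pi> (\<lambda>q. sqrt (queue_gap n q) ^ 3) \<le> real n * b"
  proof -
    have "mean \<pi> (\<lambda>q. sqrt (queue_gap n q) ^ 3) / n \<le> b"
    proof -
      have "mean \<pi> (\<lambda>q. sqrt (queue_gap n q) ^ 3) / n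
          = mean \<pi> (\<lambda>q. 2 * (1 / (2 * n)) * sqrt (queue_gap n q) ^ 3)"
        by simp
      also have "\<dots> \<le> b" by (rule e)
      finally show ?thesis .
    qed
    then show ?thesis using n_pos by (simp add: divide_le_eq mult.commute)
  qed
  \<comment> \<open>The leading term is \<open>250 * (2 * n)^3 * (2 * n)^2\<close>; the drift rate
    \<open>1 / n\<close> supplies one more factor \<open>n\<close>.\<close>
  also have "b = 8000 * real n ^ 5 + 10 * real n ^ 2"
    by (simp add: b_def power2_eq_square eval_nat_numeral)
  also have "real n * (8000 * real n ^ 5 + 10 * real n ^ 2) \<le> real n * (8000 * real n ^ 5 + 10 * real n ^ 5)"
    using n_pos by (intro mult_left_mono add_mono power_increasing) auto
  also have "\<dots> = 8010 * real n ^ 6" by (simp add: eval_nat_numeral)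
  finally show "mean \<pi> (\<lambda>q. sqrt (queue_gap n q) ^ 3) \<le> 8010 * real n ^ 6" .
qed

text \<open>The mean of \<open>proj_form n d d\<close> for \<open>d\<close> the arrivals minus a
  maximal schedule, the same for every such schedule. At full load it would be 2n - 3 + 1/n.\<close>

definition noise :: real where
  "noise = real n - real n * lam + (real n * lam)\<^sup>2 * (real n - 2 + 1 / real n)"

lemma noise_approx: "\<bar>noise - 2 * real n\<bar> \<le> 3 + 2 * real n * slack"
proof -
  define r where "r = real n * lam"
  have r: "0 \<le> r" "r \<le> 1" "slack = 1 - r"
    using load_lt_1 lam_pos by (auto simp: r_def slack_def)
  have n1: "1 \<le> real n" using n_pos by simp
  have eq: "noise - 2 * real n = - r + r\<^sup>2 / n - 2 * r\<^sup>2 - real n * (1 - r) * (1 + r)"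
    by (simp add: noise_def r_def power2_eq_square algebra_simps)
  have r2: "0 \<le> r\<^sup>2" "r\<^sup>2 \<le> 1" using r by (auto intro: power_le_one)
  have d: "0 \<le> r\<^sup>2 / n" "r\<^sup>2 / n \<le> r\<^sup>2" using r2 n1 mult_left_mono[OF n1 r2(1)] by (auto simp: divide_simps)
  have "real n * (1 - r) * (1 + r) \<le> real n * (1 - r) * 2"
    using r n1 by (intro mult_left_mono) auto
  moreover have "0 \<le> real n * (1 - r) * (1 + r)" using r by simp
  ultimately show ?thesis unfolding eq r(3) abs_le_iff using r(1,2) r2 d by (intro conjI; linarith)
qed

text \<open>A maximal schedule has all line sums 1, so it projects to the constant array 1/n and its
  pairing with any \<open>x\<close> is the total of \<open>x\<close>. The choice of the schedule
  therefore drops out of the drift.\<close>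

lemma E_proj_form_slot:
  assumes s: "s \<in> maximal n"
  defines "d \<equiv> \<lambda>a ij. real (a ij) - real (s ij)"
  shows "E (\<lambda>a. proj_form n (d a) (d a)) = noise"
    and "E (\<lambda>a. proj_form n (real_arr q) (d a)) = - slack * total n q"
proof -
  have fs: "proj_form n x (real_arr s) = (\<Sum>ij\<in>pairs n. x ij)" for x
  proof -
    have "proj_form n x (real_arr s) = (\<Sum>i=1..n. row_sum n x i) + (\<Sum>j=1..n. col_sum n x j)
        - (\<Sum>ij\<in>pairs n. x ij) * real n / n"
      using maximalD(3,4,5)[OF s] by (simp add: proj_form_def total_def)
    then show ?thesis using n_pos by (simp only: sum_row_sum sum_col_sum) simp
  qed
  have fa: "E (\<lambda>a. proj_form n x (real_arr a)) = lam * real n * (\<Sum>ij\<in>pairs n. x ij)" for x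
  proof -
    have "E (\<lambda>a. proj_form n x (real_arr a)) = lam * (\<Sum>ij\<in>pairs n. (row_sum n x (fst ij)
        + col_sum n x (snd ij) - (\<Sum>ij\<in>pairs n. x ij) / n) * 1)"
      unfolding proj_form_eq_sum E_weighted by simp
    also have "\<dots> = lam * proj_form n x (\<lambda>_. 1)"
      unfolding proj_form_eq_sum ..
    also have "proj_form n x (\<lambda>_. 1) = real n * (\<Sum>ij\<in>pairs n. x ij)"
    proof -
      have "proj_form n x (\<lambda>_. 1) = real n * (\<Sum>i=1..n. row_sum n x i) + real n * (\<Sum>j=1..n. col_sum n x j)
          - (\<Sum>ij\<in>pairs n. x ij) * (real n * real n) / n"
        by (simp add: proj_form_def row_sum_def[of n "\<lambda>_. 1"] col_sum_def[of n "\<lambda>_. 1"] sum_distrib_left mult.commute)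
      then show ?thesis using n_pos by (simp only: sum_row_sum sum_col_sum) simp
    qed
    finally show ?thesis by simp
  qed
  have "E (\<lambda>a. proj_form n (real_arr q) (d a)) = E (\<lambda>a. proj_form n (real_arr q) (real_arr a)) - total n q"
    unfolding d_def proj_form_diff fs by (simp add: total_def)
  then show "E (\<lambda>a. proj_form n (real_arr q) (d a)) = - slack * total n q"
    unfolding fa by (simp add: total_def slack_def algebra_simps)
  have sq: "proj_form n (d a) (d a) = proj_form n (real_arr a) (real_arr a) - 2 * total n a + real n" for a
  proof -
    have "proj_form n (d a) (d a) = proj_form n (d a) (real_arr a) - proj_form n (d a) (real_arr s)"
      unfolding d_def by (rule proj_form_diff)
    also have "proj_form n (d a) (real_arr a) = proj_form n (real_arr a) (real_arr a) - proj_form n (real_arr a) (real_arr s)"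
      unfolding proj_form_sym[of n "d a"] unfolding d_def by (rule proj_form_diff)
    also have "proj_form n (d a) (real_arr s) = total n a - real n"
      unfolding fs using maximalD(5)[OF s] by (simp add: d_def sum_subtractf total_def)
    also have "proj_form n (real_arr a) (real_arr s) = total n a"
      unfolding fs by (simp add: total_def)
    finally show ?thesis by simp
  qed
  have sqa: "proj_form n (real_arr a) (real_arr a)
      = (\<Sum>i=1..n. (row_sum n (real_arr a) i)\<^sup>2) + (\<Sum>j=1..n. (col_sum n (real_arr a) j)\<^sup>2) - (total n a)\<^sup>2 / n" for a
    by (simp add: proj_form_def power2_eq_square total_def)
  have "E (\<lambda>a. proj_form n (d a) (d a))
      = (\<Sum>i=1..n. E (\<lambda>a. (row_sum n (real_arr a) i)\<^sup>2)) + (\<Sum>j=1..n. E (\<lambda>a. (col_sum n (real_arr a) j)\<^sup>2))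
        - E (\<lambda>a. (total n a)\<^sup>2) / n - 2 * E (total n) + real n"
    unfolding sq sqa by simp
  also have "\<dots> = 2 * (real n * (real n * lam + real n * (real n - 1) * lam\<^sup>2))
      - (real n ^ 2 * lam + real n ^ 2 * (real n ^ 2 - 1) * lam\<^sup>2) / n - 2 * (real n ^ 2 * lam) + real n"
  proof -
    have "(\<Sum>i=1..n. E (\<lambda>a. (row_sum n (real_arr a) i)\<^sup>2)) = (\<Sum>i=1..n. real n * lam + real n * (real n - 1) * lam\<^sup>2)"
      by (intro sum.cong refl E_row_sq)
    moreover have "(\<Sum>j=1..n. E (\<lambda>a. (col_sum n (real_arr a) j)\<^sup>2)) = (\<Sum>j=1..n. real n * lam + real n * (real n - 1) * lam\<^sup>2)"
      by (intro sum.cong refl E_col_sq)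
    ultimately show ?thesis by (simp add: E_total_sq E_total)
  qed
  also have "\<dots> = noise"
    using n_pos by (simp add: noise_def field_simps power2_eq_square)
  finally show "E (\<lambda>a. proj_form n (d a) (d a)) = noise" .
qed

lemma proj_form_slot_bounds:
  fixes q :: arr
  assumes s: "s \<in> maximal n" and S: "0 < S"
  defines "d \<equiv> \<lambda>a ij. real (a ij) - real (s ij)"
    and "\<Phi> \<equiv> \<lambda>q :: arr. proj_form n (real_arr q) (real_arr q)"
    and "Y3 \<equiv> \<lambda>q :: arr. sqrt (queue_gap n q) ^ 3"
    and "base \<equiv> \<lambda>a. proj_form n (real_arr q) (real_arr q) + 2 * proj_form n (real_arr q) (\<lambda>ij. real (a ij) - real (s ij))
      + proj_form n (\<lambda>ij. real (a ij) - real (s ij)) (\<lambda>ij. real (a ij) - real (s ij))"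
  shows "\<bar>\<Phi> (served q s a) - base a\<bar>
    \<le> 8 * real n / S\<^sup>2 * Y3 (served q s a) + (8 * real n * S + 2) * total n (unused q s a)"
proof -
  define q' where "q' = served q s a"
  define u where "u = real_arr (unused q s a)"
  define y where "y = (\<lambda>ij. real (q ij) + (real (a ij) - real (s ij)))"
  have q': "real_arr q' = (\<lambda>ij. y ij + u ij)"
    by (rule ext) (simp add: q'_def y_def u_def real_served)
  have base: "proj_form n y y = base a"
    unfolding y_def base_def by (rule proj_form_square_update)
  have "\<Phi> q' = proj_form n y y + 2 * proj_form n y u + proj_form n u u"
    unfolding \<Phi>_def q' by (rule proj_form_square_update)
  moreover have "proj_form n (real_arr q') u = proj_form n y u + proj_form n u u"
  proof -
    have "proj_form n (real_arr q') u = proj_form n u (real_arr q')" by (rule proj_form_sym)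
    also have "\<dots> = proj_form n u y + proj_form n u u" unfolding q' by (rule proj_form_add)
    also have "proj_form n u y = proj_form n y u" by (rule proj_form_sym)
    finally show ?thesis .
  qed
  ultimately have eq: "\<Phi> q' - base a = 2 * proj_form n (real_arr q') u - proj_form n u u"
    by (simp add: base)
  have u01: "u ij = 0 \<or> u ij = 1" for ij
    using unused_01(1)[OF s, of q a ij] by (auto simp: u_def)
  have u0: "0 \<le> u ij" and us: "u ij \<le> real (s ij)" for ij
    using unused_01(2)[OF s, of q a ij] by (auto simp: u_def)
  have qu: "real (q' ij) * u ij = 0" for ij
    unfolding q'_def u_def of_nat_mult[symmetric] served_unused by simp
  define U where "U = (\<Sum>ij\<in>pairs n. unused q s a ij)"
  have U: "(\<Sum>ij\<in>pairs n. u ij) = real U" "total n (unused q s a) = real U"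
    by (simp_all add: U_def u_def total_def)
  have Y0: "0 \<le> sqrt (queue_gap n q')" by (simp add: cone_gap_nonneg)
  have "\<bar>proj_form n (real_arr q') u\<bar> \<le> 4 * real n * (sqrt (queue_gap n q') * sqrt (\<Sum>ij\<in>pairs n. u ij))"
    by (rule proj_form_unused_bound[OF n_pos]) (use u01 qu in auto)
  also have "\<dots> \<le> 4 * real n * (Y3 q' / S\<^sup>2 + S * U)"
    unfolding U Y3_def by (intro mult_left_mono cubic_trade_off Y0 S) auto
  finally have 1: "\<bar>proj_form n (real_arr q') u\<bar> \<le> 4 * real n * (Y3 q' / S\<^sup>2 + S * U)" .
  \<comment> \<open>The line sums of \<open>u\<close> lie between 0 and the line sums 1 of the
    schedule, so squaring does not increase them.\<close>
  have sq: "x\<^sup>2 \<le> x" if "0 \<le> x" "x \<le> y" "y = 1" for x y :: real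
    using that by (simp add: power2_eq_square mult_left_le)
  have "(\<Sum>i=1..n. (row_sum n u i)\<^sup>2) \<le> (\<Sum>i=1..n. row_sum n u i)"
    by (intro sum_mono sq[OF _ _ maximalD(3)[OF s]]) (auto simp: row_sum_def intro!: sum_nonneg sum_mono u0 us)
  then have r: "(\<Sum>i=1..n. (row_sum n u i)\<^sup>2) \<le> real U" unfolding sum_row_sum U .
  have "(\<Sum>j=1..n. (col_sum n u j)\<^sup>2) \<le> (\<Sum>j=1..n. col_sum n u j)"
    by (intro sum_mono sq[OF _ _ maximalD(4)[OF s]]) (auto simp: col_sum_def intro!: sum_nonneg sum_mono u0 us)
  then have c: "(\<Sum>j=1..n. (col_sum n u j)\<^sup>2) \<le> real U" unfolding sum_col_sum U .
  have "0 \<le> real U * real U / real n" by simp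
  then have 2: "proj_form n u u \<le> 2 * real U"
    using r c unfolding proj_form_def U power2_eq_square by linarith
  have 3: "0 \<le> proj_form n u u" by (rule proj_form_nonneg[OF n_pos])
  have "\<bar>\<Phi> q' - base a\<bar> \<le> 2 * (4 * real n * (Y3 q' / S\<^sup>2 + S * U)) + 2 * real U"
    unfolding eq using 1 2 3 by linarith
  also have "\<dots> = 8 * real n / S\<^sup>2 * Y3 q' + (8 * real n * S + 2) * real U"
    by (simp add: algebra_simps)
  finally show ?thesis unfolding q'_def U(2) .
qed

lemma proj_form_drift:
  fixes q :: arr and \<sigma> :: real
  assumes S: "0 < S" and \<sigma>: "\<bar>\<sigma>\<bar> = 1"
  shows "mean (mw q) (\<lambda>q. \<sigma> * proj_form n (real_arr q) (real_arr q)
      - 8 * real n / S\<^sup>2 * sqrt (queue_gap n q) ^ 3 - (8 * real n * S + 2) * total n q)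
    \<le> \<sigma> * (proj_form n (real_arr q) (real_arr q) - 2 * slack * total n q + noise)
      - (8 * real n * S + 2) * (total n q - real n * slack)" (is "_ \<le> ?b")
proof (rule kernel_le[where pol = "max_weight n", OF finite_max_weight])
  fix s assume "s \<in> set_pmf (max_weight n q)"
  then have s: "s \<in> maximal n" by (rule max_weight_maximal(1)[OF n_pos])
  define \<Phi> where "\<Phi> = (\<lambda>q :: arr. proj_form n (real_arr q) (real_arr q))"
  define \<alpha> where "\<alpha> = 8 * real n / S\<^sup>2"
  define \<beta> where "\<beta> = 8 * real n * S + 2"
  define Y3 where "Y3 = (\<lambda>q :: arr. sqrt (queue_gap n q) ^ 3)"
  define d where "d = (\<lambda>(a :: arr) ij. real (a ij) - real (s ij))"
  have pw: "\<sigma> * \<Phi> (served q s a) - \<alpha> * Y3 (served q s a) - \<beta> * total n (served q s a)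
      \<le> \<sigma> * (\<Phi> q + 2 * proj_form n (real_arr q) (d a) + proj_form n (d a) (d a))
        - \<beta> * (total n q + total n a - real n)" for a
  proof -
    have b: "\<bar>\<Phi> (served q s a) - (\<Phi> q + 2 * proj_form n (real_arr q) (d a) + proj_form n (d a) (d a))\<bar>
        \<le> \<alpha> * Y3 (served q s a) + \<beta> * total n (unused q s a)"
      using proj_form_slot_bounds[OF s S, of q a] by (simp add: \<Phi>_def d_def \<alpha>_def \<beta>_def Y3_def)
    have "\<sigma> * (\<Phi> (served q s a) - (\<Phi> q + 2 * proj_form n (real_arr q) (d a) + proj_form n (d a) (d a)))
        \<le> \<alpha> * Y3 (served q s a) + \<beta> * total n (unused q s a)"
    proof -
      have "\<sigma> = 1 \<or> \<sigma> = -1" using \<sigma> by linarith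
      then show ?thesis using b by (elim disjE) auto
    qed
    moreover have "total n (unused q s a) = total n (served q s a) - (total n q + total n a - real n)"
      using maximalD(5)[OF s] by (simp add: total_served)
    ultimately show ?thesis by (simp add: algebra_simps)
  qed
  have "E (\<lambda>a. \<sigma> * \<Phi> (served q s a) - \<alpha> * Y3 (served q s a) - \<beta> * total n (served q s a))
      \<le> E (\<lambda>a. \<sigma> * (\<Phi> q + 2 * proj_form n (real_arr q) (d a) + proj_form n (d a) (d a))
        - \<beta> * (total n q + total n a - real n))"
    by (intro mean_mono_finite finite_arrivals pw)
  also have "\<dots> = \<sigma> * (\<Phi> q + 2 * E (\<lambda>a. proj_form n (real_arr q) (d a)) + E (\<lambda>a. proj_form n (d a) (d a)))
      - \<beta> * (total n q + E (total n) - real n)"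
    by simp
  also have "\<dots> = \<sigma> * (\<Phi> q - 2 * slack * total n q + noise) - \<beta> * (total n q - real n * slack)"
  proof -
    have E1: "E (\<lambda>a. proj_form n (d a) (d a)) = noise"
      and E2: "E (\<lambda>a. proj_form n (real_arr q) (d a)) = - slack * total n q"
      unfolding d_def by (rule E_proj_form_slot[OF s])+
    have "E (total n) - real n = - (real n * slack)"
      by (simp add: E_total slack_def power2_eq_square algebra_simps)
    then have "total n q + E (total n) - real n = total n q - real n * slack" by linarith
    then show ?thesis unfolding E1 E2 by (simp only:) (simp add: algebra_simps)
  qed
  finally show "E (\<lambda>a. \<sigma> * proj_form n (real_arr (served q s a)) (real_arr (served q s a))
      - 8 * real n / S\<^sup>2 * sqrt (queue_gap n (served q s a)) ^ 3
      - (8 * real n * S + 2) * total n (served q s a)) \<le> ?b"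
    by (simp add: \<Phi>_def \<alpha>_def \<beta>_def Y3_def)
qed

text \<open>In steady state the means of \<open>\<Phi>\<close>, \<open>Y3\<close> and
  \<open>total n\<close> are unchanged by a step, so the drift inequality compares
  \<open>2 * slack\<close> times the mean total with \<open>noise\<close>, once for each sign.
  \<open>S\<close> stays free until its growth in \<open>n\<close> can be chosen; 64080 is 8 times
  8010.\<close>

lemma heavy_traffic_bound:
  assumes st: "stationary mw \<pi>" and sub: "set_pmf \<pi> \<subseteq> queues n" and small: "slack \<le> 1 / (2 * n)"
    and S: "0 < S"
  shows "\<bar>2 * slack * mean \<pi> (total n) - 2 * real n\<bar>
    \<le> 3 + 2 * real n * slack + 64080 * real n ^ 7 / S\<^sup>2 + (8 * real n * S + 2) * (real n * slack)"
proof -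
  interpret finite_step_chain mw "queues n" by (rule mw_chain)
  define \<Phi> where "\<Phi> = (\<lambda>q :: arr. proj_form n (real_arr q) (real_arr q))"
  define \<alpha> where "\<alpha> = 8 * real n / S\<^sup>2"
  define \<beta> where "\<beta> = 8 * real n * S + 2"
  define Y3 where "Y3 = (\<lambda>q :: arr. sqrt (queue_gap n q) ^ 3)"
  let ?E = "mean \<pi>"
  have i\<Phi>: "integrable (measure_pmf \<pi>) \<Phi>" and iT: "integrable (measure_pmf \<pi>) (total n)"
    and iY: "integrable (measure_pmf \<pi>) Y3"
    using stationary_integrable[OF st sub] stationary_cone_gap(1)[OF st sub small]
    by (simp_all add: \<Phi>_def Y3_def)
  have s\<Phi>: "integrable (measure_pmf \<pi>) (step \<Phi>)" "?E (step \<Phi>) = ?E \<Phi>"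
    using stationary_step_nonneg[OF st sub _ i\<Phi>] by (simp_all add: \<Phi>_def proj_form_nonneg[OF n_pos])
  have sT: "integrable (measure_pmf \<pi>) (step (total n))" "?E (step (total n)) = ?E (total n)"
    using stationary_step_nonneg[OF st sub _ iT] by (simp_all add: total_nonneg)
  have sY: "integrable (measure_pmf \<pi>) (step Y3)" "?E (step Y3) = ?E Y3"
    using stationary_step_nonneg[OF st sub _ iY] by (simp_all add: Y3_def cone_gap_nonneg)
  have one: "\<sigma> * (2 * slack * ?E (total n) - noise) \<le> \<alpha> * ?E Y3 + \<beta> * (real n * slack)"
    if \<sigma>: "\<bar>\<sigma>\<bar> = 1" for \<sigma> :: real
  proof -
    have "?E (\<lambda>q. \<sigma> * step \<Phi> q - \<alpha> * step Y3 q - \<beta> * step (total n) q)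
        \<le> ?E (\<lambda>q. \<sigma> * (\<Phi> q - 2 * slack * total n q + noise) - \<beta> * (total n q - real n * slack))"
    proof (intro integral_mono_AE AE_pmfI)
      fix q assume "q \<in> set_pmf \<pi>"
      then have q: "q \<in> queues n" using sub by auto
      have "\<sigma> * step \<Phi> q - \<alpha> * step Y3 q - \<beta> * step (total n) q
          = step (\<lambda>q. \<sigma> * \<Phi> q - \<alpha> * Y3 q - \<beta> * total n q) q"
        by (simp add: integrable_step[OF q])
      also have "\<dots> \<le> \<sigma> * (\<Phi> q - 2 * slack * total n q + noise) - \<beta> * (total n q - real n * slack)"
        unfolding \<Phi>_def Y3_def \<alpha>_def \<beta>_def by (rule proj_form_drift[OF S \<sigma>])
      finally show "\<sigma> * step \<Phi> q - \<alpha> * step Y3 q - \<beta> * step (total n) q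
          \<le> \<sigma> * (\<Phi> q - 2 * slack * total n q + noise) - \<beta> * (total n q - real n * slack)" .
    qed (intro Bochner_Integration.integrable_add Bochner_Integration.integrable_diff
          integrable_mult_right i\<Phi> iT s\<Phi> sT sY integrable_const; simp)+
    then show ?thesis
      by (simp add: i\<Phi> iT s\<Phi> sT sY algebra_simps)
  qed
  have "\<bar>2 * slack * ?E (total n) - noise\<bar> \<le> \<alpha> * ?E Y3 + \<beta> * (real n * slack)"
    using one[of 1] one[of "-1"] by simp
  also have "\<alpha> * ?E Y3 \<le> \<alpha> * (8010 * real n ^ 6)"
    using stationary_cone_gap(2)[OF st sub small] unfolding Y3_def
    by (intro mult_left_mono) (auto simp: \<alpha>_def)
  also have "\<alpha> * (8010 * real n ^ 6) = 64080 * real n ^ 7 / S\<^sup>2"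
    by (simp add: \<alpha>_def eval_nat_numeral)
  finally show ?thesis
    using noise_approx unfolding \<beta>_def by (simp add: abs_le_iff)
qed

end

section \<open>The lower bound for arbitrary policies\<close>

text \<open>A convex function of linear growth that agrees with the square up to \<open>M\<close>; it stands in for
  the square because only the first moment of a stationary law can be assumed finite.\<close>

definition huber :: "real \<Rightarrow> real \<Rightarrow> real" where
  "huber M w = (if w \<le> M then w\<^sup>2 else 2 * M * w - M\<^sup>2)"

lemma huber_nonneg: "0 \<le> M \<Longrightarrow> 0 \<le> huber M w"
proof -
  assume M: "0 \<le> M"
  have "M * M \<le> M * (2 * w)" if "M < w" using that M by (intro mult_left_mono) auto
  then show ?thesis by (auto simp: huber_def power2_eq_square algebra_simps)
qed

lemma huber_le: "0 \<le> M \<Longrightarrow> 0 \<le> w \<Longrightarrow> huber M w \<le> 2 * M * w"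
proof -
  assume M: "0 \<le> M" and w: "0 \<le> w"
  have "w * w \<le> (2 * M) * w" if "w \<le> M" using that w by (intro mult_right_mono) auto
  then show ?thesis by (auto simp: huber_def power2_eq_square)
qed

text \<open>Convexity, with the quadratic remainder retained when both points are in the range where
  the function is the square; the lower bound on the queue lengths comes from this
  remainder.\<close>

lemma huber_tangent:
  "huber M w + 2 * min w M * d + (if w \<le> M \<and> w + d \<le> M then d\<^sup>2 else 0) \<le> huber M (w + d)"
proof -
  consider "w \<le> M" "w + d \<le> M" | "w \<le> M" "M < w + d" | "M < w" "w + d \<le> M" | "M < w" "M < w + d"
    by linarith
  then show ?thesis
  proof cases
    case 1
    then show ?thesis by (simp add: huber_def power2_eq_square algebra_simps)
  next
    case 2
    have "0 \<le> (M - w) * (w + 2 * d - M)" using 2 by (intro mult_nonneg_nonneg) auto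
    then show ?thesis using 2 by (simp add: huber_def power2_eq_square algebra_simps)
  next
    case 3
    have "0 \<le> (w + d - M)\<^sup>2" by simp
    then show ?thesis using 3 by (simp add: huber_def power2_eq_square algebra_simps)
  next
    case 4
    then show ?thesis by (simp add: huber_def power2_eq_square algebra_simps)
  qed
qed

lemma huber_mono:
  assumes "0 \<le> M" "0 \<le> v" "v \<le> w"
  shows "huber M v \<le> huber M w"
proof -
  have "0 \<le> 2 * min v M * (w - v)" using assms by (intro mult_nonneg_nonneg) auto
  moreover have "0 \<le> (if v \<le> M \<and> v + (w - v) \<le> M then (w - v)\<^sup>2 else 0)" by simp
  ultimately have "huber M v \<le> huber M (v + (w - v))"
    using huber_tangent[of M v "w - v"] by linarith
  then show ?thesis by simp
qed

section \<open>Laws obtained as limits in distribution\<close>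

lemma converges_expectation:
  fixes h :: "'s \<Rightarrow> real"
  assumes conv: "converges_in_distribution X \<pi>" and h: "\<And>x. \<bar>h x\<bar> \<le> c"
  shows "(\<lambda>t. mean (X t) h) \<longlonglongrightarrow> mean \<pi> h"
proof -
  have "bounded (range h)" unfolding bounded_iff using h by (intro exI[of _ c]) auto
  then show ?thesis using conv unfolding converges_in_distribution_def by blast
qed

text \<open>On a discrete space a kernel maps bounded functions to bounded, hence admissible, test
  functions, so the limit may be taken on both sides of one step.\<close>

lemma converges_imp_stationary:
  fixes K :: "'s \<Rightarrow> 's pmf"
  assumes "converges_in_distribution (chain_law K \<mu>) \<pi>"
  shows "stationary K \<pi>"
  unfolding stationary_def
proof (rule pmf_eqI)
  fix y :: 's
  let ?f = "indicator {y} :: 's \<Rightarrow> real"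
  have f: "\<bar>?f x\<bar> \<le> 1" for x by (simp add: indicator_def)
  note lim = converges_expectation[OF assms, where c = 1]
  have "(\<lambda>t. mean (chain_law K \<mu> (Suc t)) ?f) \<longlonglongrightarrow> mean \<pi> ?f"
    by (rule LIMSEQ_Suc[OF lim[OF f]])
  moreover have "(\<lambda>t. mean (chain_law K \<mu> (Suc t)) ?f)
      \<longlonglongrightarrow> mean \<pi> (\<lambda>x. mean (K x) ?f)"
    unfolding chain_law.simps mean_bind_bounded[of ?f 1, OF f]
    by (rule lim) (rule abs_mean_le[OF f])
  ultimately have "mean \<pi> ?f = mean (bind_pmf \<pi> K) ?f"
    unfolding mean_bind_bounded[of ?f 1, OF f] by (rule LIMSEQ_unique)
  then show "pmf (bind_pmf \<pi> K) y = pmf \<pi> y"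
    by (simp add: pmf.rep_eq)
qed

lemma converges_imp_support:
  assumes conv: "converges_in_distribution X \<pi>" and sub: "\<And>t. set_pmf (X t) \<subseteq> Q"
  shows "set_pmf \<pi> \<subseteq> Q"
proof -
  let ?f = "indicator (- Q) :: _ \<Rightarrow> real"
  have "(\<lambda>t. mean (X t) ?f) \<longlonglongrightarrow> mean \<pi> ?f"
    by (rule converges_expectation[OF conv, where c = 1]) (simp add: indicator_def)
  moreover have "mean (X t) ?f = 0" for t
    using sub[of t] by (simp add: measure_pmf_zero_iff) blast
  ultimately have "mean \<pi> ?f = 0"
    by (simp add: LIMSEQ_const_iff)
  then show ?thesis by (simp add: measure_pmf_zero_iff) blast
qed

lemma expected_total_eq:
  assumes "integrable (measure_pmf \<pi>) (total n)"
  shows "expected_total n \<pi> = ereal (mean \<pi> (total n))"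
  using assms unfolding expected_total_def
  by (subst nn_integral_eq_integral) (auto simp: total_nonneg enn2ereal_ennreal)

lemma integrable_total_cases:
  "expected_total n \<pi> = \<infinity> \<or> integrable (measure_pmf \<pi>) (total n)"
proof (cases "(\<integral>\<^sup>+ q. ennreal (total n q) \<partial>measure_pmf \<pi>) = \<infinity>")
  case False
  then have "integrable (measure_pmf \<pi>) (total n)"
    by (intro integrableI_nonneg) (auto simp: total_nonneg top.not_eq_extremum)
  then show ?thesis by simp
qed (simp add: expected_total_def)

context bernoulli_switch
begin

text \<open>A feasible schedule removes at most one unit from a row, so the row sum dominates that
  of a single-server queue with the same arrivals, and the test function is monotone.\<close>

lemma row_drift:
  assumes s: "s \<in> feasible n" and i: "i \<in> {1..n}" and M: "1 \<le> M"
  defines "W \<equiv> \<lambda>q :: arr. row_sum n (real_arr q) i"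
  shows "huber M (W q) + W q - 2 * slack * min (W q) M - slack
      + (if W q + n \<le> M then slack + (real n * lam)\<^sup>2 * (1 - 1 / real n) else 0)
    \<le> E (\<lambda>a. huber M (W (served q s a)) + W (served q s a))"
proof -
  have W0: "0 \<le> W q" for q by (simp add: W_def row_sum_def sum_nonneg)
  let ?r = "\<lambda>a. huber M (W q) + W q + 2 * min (W q) M * (W a - 1) + (W a - 1)
      + (if W q + n \<le> M then (W a - 1)\<^sup>2 else 0)"
  have pw: "?r a \<le> huber M (W (served q s a)) + W (served q s a)" if a: "a \<in> set_pmf arrivals" for a
  proof -
    define k where "k = (\<Sum>j=1..n. q (i, j) + a (i, j))"
    have k: "real k = W q + W a" by (simp add: k_def W_def row_sum_def sum.distrib)
    have "k \<le> (\<Sum>j=1..n. served q s a (i, j) + s (i, j))"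
      unfolding k_def served_def by (intro sum_mono) simp
    also have "\<dots> \<le> (\<Sum>j=1..n. served q s a (i, j)) + 1"
      using s i by (simp add: sum.distrib feasible_def)
    finally have le: "real (k - 1) \<le> W (served q s a)"
      by (simp add: W_def row_sum_def flip: of_nat_sum)
    \<comment> \<open>This is the purpose of the linear term: \<open>w\<^sup>2 + w\<close> takes the
      same value at -1 and at 0, so replacing \<open>k - 1\<close> by its positive part at
      \<open>k = 0\<close> costs nothing.\<close>
    have "huber M (real k - 1) + (real k - 1) \<le> huber M (real (k - 1)) + real (k - 1)"
      using M by (cases k) (auto simp: huber_def)
    also have "\<dots> \<le> huber M (W (served q s a)) + W (served q s a)"
      using le M by (intro add_mono huber_mono) auto
    finally have 1: "huber M (W q + (W a - 1)) + (W q + (W a - 1)) \<le> huber M (W (served q s a)) + W (served q s a)"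
      by (simp add: k algebra_simps)
    have "a (i, j) \<le> 1" for j
    proof -
      have "a (i, j) = 0 \<or> a (i, j) = 1" using a by (simp add: set_arrivals)
      then show ?thesis by auto
    qed
    then have "(\<Sum>j=1..n. real (a (i, j))) \<le> (\<Sum>j=1..n. 1)" by (intro sum_mono) simp
    then have "W a \<le> n" by (simp add: W_def row_sum_def)
    \<comment> \<open>A row gains at most \<open>n\<close> in a slot, so
      \<open>W q + n \<le> M\<close> keeps both ends in the quadratic range of
      \<open>huber M\<close>.\<close>
    then have "(if W q + n \<le> M then (W a - 1)\<^sup>2 else 0)
        \<le> (if W q \<le> M \<and> W q + (W a - 1) \<le> M then (W a - 1)\<^sup>2 else 0)"
      by auto
    then show ?thesis using huber_tangent[of M "W q" "W a - 1"] 1 by linarith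
  qed
  have EW: "E W = real n * lam" using E_row[OF i] by (simp add: W_def)
  \<comment> \<open>The second moment of a binomial variable about 1. Its summand
    \<open>slack\<close> is cancelled by the mean of the linear term, which leaves the squared load
    times \<open>1 - 1 / real n\<close>.\<close>
  have EW2: "E (\<lambda>a. (W a - 1)\<^sup>2) = slack + (real n * lam)\<^sup>2 * (1 - 1 / real n)"
  proof -
    have "E (\<lambda>a. (W a - 1)\<^sup>2) = E (\<lambda>a. (W a)\<^sup>2) - 2 * (real n * lam) + 1"
      by (simp add: power2_diff flip: EW)
    also have "E (\<lambda>a. (W a)\<^sup>2) = real n * lam + real n * (real n - 1) * lam\<^sup>2"
      unfolding W_def by (rule E_row_sq[OF i])
    also have "real n * lam + real n * (real n - 1) * lam\<^sup>2 - 2 * (real n * lam) + 1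
        = slack + (real n * lam)\<^sup>2 * (1 - 1 / real n)"
      using n_pos by (simp add: slack_def field_simps power2_eq_square)
    finally show ?thesis .
  qed
  have "E ?r \<le> E (\<lambda>a. huber M (W (served q s a)) + W (served q s a))"
    by (intro mean_mono_finite finite_arrivals pw)
  also have "E ?r = huber M (W q) + W q + 2 * min (W q) M * (E W - 1) + (E W - 1)
      + (if W q + n \<le> M then E (\<lambda>a. (W a - 1)\<^sup>2) else 0)"
    by (cases "W q + n \<le> M") simp_all
  finally show ?thesis
    unfolding EW EW2 by (simp add: slack_def algebra_simps)
qed

text \<open>The test function grows linearly, so it is integrable and its drift has mean zero;
  letting the cut-off grow recovers the full variance term.\<close>

lemma row_lower_bound:
  assumes pol: "scheduling_policy n pol" and st: "stationary (kernel pol) \<pi>"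
    and sub: "set_pmf \<pi> \<subseteq> queues n" and int: "integrable (measure_pmf \<pi>) (total n)"
    and i: "i \<in> {1..n}"
  shows "integrable (measure_pmf \<pi>) (\<lambda>q. row_sum n (real_arr q) i)"
    and "(real n * lam)\<^sup>2 * (1 - 1 / real n) \<le> 2 * slack * mean \<pi> (\<lambda>q. row_sum n (real_arr q) i)"
proof -
  interpret finite_step_chain "kernel pol" "queues n" by (rule policy_chain[OF pol])
  define W where "W = (\<lambda>q :: arr. row_sum n (real_arr q) i)"
  define e2 where "e2 = slack + (real n * lam)\<^sup>2 * (1 - 1 / real n)"
  let ?E = "mean \<pi>"
  have n1: "1 / real n \<le> 1" using n_pos by simp
  have e2: "0 \<le> e2" unfolding e2_def using slack_pos n1 by (intro add_nonneg_nonneg mult_nonneg_nonneg) auto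
  have W0: "0 \<le> W q" for q by (simp add: W_def row_sum_def sum_nonneg)
  have Wle: "W q \<le> total n q" for q
    unfolding W_def total_def sum_row_sum[symmetric] using i
    by (intro member_le_sum) (auto simp: row_sum_def sum_nonneg)
  have iW: "integrable (measure_pmf \<pi>) W"
    by (rule Bochner_Integration.integrable_bound[OF int]) (auto intro!: AE_I2 simp: W0 Wle total_nonneg)
  have EW0: "0 \<le> ?E W" by (simp add: W0)
  have fin: "e2 - slack \<le> 2 * slack * ?E W + e2 * ?E W / m" if m: "m \<ge> 1" for m :: real
  proof -
    \<comment> \<open>Now \<open>W q \<le> m\<close> is the quadratic range and
      \<open>1 - W q / m\<close> lies below its indicator on \<open>W q \<ge> 0\<close>, so the loss
      is at most \<open>e2 * W q / m\<close>, which vanishes as \<open>m\<close> grows.\<close>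
    define M where "M = real n + m"
    have M: "1 \<le> M" using m by (simp add: M_def)
    define \<theta> where "\<theta> = (\<lambda>q. huber M (W q) + W q)"
    have \<theta>0: "0 \<le> \<theta> q" for q using huber_nonneg[of M "W q"] W0[of q] M by (simp add: \<theta>_def)
    have "integrable (measure_pmf \<pi>) (\<lambda>q. (2 * M + 1) * W q)" using iW by simp
    then have i\<theta>: "integrable (measure_pmf \<pi>) \<theta>"
      by (rule Bochner_Integration.integrable_bound)
         (use M huber_le[of M "W _"] \<theta>0 W0 in \<open>auto intro!: AE_I2 simp: abs_of_nonneg \<theta>_def algebra_simps\<close>)
    note s\<theta> = stationary_step_nonneg[OF st sub \<theta>0 i\<theta>]
    have low: "\<theta> q - 2 * slack * W q - slack + e2 * (1 - W q / m) \<le> step \<theta> q" if q: "q \<in> queues n" for q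
    proof -
      have polq: "set_pmf (pol q) \<subseteq> feasible n" using pol q by (simp add: scheduling_policy_def)
      have finq: "finite (set_pmf (pol q))" using finite_subset[OF polq finite_feasible] .
      let ?b = "\<theta> q - 2 * slack * W q - slack + e2 * (1 - W q / m)"
      have b: "?b \<le> E (\<lambda>a. \<theta> (served q s a))" if "s \<in> set_pmf (pol q)" for s
      proof -
        have "2 * slack * min (W q) M \<le> 2 * slack * W q" using slack_pos by (intro mult_left_mono) auto
        moreover have "e2 * (1 - W q / m) \<le> (if W q + n \<le> M then e2 else 0)"
        proof (cases "W q + n \<le> M")
          case True
          have "e2 * (1 - W q / m) \<le> e2 * 1" using e2 W0[of q] m by (intro mult_left_mono) auto
          then show ?thesis using True by simp
        next
          case False
          then have "1 - W q / m \<le> 0" using m by (simp add: M_def field_simps)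
          then show ?thesis using False e2 by (simp add: mult_nonneg_nonpos)
        qed
        ultimately show ?thesis
          using row_drift[of s i M q] that polq i M unfolding \<theta>_def W_def e2_def by fastforce
      qed
      have "?b = mean (pol q) (\<lambda>_. ?b)" by simp
      also have "\<dots> \<le> mean (pol q) (\<lambda>s. E (\<lambda>a. \<theta> (served q s a)))"
        by (intro mean_mono_finite finq b)
      also have "\<dots> = step \<theta> q" by (rule E_kernel[of pol q, OF finq, symmetric])
      finally show ?thesis .
    qed
    have "?E (\<lambda>q. \<theta> q - 2 * slack * W q - slack + e2 * (1 - W q / m)) \<le> ?E (step \<theta>)"
    proof (intro integral_mono_AE AE_pmfI)
      show "integrable (measure_pmf \<pi>) (\<lambda>q. \<theta> q - 2 * slack * W q - slack + e2 * (1 - W q / m))"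
        using i\<theta> iW by simp
    qed (use s\<theta>(1) low sub in auto)
    then show ?thesis using s\<theta>(2) i\<theta> iW by (simp add: algebra_simps)
  qed
  show "integrable (measure_pmf \<pi>) (\<lambda>q. row_sum n (real_arr q) i)" using iW by (simp add: W_def)
  have "(\<lambda>m. 2 * slack * ?E W + e2 * ?E W / real m) \<longlonglongrightarrow> 2 * slack * ?E W + 0"
    by (intro tendsto_add tendsto_const lim_const_over_n)
  then have "e2 - slack \<le> 2 * slack * ?E W + 0"
    by (rule LIMSEQ_le_const) (auto intro!: exI[of _ 1] fin)
  then show "(real n * lam)\<^sup>2 * (1 - 1 / real n) \<le> 2 * slack * mean \<pi> (\<lambda>q. row_sum n (real_arr q) i)"
    by (simp add: e2_def W_def)
qed

text \<open>Either the mean is infinite, or the single-server bounds for the \<open>n\<close> rows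
  add up.\<close>

lemma universal_lower_bound:
  assumes pol: "scheduling_policy n pol" and st: "stationary (kernel pol) \<pi>"
    and sub: "set_pmf \<pi> \<subseteq> queues n"
  shows "ereal ((real n * lam)\<^sup>2 * (real n - 1) / (2 * slack)) \<le> expected_total n \<pi>"
  using integrable_total_cases[of n \<pi>]
proof
  assume int: "integrable (measure_pmf \<pi>) (total n)"
  note row = row_lower_bound[OF pol st sub int]
  have "(real n * lam)\<^sup>2 * (real n - 1) = (\<Sum>i=1..n. (real n * lam)\<^sup>2 * (1 - 1 / real n))"
    using n_pos by (simp add: field_simps)
  also have "\<dots> \<le> (\<Sum>i=1..n. 2 * slack * mean \<pi> (\<lambda>q. row_sum n (real_arr q) i))"
    by (intro sum_mono row(2))
  also have "\<dots> = 2 * slack * mean \<pi> (\<lambda>q. \<Sum>i=1..n. row_sum n (real_arr q) i)"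
    using row(1) by (simp add: sum_distrib_left)
  also have "(\<lambda>q. \<Sum>i=1..n. row_sum n (real_arr q) i) = total n"
    by (rule ext) (simp only: sum_row_sum total_def)
  finally show ?thesis
    unfolding expected_total_eq[OF int] using slack_pos by (simp add: divide_simps mult.commute)
qed simp

end

section \<open>The heavy-traffic sequence of switches\<close>

lemma heavy_kernel_switch:
  assumes n: "n > 0" and small: "0 < \<gamma> n * real n powr (- \<beta>)" "\<gamma> n * real n powr (- \<beta>) < 1"
  shows "bernoulli_switch n (load \<beta> \<gamma> n / n)"
    and "heavy_kernel \<beta> \<gamma> pol n = bernoulli_switch.kernel n (load \<beta> \<gamma> n / n) (pol n)"
    and "bernoulli_switch.slack n (load \<beta> \<gamma> n / n) = \<gamma> n * real n powr (- \<beta>)"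
proof -
  show b: "bernoulli_switch n (load \<beta> \<gamma> n / n)"
    using assms by unfold_locales (auto simp: load_def)
  have "bernoulli_arrivals \<beta> \<gamma> n = (\<lambda>_. map_pmf of_bool (bernoulli_pmf (load \<beta> \<gamma> n / n)))"
    by (rule ext) (simp add: bernoulli_arrivals_def)
  then show "heavy_kernel \<beta> \<gamma> pol n = bernoulli_switch.kernel n (load \<beta> \<gamma> n / n) (pol n)"
    by (simp add: heavy_kernel_def bernoulli_switch.kernel_def[OF b])
  show "bernoulli_switch.slack n (load \<beta> \<gamma> n / n) = \<gamma> n * real n powr (- \<beta>)"
    unfolding bernoulli_switch.slack_def[OF b] using n by (simp add: load_def)
qed

lemma heavy_lower_bound:
  assumes n: "n > 0" and small: "0 < \<gamma> n * real n powr (- \<beta>)" "\<gamma> n * real n powr (- \<beta>) < 1"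
    and ss: "stable_with_steady_state \<beta> \<gamma> pol \<mu> \<pi>"
  shows "ereal ((1 - \<gamma> n * real n powr (- \<beta>))\<^sup>2 / (2 * \<gamma> n) * real n powr \<beta> * (real n - 1))
    \<le> expected_total n (\<pi> n)"
proof -
  note hk = heavy_kernel_switch[where \<gamma> = \<gamma> and \<beta> = \<beta>, OF n small]
  interpret bernoulli_switch n "load \<beta> \<gamma> n / n" by (rule hk(1))
  have pol: "scheduling_policy n (pol n)" and \<mu>: "set_pmf (\<mu> n) \<subseteq> queues n"
    and conv: "converges_in_distribution (chain_law (kernel (pol n)) (\<mu> n)) (\<pi> n)"
    using ss n unfolding stable_with_steady_state_def hk(2)[where pol = pol, symmetric] by auto
  interpret finite_step_chain "kernel (pol n)" "queues n" by (rule policy_chain[OF pol])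
  have "set_pmf (chain_law (kernel (pol n)) (\<mu> n) t) \<subseteq> queues n" for t
    by (induction t) (use \<mu> closed in auto)
  note sub = converges_imp_support[OF conv this]
  have "ereal ((real n * (load \<beta> \<gamma> n / n))\<^sup>2 * (real n - 1) / (2 * slack)) \<le> expected_total n (\<pi> n)"
    by (rule universal_lower_bound[OF pol converges_imp_stationary[OF conv] sub])
  also have "(real n * (load \<beta> \<gamma> n / n))\<^sup>2 * (real n - 1) / (2 * slack)
      = (1 - \<gamma> n * real n powr (- \<beta>))\<^sup>2 / (2 * \<gamma> n) * real n powr \<beta> * (real n - 1)"
    unfolding hk(3) using n by (simp add: load_def powr_minus divide_simps)
  finally show ?thesis .
qed

lemma heavy_lower_bound_scaling:
  assumes \<beta>: "\<beta> > 0" and c2: "c2 > 0" and upper: "\<forall>\<^sub>F n in sequentially. \<gamma> n \<le> c2"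
    and pos: "\<And>n. n > 0 \<Longrightarrow> \<gamma> n > 0"
    and small: "\<And>n. n > 0 \<Longrightarrow> 0 < \<gamma> n * real n powr (- \<beta>) \<and> \<gamma> n * real n powr (- \<beta>) < 1"
    and ss: "stable_with_steady_state \<beta> \<gamma> pol \<mu> \<pi>"
  shows "\<forall>\<^sub>F n in sequentially. ereal (1 / (16 * c2) * real n powr (1 + \<beta>)) \<le> expected_total n (\<pi> n)"
proof -
  have "(\<lambda>n. c2 * real n powr (- \<beta>)) \<longlonglongrightarrow> c2 * 0"
    using \<beta> by (intro tendsto_mult tendsto_const tendsto_neg_powr filterlim_real_sequentially) auto
  then have "\<forall>\<^sub>F n in sequentially. c2 * real n powr (- \<beta>) < 1 / 2"
    by (intro order_tendstoD(2)) auto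
  then show ?thesis
    using upper eventually_ge_at_top[of 2]
  proof eventually_elim
    case (elim n)
    then have n: "n > 0" by simp
    note sm = small[OF n, THEN conjunct1] small[OF n, THEN conjunct2]
    have "\<gamma> n * real n powr (- \<beta>) \<le> c2 * real n powr (- \<beta>)"
      using elim by (intro mult_right_mono) auto
    then have l: "1 / 2 \<le> 1 - \<gamma> n * real n powr (- \<beta>)" using elim by linarith
    \<comment> \<open>For large \<open>n\<close> the load is at least 1/2, \<open>\<gamma> n\<close>
      at most \<open>c2\<close> and \<open>n - 1\<close> at least \<open>n / 2\<close>; 16 collects
      these factors.\<close>
    have "1 / (16 * c2) * real n powr (1 + \<beta>) = (1 / 2)\<^sup>2 / (2 * c2) * real n powr \<beta> * (real n / 2)"
      using n c2 by (simp add: powr_add power2_eq_square field_simps)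
    also have "\<dots> \<le> (1 - \<gamma> n * real n powr (- \<beta>))\<^sup>2 / (2 * \<gamma> n) * real n powr \<beta> * (real n - 1)"
      using l pos[OF n] elim c2
      by (intro mult_mono frac_le power_mono mult_nonneg_nonneg divide_nonneg_pos) auto
    finally show ?case
      using heavy_lower_bound[where n = n and \<gamma> = \<gamma> and \<beta> = \<beta>, OF n sm ss] by (meson ereal_less_eq(3) order_trans)
  qed
qed

lemma heavy_upper_scaling:
  fixes \<beta> c1 c2 :: real and \<gamma> :: "nat \<Rightarrow> real"
  assumes \<beta>: "\<beta> > 4" and c1: "c1 > 0" and c2: "c2 > 0"
    and lower: "\<forall>\<^sub>F n in sequentially. c1 \<le> \<gamma> n" and upper: "\<forall>\<^sub>F n in sequentially. \<gamma> n \<le> c2"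
    and small: "\<And>n. n > 0 \<Longrightarrow> 0 < \<gamma> n * real n powr (- \<beta>) \<and> \<gamma> n * real n powr (- \<beta>) < 1"
    and st: "\<And>n. n > 0 \<Longrightarrow> stationary (heavy_kernel \<beta> \<gamma> max_weight n) (\<pi> n)"
    and sub: "\<And>n. n > 0 \<Longrightarrow> set_pmf (\<pi> n) \<subseteq> queues n"
  shows "(\<lambda>n. mean (\<pi> n) (total n) - real n powr (1 + \<beta>) / \<gamma> n)
    \<in> o(\<lambda>n. real n powr (1 + \<beta>))"
proof -
  \<comment> \<open>With S = n^(3 + \<delta>) and \<delta> half of \<beta> - 4, the exponent 3 +
    \<delta> is strictly between 3 and \<beta> - 1, and all four exponents in \<open>R\<close> are
    below 1 + \<beta>.\<close>
  define \<delta> where "\<delta> = (\<beta> - 4) / 2"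
  have \<delta>: "\<delta> > 0" using \<beta> by (simp add: \<delta>_def)
  define R where "R = (\<lambda>n. 3 / (2 * c1) * real n powr \<beta> + 64080 / (2 * c1) * real n powr (1 - 2 * \<delta> + \<beta>)
    + 2 * real n powr 1 + 4 * real n powr (5 + \<delta>))"
  have pw: "(\<lambda>n. c * real n powr p) \<in> o(\<lambda>n. real n powr (1 + \<beta>))" if "p < 1 + \<beta>" for c p
  proof -
    have "(\<lambda>n. real n powr p) \<in> o(\<lambda>n. real n powr (1 + \<beta>))"
      using that by (subst powr_smallo_iff) (auto intro: filterlim_real_sequentially)
    then show ?thesis by (cases "c = 0") simp_all
  qed
  have "R \<in> o(\<lambda>n. real n powr (1 + \<beta>))"
    unfolding R_def using \<beta> by (intro sum_in_smallo pw) (auto simp: \<delta>_def field_simps)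
  moreover have "(\<lambda>n. mean (\<pi> n) (total n) - real n powr (1 + \<beta>) / \<gamma> n) \<in> O(R)"
  proof (rule bigoI[where c = 1])
    have "(\<lambda>n. c2 * real n powr (1 - \<beta>)) \<longlonglongrightarrow> c2 * 0"
      using \<beta> by (intro tendsto_mult tendsto_const tendsto_neg_powr filterlim_real_sequentially) auto
    then have "\<forall>\<^sub>F n in sequentially. c2 * real n powr (1 - \<beta>) < 1 / 2"
      by (intro order_tendstoD(2)) auto
    then show "\<forall>\<^sub>F n in sequentially. norm (mean (\<pi> n) (total n) - real n powr (1 + \<beta>) / \<gamma> n)
        \<le> 1 * norm (R n)"
      using lower upper eventually_gt_at_top[of 0]
    proof eventually_elim
      case (elim n)
      then have n: "n > 0" by simp
      note sm = small[OF n, THEN conjunct1] small[OF n, THEN conjunct2]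
      note hk = heavy_kernel_switch[where \<gamma> = \<gamma> and \<beta> = \<beta>, OF n sm]
      interpret bernoulli_switch n "load \<beta> \<gamma> n / n" by (rule hk(1))
      define T where "T = mean (\<pi> n) (total n)"
      define S where "S = real n powr (3 + \<delta>)"
      have S: "0 < S" using n by (simp add: S_def)
      have \<gamma>: "0 < \<gamma> n" using elim c1 by linarith
      \<comment> \<open>As \<gamma> is bounded and \<beta> > 1, the slack is below 1/(2n) for large
        n, as state space collapse requires.\<close>
      have "real n * slack = \<gamma> n * real n powr (1 - \<beta>)"
        unfolding hk(3) using n by (simp add: powr_diff powr_minus divide_simps)
      also have "\<dots> \<le> c2 * real n powr (1 - \<beta>)" using elim by (intro mult_right_mono) auto
      also have "\<dots> \<le> 1 / 2" using elim by simp
      finally have sl: "slack \<le> 1 / real (2 * n)" using n by (simp add: field_simps)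
      have "\<bar>2 * slack * T - 2 * real n\<bar>
          \<le> 3 + 2 * real n * slack + 64080 * real n ^ 7 / S\<^sup>2 + (8 * real n * S + 2) * (real n * slack)"
        unfolding T_def using st[OF n] sub[OF n] by (intro heavy_traffic_bound sl S) (simp_all add: hk(2))
      also have "\<dots> = 2 * slack * ((3 + 64080 * real n ^ 7 / S\<^sup>2) / (2 * slack) + 2 * real n + 4 * real n * S * real n)"
        using slack_pos by (simp add: field_simps)
      finally have "\<bar>2 * slack * (T - real n / slack)\<bar> \<le> 2 * slack * ((3 + 64080 * real n ^ 7 / S\<^sup>2) / (2 * slack) + 2 * real n + 4 * real n * S * real n)"
        using slack_pos by (simp add: algebra_simps)
      then have b: "\<bar>T - real n / slack\<bar> \<le> (3 + 64080 * real n ^ 7 / S\<^sup>2) / (2 * slack) + 2 * real n + 4 * real n * S * real n"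
        using slack_pos by (simp add: abs_mult)
      have inv: "1 / slack = real n powr \<beta> / \<gamma> n"
        unfolding hk(3) using n by (simp add: powr_minus divide_simps)
      have ns: "real n / slack = real n powr (1 + \<beta>) / \<gamma> n"
      proof -
        have "real n / slack = real n * (1 / slack)" by simp
        also have "\<dots> = real n powr (1 + \<beta>) / \<gamma> n" unfolding inv using n by (simp add: powr_add)
        finally show ?thesis .
      qed
      have "1 / slack \<le> real n powr \<beta> / c1"
        unfolding inv using elim c1 by (intro divide_left_mono) auto
      then have "(3 + 64080 * real n ^ 7 / S\<^sup>2) / 2 * (1 / slack) \<le> (3 + 64080 * real n ^ 7 / S\<^sup>2) / 2 * (real n powr \<beta> / c1)"
        by (intro mult_left_mono) auto
      moreover have "64080 * real n ^ 7 / S\<^sup>2 = 64080 * real n powr (1 - 2 * \<delta>)"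
      proof -
        have "real n ^ 7 = real n powr 7" using n by simp
        moreover have "S\<^sup>2 = real n powr (6 + 2 * \<delta>)"
          by (simp add: S_def power2_eq_square flip: powr_add)
        ultimately have "real n ^ 7 / S\<^sup>2 = real n powr (7 - (6 + 2 * \<delta>))"
          by (simp only: powr_diff)
        then show ?thesis by simp
      qed
      moreover have "real n * S * real n = real n powr (5 + \<delta>)"
      proof -
        have "real n * S * real n = real n powr 1 * real n powr (3 + \<delta>) * real n powr 1"
          using n by (simp add: S_def)
        also have "\<dots> = real n powr (1 + (3 + \<delta>) + 1)" by (simp only: powr_add)
        finally show ?thesis by simp
      qed
      ultimately have "(3 + 64080 * real n ^ 7 / S\<^sup>2) / (2 * slack) + 2 * real n + 4 * real n * S * real n
          \<le> (3 + 64080 * real n powr (1 - 2 * \<delta>)) / 2 * (real n powr \<beta> / c1) + 2 * real n + 4 * real n powr (5 + \<delta>)"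
        by (simp add: mult.assoc)
      also have "\<dots> = R n"
      proof -
        have "real n powr (1 - 2 * \<delta> + \<beta>) = real n powr (1 - 2 * \<delta>) * real n powr \<beta>" by (rule powr_add)
        then show ?thesis using n by (simp add: R_def algebra_simps add_divide_distrib)
      qed
      finally have "\<bar>T - real n powr (1 + \<beta>) / \<gamma> n\<bar> \<le> R n"
        using b unfolding ns by linarith
      then show ?case by (simp add: T_def)
    qed
  qed
  ultimately show ?thesis by (rule landau_o.big_small_trans[rotated])
qed

theorem corollary1:
  fixes \<beta> :: real and \<gamma> :: "nat \<Rightarrow> real"
  assumes "\<beta> > 0"
    and "\<And>n. n > 0 \<Longrightarrow> \<gamma> n > 0"
    and "\<gamma> \<in> \<Theta>(\<lambda>_. 1)"
    and "\<And>n. n > 0 \<Longrightarrow> 0 < \<gamma> n * real n powr (- \<beta>) \<and> \<gamma> n * real n powr (- \<beta>) < 1"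
  shows
    "(\<forall>pol \<mu> \<pi>. stable_with_steady_state \<beta> \<gamma> pol \<mu> \<pi> \<longrightarrow>
        (\<forall>n>0. ereal ((1 - \<gamma> n * real n powr (- \<beta>))\<^sup>2 / (2 * \<gamma> n) * real n powr \<beta> * (real n - 1))
                \<le> expected_total n (\<pi> n)) \<and>
        (\<exists>c>0. \<forall>\<^sub>F n in sequentially.
           ereal (c * real n powr (1 + \<beta>)) \<le> expected_total n (\<pi> n))) \<and>
     (\<exists>\<pi>.
        (\<forall>n>0.
           (\<forall>x \<in> reachable (heavy_kernel \<beta> \<gamma> max_weight n) (\<lambda>_. 0).
              positive_recurrent (heavy_kernel \<beta> \<gamma> max_weight n) x) \<and>
           stationary (heavy_kernel \<beta> \<gamma> max_weight n) (\<pi> n) \<and>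
           (\<forall>\<mu>. set_pmf \<mu> \<subseteq> queues n \<longrightarrow>
              converges_in_distribution (chain_law (heavy_kernel \<beta> \<gamma> max_weight n) \<mu>) (\<pi> n))) \<and>
        (\<beta> > 4 \<longrightarrow>
           (\<exists>B\<^sub>3 B\<^sub>4. B\<^sub>3 \<in> o(\<lambda>n. real n powr (1 + \<beta>)) \<and> B\<^sub>4 \<in> o(\<lambda>n. real n powr (1 + \<beta>)) \<and>
              (\<forall>n>0. 2 * \<gamma> n \<le> real n powr (\<beta> - 1) \<longrightarrow>
                 ereal (real n powr (1 + \<beta>) / \<gamma> n - B\<^sub>3 n) \<le> expected_total n (\<pi> n) \<and>
                 expected_total n (\<pi> n) \<le> ereal (real n powr (1 + \<beta>) / \<gamma> n + B\<^sub>4 n))) \<and>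
           (\<forall>\<^sub>F n in sequentially. expected_total n (\<pi> n) \<noteq> \<infinity>) \<and>
           (\<lambda>n. real_of_ereal (expected_total n (\<pi> n))) \<in> \<Theta>(\<lambda>n. real n powr (1 + \<beta>)) \<and>
           (\<forall>pol \<mu> \<pi>'. stable_with_steady_state \<beta> \<gamma> pol \<mu> \<pi>' \<longrightarrow>
              (\<exists>C>0. \<forall>\<^sub>F n in sequentially.
                 expected_total n (\<pi> n) \<le> ereal C * expected_total n (\<pi>' n)))))"
proof -
  obtain c1 c2 where c: "c1 > 0" "c2 > 0"
    and lower: "\<forall>\<^sub>F n in sequentially. c1 \<le> \<gamma> n" and upper: "\<forall>\<^sub>F n in sequentially. \<gamma> n \<le> c2"
  proof -
    obtain c1 c2 where c: "c1 > 0" "c2 > 0" "\<forall>\<^sub>F n in sequentially. norm (\<gamma> n) \<le> c2 * norm (1 :: real)"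
      "\<forall>\<^sub>F n in sequentially. c1 * norm (1 :: real) \<le> norm (\<gamma> n)"
      using bigthetaD1[OF assms(3)] bigthetaD2[OF assms(3)] by (elim landau_o.bigE landau_omega.bigE)
    have abs: "\<forall>\<^sub>F n in sequentially. \<bar>\<gamma> n\<bar> = \<gamma> n"
      using eventually_gt_at_top[of 0] by eventually_elim (simp add: assms(2) less_imp_le)
    show ?thesis
    proof (rule that[OF c(1,2)])
      show "\<forall>\<^sub>F n in sequentially. c1 \<le> \<gamma> n" using c(4) abs by eventually_elim simp
      show "\<forall>\<^sub>F n in sequentially. \<gamma> n \<le> c2" using c(3) abs by eventually_elim simp
    qed
  qed
  have lower_scaling: "\<forall>\<^sub>F n in sequentially. ereal (1 / (16 * c2) * real n powr (1 + \<beta>)) \<le> expected_total n (\<pi> n)"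
    if "stable_with_steady_state \<beta> \<gamma> pol \<mu> \<pi>" for pol \<mu> \<pi>
    by (rule heavy_lower_bound_scaling[OF assms(1) c(2) upper assms(2,4) that])
  let ?K = "heavy_kernel \<beta> \<gamma> max_weight"
  have "\<exists>\<pi>. stationary (?K n) \<pi> \<and> set_pmf \<pi> \<subseteq> queues n \<and>
     (\<forall>x\<in>reachable (?K n) (\<lambda>_. 0). positive_recurrent (?K n) x) \<and>
     (\<forall>\<mu>. set_pmf \<mu> \<subseteq> queues n \<longrightarrow> converges_in_distribution (chain_law (?K n) \<mu>) \<pi>)" if "n > 0" for n
  proof -
    note hk = heavy_kernel_switch[where \<gamma> = \<gamma> and \<beta> = \<beta>, OF that assms(4)[OF that, THEN conjunct1] assms(4)[OF that, THEN conjunct2]]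
    show ?thesis unfolding hk(2) by (rule bernoulli_switch.max_weight_recurrent[OF hk(1)])
  qed
  then obtain \<pi> where \<pi>: "\<And>n. n > 0 \<Longrightarrow> stationary (?K n) (\<pi> n)" "\<And>n. n > 0 \<Longrightarrow> set_pmf (\<pi> n) \<subseteq> queues n"
     "\<And>n x. n > 0 \<Longrightarrow> x \<in> reachable (?K n) (\<lambda>_. 0) \<Longrightarrow> positive_recurrent (?K n) x"
     "\<And>n \<mu>. n > 0 \<Longrightarrow> set_pmf \<mu> \<subseteq> queues n \<Longrightarrow> converges_in_distribution (chain_law (?K n) \<mu>) (\<pi> n)"
    by metis
  define T where "T = (\<lambda>n. mean (\<pi> n) (total n))"
  have T: "expected_total n (\<pi> n) = ereal (T n)" if n: "n > 0" for n
  proof -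
    note hk = heavy_kernel_switch[where \<gamma> = \<gamma> and \<beta> = \<beta>, OF n assms(4)[OF n, THEN conjunct1] assms(4)[OF n, THEN conjunct2]]
    have "integrable (measure_pmf (\<pi> n)) (total n)"
      using bernoulli_switch.stationary_integrable(2)[OF hk(1)] \<pi>(1,2)[OF n] by (simp add: hk(2))
    then show ?thesis unfolding T_def by (rule expected_total_eq)
  qed
  \<comment> \<open>The deviation from the leading term; its absolute value serves as both error
    functions, so the substance of the two bounds is that \<open>D\<close> is of smaller
    order.\<close>
  define D where "D = (\<lambda>n. T n - real n powr (1 + \<beta>) / \<gamma> n)"
  have D: "D \<in> o(\<lambda>n. real n powr (1 + \<beta>))" if "\<beta> > 4"
    unfolding D_def T_def by (rule heavy_upper_scaling[OF that c lower upper assms(4) \<pi>(1,2)])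
  \<comment> \<open>The tolerance \<open>1 / (2 * c2)\<close> is half of the least leading
    coefficient \<open>1 / c2\<close>, so half of it survives as a lower bound.\<close>
  have bounds: "\<forall>\<^sub>F n in sequentially. n > 0 \<and> 1 / (2 * c2) * real n powr (1 + \<beta>) \<le> T n
        \<and> T n \<le> (1 / c1 + 1 / (2 * c2)) * real n powr (1 + \<beta>)" if "\<beta> > 4"
  proof -
    have "\<forall>\<^sub>F n in sequentially. norm (D n) \<le> 1 / (2 * c2) * norm (real n powr (1 + \<beta>))"
      using c(2) by (intro landau_o.smallD[OF D[OF that]]) auto
    then show ?thesis
      using lower upper eventually_gt_at_top[of 0]
    proof eventually_elim
      case (elim n)
      have \<gamma>: "0 < \<gamma> n" using elim c by linarith
      have "real n powr (1 + \<beta>) / c2 \<le> real n powr (1 + \<beta>) / \<gamma> n"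
        "real n powr (1 + \<beta>) / \<gamma> n \<le> real n powr (1 + \<beta>) / c1"
        using elim \<gamma> c by (auto intro!: divide_left_mono)
      moreover have "\<bar>T n - real n powr (1 + \<beta>) / \<gamma> n\<bar> \<le> 1 / (2 * c2) * real n powr (1 + \<beta>)"
        using elim by (simp add: D_def)
      moreover have "real n powr (1 + \<beta>) / c2 = 1 / (2 * c2) * real n powr (1 + \<beta>) + 1 / (2 * c2) * real n powr (1 + \<beta>)"
        using c(2) by (simp add: field_simps)
      moreover have "(1 / c1 + 1 / (2 * c2)) * real n powr (1 + \<beta>)
          = real n powr (1 + \<beta>) / c1 + 1 / (2 * c2) * real n powr (1 + \<beta>)"
        by (simp add: distrib_right)
      ultimately have "1 / (2 * c2) * real n powr (1 + \<beta>) \<le> T n"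
        "T n \<le> (1 / c1 + 1 / (2 * c2)) * real n powr (1 + \<beta>)"
        by linarith+
      then show ?case using elim by blast
    qed
  qed
  show ?thesis
  proof (intro conjI allI impI ballI exI[of _ \<pi>] exI[of _ "\<lambda>n. \<bar>D n\<bar>"] \<pi>)
    show "ereal ((1 - \<gamma> n * real n powr (- \<beta>))\<^sup>2 / (2 * \<gamma> n) * real n powr \<beta> * (real n - 1))
        \<le> expected_total n (\<pi>' n)" if "stable_with_steady_state \<beta> \<gamma> pol \<mu> \<pi>'" "n > 0" for pol \<mu> \<pi>' n
      using heavy_lower_bound[OF that(2) _ _ that(1)] assms(4)[OF that(2)] by blast
    show "\<exists>c>0. \<forall>\<^sub>F n in sequentially. ereal (c * real n powr (1 + \<beta>)) \<le> expected_total n (\<pi>' n)"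
      if "stable_with_steady_state \<beta> \<gamma> pol \<mu> \<pi>'" for pol \<mu> \<pi>'
      using lower_scaling[OF that] c(2) by (intro exI[of _ "1 / (16 * c2)"]) simp
    show "(\<lambda>n. \<bar>D n\<bar>) \<in> o(\<lambda>n. real n powr (1 + \<beta>))"
      "(\<lambda>n. \<bar>D n\<bar>) \<in> o(\<lambda>n. real n powr (1 + \<beta>))" if "\<beta> > 4"
      using D[OF that] by simp_all
    show "ereal (real n powr (1 + \<beta>) / \<gamma> n - \<bar>D n\<bar>) \<le> expected_total n (\<pi> n)" if "n > 0" for n
      unfolding T[OF that] by (simp add: D_def)
    show "expected_total n (\<pi> n) \<le> ereal (real n powr (1 + \<beta>) / \<gamma> n + \<bar>D n\<bar>)" if "n > 0" for n
      unfolding T[OF that] by (simp add: D_def)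
    show "\<forall>\<^sub>F n in sequentially. expected_total n (\<pi> n) \<noteq> \<infinity>"
      using eventually_gt_at_top[of 0] by eventually_elim (simp add: T)
    show "(\<lambda>n. real_of_ereal (expected_total n (\<pi> n))) \<in> \<Theta>(\<lambda>n. real n powr (1 + \<beta>))" if "\<beta> > 4"
    proof (rule bigthetaI'[of "1 / (2 * c2)" "1 / c1 + 1 / (2 * c2)"])
      show "\<forall>\<^sub>F n in sequentially.
          1 / (2 * c2) * norm (real n powr (1 + \<beta>)) \<le> norm (real_of_ereal (expected_total n (\<pi> n))) \<and>
          norm (real_of_ereal (expected_total n (\<pi> n))) \<le> (1 / c1 + 1 / (2 * c2)) * norm (real n powr (1 + \<beta>))"
        using bounds[OF that]
      proof eventually_elim
        case (elim n)
        have "0 \<le> T n" by (simp add: T_def total_nonneg)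
        then show ?case using elim by (simp add: T)
      qed
    qed (use c in \<open>auto intro: add_pos_pos\<close>)
    show "\<exists>C>0. \<forall>\<^sub>F n in sequentially. expected_total n (\<pi> n) \<le> ereal C * expected_total n (\<pi>' n)"
      if "\<beta> > 4" "stable_with_steady_state \<beta> \<gamma> pol \<mu> \<pi>'" for pol \<mu> \<pi>'
    proof -
      \<comment> \<open>The ratio of the upper coefficient for MaxWeight to the coefficient
        \<open>1 / (16 * c2)\<close> of the lower bound valid for every stable policy.\<close>
      define C where "C = (1 / c1 + 1 / (2 * c2)) * (16 * c2)"
      have C: "C > 0" unfolding C_def using c by (intro mult_pos_pos add_pos_pos) auto
      have "\<forall>\<^sub>F n in sequentially. expected_total n (\<pi> n) \<le> ereal C * expected_total n (\<pi>' n)"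
        using bounds[OF that(1)] lower_scaling[OF that(2)]
      proof eventually_elim
        case (elim n)
        have "expected_total n (\<pi> n) \<le> ereal ((1 / c1 + 1 / (2 * c2)) * real n powr (1 + \<beta>))"
          using elim by (simp add: T)
        also have "\<dots> = ereal C * ereal (1 / (16 * c2) * real n powr (1 + \<beta>))"
          using c by (simp add: C_def)
        also have "\<dots> \<le> ereal C * expected_total n (\<pi>' n)"
          using elim C by (intro ereal_mult_left_mono) auto
        finally show ?case .
      qed
      then show "\<exists>C>0. \<forall>\<^sub>F n in sequentially. expected_total n (\<pi> n) \<le> ereal C * expected_total n (\<pi>' n)"
        using C by blast
    qed
  qed
qed

end
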